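(* Let $n \ge 2$ and let $V \in L^\infty(\mathbb{R}^n)$ satisfy $\|V\|_{L^\infty(\mathbb{R}^n)} \le 1$. Let $C_0>0$ and assume that $u$ is a solution to $$-\Delta u + V u = 0 \quad \text{in } \mathbb{R}^n$$ such that $|u(x)| \le \exp\left(C_0 |x|^{4/3}\right)$ for all $x\in\mathbb{R}^n$, and $\|u\|_{L^2(B_1)} \ge 1$, where $B_1$ is the unit ball centered at the origin. Then there exists a constant $C = C(n, C_0) > 0$ such that for every sufficiently large $R$ (i.e. $R \ge R_0$ for some $R_0\ge 1$) and every $x_0 \in \mathbb{R}^n$ with $|x_0| = R$, $$\|u\|_{L^2(B_1(x_0))} \ge \exp\left(-C R^{4/3}\log R\right).$$
   Context: $B_r(x)$ denotes the open ball of radius $r$ centered at $x$; $B_r$ denotes the ball centered at the origin. *)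

theory Defs
  imports "HOL-Analysis.Analysis"
begin

definition partial_deriv :: "'n::finite \<Rightarrow> (real^'n \<Rightarrow> real) \<Rightarrow> real^'n \<Rightarrow> real" where
  "partial_deriv i f x = deriv (\<lambda>t. f (x + t *\<^sub>R axis i 1)) 0"

fun partials :: "'n::finite list \<Rightarrow> (real^'n \<Rightarrow> real) \<Rightarrow> real^'n \<Rightarrow> real" where
  "partials [] f = f"
| "partials (i # is) f = partial_deriv i (partials is f)"

definition smooth_fun :: "(real^'n::finite \<Rightarrow> real) \<Rightarrow> bool" where
  "smooth_fun f \<longleftrightarrow> (\<forall>is. continuous_on UNIV (partials is f) \<and>
                              (\<forall>x. partials is f differentiable (at x)))"

definition test_fun :: "(real^'n::finite \<Rightarrow> real) \<Rightarrow> bool" where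
  "test_fun f \<longleftrightarrow> smooth_fun f \<and> compact (closure {x. f x \<noteq> 0})"

definition laplacian :: "(real^'n::finite \<Rightarrow> real) \<Rightarrow> real^'n \<Rightarrow> real" where
  "laplacian f x = (\<Sum>i\<in>UNIV. partials [i, i] f x)"

text \<open>u is a (distributional) solution of  -Laplace u + V u = 0  in R^n:
  u is locally integrable and for all test functions phi,
  integral of u * Laplace phi equals integral of V * u * phi.\<close>
definition solves_schrodinger :: "(real^'n::finite \<Rightarrow> real) \<Rightarrow> (real^'n \<Rightarrow> real) \<Rightarrow> bool" where
  "solves_schrodinger V u \<longleftrightarrow>
     u \<in> borel_measurable lborel \<and>
     (\<forall>K. compact K \<longrightarrow> set_integrable lborel K u) \<and>
     (\<forall>K. compact K \<longrightarrow> set_integrable lborel K (\<lambda>x. V x * u x)) \<and>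
     (\<forall>\<phi>. test_fun \<phi> \<longrightarrow>
        (LINT x|lborel. u x * laplacian \<phi> x) = (LINT x|lborel. V x * u x * \<phi> x))"

definition L2_norm_on :: "(real^'n::finite \<Rightarrow> real) \<Rightarrow> (real^'n) set \<Rightarrow> real" where
  "L2_norm_on u S = sqrt (LINT x:S|lborel. (u x)\<^sup>2)"

end

theory Submission
  imports Defs "HOL-Computational_Algebra.Polynomial"
begin

text \<open>Center the equation at the point x0 and let s be the squared distance to it. Conjugating the
  Laplacian with the weight s^(-a-1/2) exp(b s/2) and splitting the result into a symmetric part S and
  an antisymmetric part A, the integral of S A is bounded below by 4 b times that of
  s ((2a - b s)^2 - 1) y^2. With b = a/(8 R^2) this gain of order a^3/R^2 beats the
  potential, which costs R^2, as soon as a is a large multiple of R^(4/3). Cut u off near x0 and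
  at distance about 2R; both cutoff errors are controlled by the Caccioppoli inequality. Since the unit
  ball at the origin, at distance about R from x0, carries mass 1, the outer error is absorbed: its weight
  is smaller by exp(-a), which dominates the growth exp(C R^(4/3)). What is left bounds the
  mass in the unit ball at x0 from below by the ratio of the weights at distances of order R and 1,
  that is, by exp(-C a log R). All this is carried out for mollifications of u and passed to the
  limit.\<close>

section \<open>Partial derivatives and integration by parts\<close>

text \<open>The pure power weight is a borderline case: for b = 0 the integral of S A is zero, so
  the whole gain comes from the factor exp(b s/2). How large b may be is limited by the outer
  cutoff: for s < 8 R^2 the coefficient 2a - b s has to stay at least a, and b = a/(8 R^2) is the
  largest choice that allows it; the weight is then also decreasing there. The Laplacian term
  contains s^2 V^2 u^2 and the gain only s u^2, whence the loss of a factor R^2 and, from comparing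
  a^3/R^2 with R^2, the exponent 4/3. The obstacle is that u is merely a distributional solution,
  and that a mollification of V u is not V times the mollification of u. The inequality for smooth
  functions therefore assumes no equation and keeps the Laplacian as a separate term; the potential
  is absorbed only after the limit. Formulas are written in s, not in |x|, so that radial functions
  cause no trouble at the centre.\<close>

definition has_partial :: "'n::finite \<Rightarrow> (real^'n \<Rightarrow> real) \<Rightarrow> (real^'n \<Rightarrow> real) \<Rightarrow> bool" where
  "has_partial i f f' \<longleftrightarrow> (\<forall>x. ((\<lambda>t. f (x + t *\<^sub>R axis i 1)) has_real_derivative f' x) (at 0))"

lemma has_partial_at:
  assumes "has_partial i f f'"
  shows "((\<lambda>t. f (x + t *\<^sub>R axis i 1)) has_real_derivative f' (x + t *\<^sub>R axis i 1)) (at t)"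
proof -
  have "((\<lambda>u. f ((x + t *\<^sub>R axis i 1) + u *\<^sub>R axis i 1)) has_real_derivative f' (x + t *\<^sub>R axis i 1)) (at 0)"
    using assms unfolding has_partial_def by blast
  then have "((\<lambda>u. (\<lambda>r. f (x + r *\<^sub>R axis i 1)) (t + u)) has_real_derivative f' (x + t *\<^sub>R axis i 1)) (at 0)"
    by (simp add: algebra_simps)
  then show ?thesis
    using DERIV_at_within_shift[of "\<lambda>r. f (x + r *\<^sub>R axis i 1)" _ t 0 UNIV] by simp
qed

lemma has_partial_const: "has_partial i (\<lambda>x. c) (\<lambda>x. 0)"
  by (simp add: has_partial_def)

lemma has_partial_add: "has_partial i f f' \<Longrightarrow> has_partial i g g' \<Longrightarrow> has_partial i (\<lambda>x. f x + g x) (\<lambda>x. f' x + g' x)"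
  by (auto simp: has_partial_def intro!: derivative_eq_intros)

lemma has_partial_diff: "has_partial i f f' \<Longrightarrow> has_partial i g g' \<Longrightarrow> has_partial i (\<lambda>x. f x - g x) (\<lambda>x. f' x - g' x)"
  by (auto simp: has_partial_def intro!: derivative_eq_intros)

lemma has_partial_mult:
  assumes "has_partial i f f'" "has_partial i g g'" shows "has_partial i (\<lambda>x. f x * g x) (\<lambda>x. f' x * g x + f x * g' x)"
  unfolding has_partial_def
proof
  fix x
  show "((\<lambda>t. f (x + t *\<^sub>R axis i 1) * g (x + t *\<^sub>R axis i 1)) has_real_derivative f' x * g x + f x * g' x) (at 0)"
    using DERIV_mult[of "\<lambda>t. f (x + t *\<^sub>R axis i 1)" "f' x" 0 UNIV "\<lambda>t. g (x + t *\<^sub>R axis i 1)" "g' x"] assms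
    by (simp add: has_partial_def algebra_simps)
qed

lemma has_partial_sum: "(\<And>j. j \<in> A \<Longrightarrow> has_partial i (f j) (f' j)) \<Longrightarrow> has_partial i (\<lambda>x. \<Sum>j\<in>A. f j x) (\<lambda>x. \<Sum>j\<in>A. f' j x)"
  unfolding has_partial_def by (auto intro!: DERIV_sum)

lemma has_partial_chain:
  assumes "has_partial i f f'" "\<And>t. (g has_real_derivative g' t) (at t)"
  shows "has_partial i (\<lambda>x. g (f x)) (\<lambda>x. g' (f x) * f' x)"
  unfolding has_partial_def
proof
  fix x
  show "((\<lambda>t. g (f (x + t *\<^sub>R axis i 1))) has_real_derivative g' (f x) * f' x) (at 0)"
    using DERIV_chain'[of "\<lambda>t. f (x + t *\<^sub>R axis i 1)" "f' x" 0 UNIV g "g' (f x)"] assms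
    by (simp add: has_partial_def mult.commute)
qed

lemma has_partial_coord: "has_partial i (\<lambda>x. x $ j) (\<lambda>x. if j = i then 1 else 0)"
  unfolding has_partial_def by (auto simp: axis_def intro!: derivative_eq_intros)

lemma has_partial_inner_self: "has_partial i (\<lambda>x. x \<bullet> x) (\<lambda>x. 2 * x $ i)"
  unfolding has_partial_def inner_add_left inner_add_right
  by (auto simp: inner_axis inner_axis' intro!: derivative_eq_intros)

lemma has_partial_cong: "has_partial i f f' \<Longrightarrow> (\<And>x. f' x = g' x) \<Longrightarrow> has_partial i f g'"
  by (simp add: has_partial_def)

lemma has_partial_partial_deriv: "has_partial i f f' \<Longrightarrow> partial_deriv i f = f'"
  by (auto simp: has_partial_def partial_deriv_def fun_eq_iff intro: DERIV_imp_deriv)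

text \<open>The mean value theorem bounds the difference quotients by \<open>g\<close>, so dominated
  convergence applies. The bound is asked only for |t| <= 1: when t is a translation of a function
  with bounded support, the support then stays in one fixed ball.\<close>

lemma deriv_under_integral:
  fixes f f' :: "real \<Rightarrow> 'a \<Rightarrow> real"
  assumes int: "\<And>t. integrable M (f t)"
    and der: "\<And>t y. ((\<lambda>t. f t y) has_real_derivative f' t y) (at t)"
    and bd: "\<And>t y. \<bar>t\<bar> \<le> 1 \<Longrightarrow> \<bar>f' t y\<bar> \<le> g y"
    and g: "integrable M g"
    and meas: "f' 0 \<in> borel_measurable M"
  shows "((\<lambda>t. \<integral>y. f t y \<partial>M) has_real_derivative (\<integral>y. f' 0 y \<partial>M)) (at 0)"
proof -
  have "((\<lambda>h. ((\<integral>y. f (0+h) y \<partial>M) - (\<integral>y. f 0 y \<partial>M)) / h) \<longlongrightarrow> (\<integral>y. f' 0 y \<partial>M)) (at 0)"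
    unfolding tendsto_at_iff_sequentially
  proof (intro allI impI, unfold comp_def)
    fix X :: "nat \<Rightarrow> real" assume X: "\<forall>i. X i \<in> UNIV - {0}" "X \<longlonglongrightarrow> 0"
    \<comment> \<open>The bound \<open>g\<close> is available only once |X n| < 1, hence the index
      shift by \<open>N\<close> below.\<close>
    have "eventually (\<lambda>n. \<bar>X n\<bar> < 1) sequentially"
      using X(2) by (simp add: tendsto_iff dist_norm)
    then obtain N where N: "\<And>n. n \<ge> N \<Longrightarrow> \<bar>X n\<bar> < 1"
      by (auto simp: eventually_sequentially)
    have bnd: "\<bar>(f (X n) y - f 0 y) / X n\<bar> \<le> g y" if "n \<ge> N" for n y
    proof -
      have x0: "X n \<noteq> 0" using X(1) by simp
      have "\<bar>f (X n) y - f 0 y\<bar> \<le> g y * \<bar>X n - 0\<bar>"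
      proof (rule field_differentiable_bound[where S="{-1..1}" and f'="\<lambda>t. f' t y", simplified real_norm_def])
        show "((\<lambda>t. f t y) has_real_derivative f' z y) (at z within {- 1..1})" for z
          using der has_field_derivative_at_within by blast
        show "\<bar>f' z y\<bar> \<le> g y" if "z \<in> {-1..1}" for z using bd that by auto
      qed (use N[OF that] in auto)
      then show ?thesis using x0 by (simp add: divide_simps)
    qed
    have "(\<lambda>n. \<integral>y. (f (X (n+N)) y - f 0 y) / X (n+N) \<partial>M) \<longlonglongrightarrow> (\<integral>y. f' 0 y \<partial>M)"
    proof (rule integral_dominated_convergence[where w=g])
      show "AE y in M. (\<lambda>n. (f (X (n + N)) y - f 0 y) / X (n + N)) \<longlonglongrightarrow> f' 0 y"
      proof (rule AE_I2)
        fix y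
        have "((\<lambda>h. (f (0+h) y - f 0 y) / h) \<longlongrightarrow> f' 0 y) (at 0)"
          using der[of y 0] by (simp add: DERIV_def)
        then have "(\<lambda>n. (f (X n) y - f 0 y) / X n) \<longlonglongrightarrow> f' 0 y"
          unfolding tendsto_at_iff_sequentially using X by (auto simp: comp_def)
        then show "(\<lambda>n. (f (X (n + N)) y - f 0 y) / X (n + N)) \<longlonglongrightarrow> f' 0 y"
          by (rule LIMSEQ_ignore_initial_segment)
      qed
      show "(\<lambda>y. (f (X (n + N)) y - f 0 y) / X (n + N)) \<in> borel_measurable M" for n
        using int by (auto intro!: borel_measurable_divide borel_measurable_diff)
      show "AE y in M. norm ((f (X (n + N)) y - f 0 y) / X (n + N)) \<le> g y" for n
        using bnd[of "n+N"] by simp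
    qed (use g meas in auto)
    then have "(\<lambda>n. ((\<integral>y. f (X (n+N)) y \<partial>M) - (\<integral>y. f 0 y \<partial>M)) / X (n+N)) \<longlonglongrightarrow> (\<integral>y. f' 0 y \<partial>M)"
      using int by (simp add: Bochner_Integration.integral_diff)
    then have "(\<lambda>n. ((\<integral>y. f (X n) y \<partial>M) - (\<integral>y. f 0 y \<partial>M)) / X n) \<longlonglongrightarrow> (\<integral>y. f' 0 y \<partial>M)"
      by (rule LIMSEQ_offset)
    then show "(\<lambda>n. ((\<integral>y. f (0 + X n) y \<partial>M) - (\<integral>y. f 0 y \<partial>M)) / X n) \<longlonglongrightarrow> (\<integral>y. f' 0 y \<partial>M)"
      by simp
  qed
  then show ?thesis by (simp add: DERIV_def)
qed

section \<open>Functions with bounded support and translation of integrals\<close>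

lemma integrable_continuous_bounded_support:
  fixes f :: "'a::euclidean_space \<Rightarrow> real"
  assumes "continuous_on UNIV f" "\<And>x. norm x > r \<Longrightarrow> f x = 0"
  shows "integrable lborel f"
proof -
  have "integrable lborel (\<lambda>x. indicator (cball 0 r) x *\<^sub>R f x)"
    by (rule borel_integrable_compact) (auto intro: continuous_on_subset assms)
  also have "(\<lambda>x. indicator (cball 0 r) x *\<^sub>R f x) = f"
    using assms(2) by (auto simp: indicator_def fun_eq_iff)
  finally show ?thesis .
qed

lemma bounded_continuous_bounded_support:
  fixes f :: "'a::euclidean_space \<Rightarrow> real"
  assumes "continuous_on UNIV f" "\<And>x. norm x > r \<Longrightarrow> f x = 0"
  obtains B where "B \<ge> 0" "\<And>x. \<bar>f x\<bar> \<le> B"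
proof -
  have "compact (f ` cball 0 r)"
    by (rule compact_continuous_image) (auto intro: continuous_on_subset assms)
  then obtain B where B: "\<And>x. x \<in> cball 0 r \<Longrightarrow> \<bar>f x\<bar> \<le> B"
    using compact_imp_bounded bounded_iff by (metis image_eqI real_norm_def)
  have "\<bar>f x\<bar> \<le> max 0 B" for x
    using B[of x] assms(2)[of x] by (cases "norm x > r") (auto simp: max_def)
  then show ?thesis using that[of "max 0 B"] by auto
qed

lemma lborel_integral_translate:
  fixes f :: "'a::euclidean_space \<Rightarrow> real"
  assumes "f \<in> borel_measurable borel"
  shows "(\<integral>x. f (x + c) \<partial>lborel) = (\<integral>x. f x \<partial>lborel)"
proof -
  have "(\<integral>x. f x \<partial>lborel) = (\<integral>x. f x \<partial>distr lborel borel (\<lambda>x. c + x))"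
    by (simp add: lborel_distr_plus)
  also have "\<dots> = (\<integral>x. f (c + x) \<partial>lborel)"
    by (rule integral_distr) (use assms in auto)
  finally show ?thesis by (simp add: add.commute)
qed

lemma lborel_integrable_translate:
  fixes f :: "'a::euclidean_space \<Rightarrow> real"
  assumes "integrable lborel f"
  shows "integrable lborel (\<lambda>x. f (x + c))"
proof -
  have "integrable (distr lborel borel (\<lambda>x. c + x)) f"
    using assms by (simp add: lborel_distr_plus)
  then show ?thesis
    by (subst (asm) integrable_distr_eq) (use assms in \<open>auto simp: add.commute\<close>)
qed

text \<open>By translation invariance the integral of f(x + t e_i) does not depend on t, while its
  derivative at t = 0 is the integral of \<open>f'\<close>. This takes the place of the divergence
  theorem and avoids iterated integrals; every integration by parts below reduces to it by
  exhibiting a vector field.\<close>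

lemma integral_has_partial_zero:
  fixes f f' :: "real^'n::finite \<Rightarrow> real"
  assumes d: "has_partial i f f'" and c: "continuous_on UNIV f" "continuous_on UNIV f'"
    and z: "\<And>x. norm x > r \<Longrightarrow> f x = 0" "\<And>x. norm x > r \<Longrightarrow> f' x = 0"
  shows "(\<integral>x. f' x \<partial>lborel) = 0"
proof -
  obtain B where B: "B \<ge> 0" "\<And>x. \<bar>f' x\<bar> \<le> B"
    using bounded_continuous_bounded_support[OF c(2) z(2)] by blast
  let ?e = "axis i 1 :: real^'n"
  have "((\<lambda>t. \<integral>x. f (x + t *\<^sub>R ?e) \<partial>lborel) has_real_derivative (\<integral>x. f' (x + 0 *\<^sub>R ?e) \<partial>lborel)) (at 0)"
  proof (rule deriv_under_integral[where g = "\<lambda>x. B * indicator (cball 0 (r+1)) x"])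
    show "integrable lborel (\<lambda>x. f (x + t *\<^sub>R ?e))" for t
      by (rule lborel_integrable_translate) (rule integrable_continuous_bounded_support[OF c(1) z(1)])
    show "((\<lambda>t. f (x + t *\<^sub>R ?e)) has_real_derivative f' (x + t *\<^sub>R ?e)) (at t)" for t x
      by (rule has_partial_at[OF d])
    show "\<bar>f' (x + t *\<^sub>R ?e)\<bar> \<le> B * indicator (cball 0 (r + 1)) x" if "\<bar>t\<bar> \<le> 1" for t x
    proof (cases "norm x \<le> r + 1")
      case True then show ?thesis using B(2) by simp
    next
      case False
      have "norm x \<le> norm (x + t *\<^sub>R ?e) + norm (t *\<^sub>R ?e)"
        by (metis add_diff_cancel_right' norm_triangle_ineq4)
      then have "norm (x + t *\<^sub>R ?e) > r" using that False by simp
      then show ?thesis using z(2) B(1) by simp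
    qed
    show "integrable lborel (\<lambda>x. B * indicator (cball 0 (r + 1)) (x::real^'n))"
      by (auto intro!: integrable_real_indicator emeasure_lborel_cball_finite)
    show "(\<lambda>x. f' (x + 0 *\<^sub>R ?e)) \<in> borel_measurable lborel"
      using c(2) by (simp add: borel_measurable_continuous_onI)
  qed
  moreover have "(\<lambda>t. \<integral>x. f (x + t *\<^sub>R ?e) \<partial>lborel) = (\<lambda>t. \<integral>x. f x \<partial>lborel)"
    by (auto intro!: lborel_integral_translate borel_measurable_continuous_onI c)
  ultimately show ?thesis
    by simp (metis DERIV_const DERIV_unique)
qed

section \<open>A Carleman inequality for the conjugated Laplacian\<close>

text \<open>Derivatives are carried along as explicit functions, so that products and mollifications
  come with closed formulas. Equality of the mixed derivatives is part of the data instead of being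
  derived from continuity; each construction below supplies it directly.\<close>

definition C2data :: "(real^'n::finite \<Rightarrow> real) \<Rightarrow> ('n \<Rightarrow> real^'n \<Rightarrow> real) \<Rightarrow> ('n \<Rightarrow> 'n \<Rightarrow> real^'n \<Rightarrow> real) \<Rightarrow> bool" where
  "C2data y y1 y2 \<longleftrightarrow>
     (\<forall>i. has_partial i y (y1 i)) \<and> (\<forall>i j. has_partial j (y1 i) (y2 i j)) \<and>
     continuous_on UNIV y \<and> (\<forall>i. continuous_on UNIV (y1 i)) \<and> (\<forall>i j. continuous_on UNIV (y2 i j)) \<and>
     (\<forall>i j x. y2 i j x = y2 j i x)"

definition radial :: "('n::finite \<Rightarrow> real^'n \<Rightarrow> real) \<Rightarrow> real^'n \<Rightarrow> real" where
  "radial y1 x = (\<Sum>i\<in>UNIV. x $ i * y1 i x)"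

definition grad2 :: "('n::finite \<Rightarrow> real^'n \<Rightarrow> real) \<Rightarrow> real^'n \<Rightarrow> real" where
  "grad2 y1 x = (\<Sum>i\<in>UNIV. (y1 i x)\<^sup>2)"

definition lap :: "('n::finite \<Rightarrow> 'n \<Rightarrow> real^'n \<Rightarrow> real) \<Rightarrow> real^'n \<Rightarrow> real" where
  "lap y2 x = (\<Sum>i\<in>UNIV. y2 i i x)"

lemma sum_delta_mult: "(\<Sum>j\<in>UNIV. (if j = (i::'n::finite) then 1 else 0) * f j) = (f i :: real)"
  by (simp add: if_distrib[of "\<lambda>c. c * _"] cong: if_cong)

lemma has_partial_radial:
  assumes "C2data y y1 y2"
  shows "has_partial i (radial y1) (\<lambda>x. y1 i x + (\<Sum>j\<in>UNIV. x $ j * y2 j i x))"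
proof -
  have "has_partial i (\<lambda>x. \<Sum>j\<in>UNIV. x $ j * y1 j x)
         (\<lambda>x. \<Sum>j\<in>UNIV. (if j = i then 1 else 0) * y1 j x + x $ j * y2 j i x)"
    using assms by (intro has_partial_sum has_partial_mult has_partial_coord) (auto simp: C2data_def)
  then show ?thesis
    unfolding radial_def[abs_def] by (simp only: sum.distrib sum_delta_mult)
qed

lemma has_partial_grad2:
  assumes "C2data y y1 y2"
  shows "has_partial i (grad2 y1) (\<lambda>x. 2 * (\<Sum>j\<in>UNIV. y1 j x * y2 j i x))"
proof -
  have "has_partial i (\<lambda>x. \<Sum>j\<in>UNIV. y1 j x * y1 j x)
         (\<lambda>x. \<Sum>j\<in>UNIV. y2 j i x * y1 j x + y1 j x * y2 j i x)"
    using assms by (intro has_partial_sum has_partial_mult) (auto simp: C2data_def)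
  then show ?thesis
    unfolding grad2_def[abs_def] power2_eq_square
    by (rule has_partial_cong) (simp add: sum_distrib_left algebra_simps)
qed


text \<open>With s = x . x, \<open>A\<close> is 2 p (x . grad) + div(p x), which is antisymmetric,
  and \<open>S\<close> is div(s grad) plus multiplication by n - 1 + p^2, which is symmetric. For
  such a pair the integral of the product is a commutator form; integrated by parts it becomes the
  integral of \<open>Q\<close>, every term of which carries the factor b. Concretely, S A - Q is the
  divergence of the field \<open>X\<close>.\<close>

lemma carleman_divergence:
  fixes y :: "real^'n::finite \<Rightarrow> real" and a b :: real
  assumes C: "C2data y y1 y2"
    and z: "\<And>x. norm x > r \<Longrightarrow> y x = 0" "\<And>x i. norm x > r \<Longrightarrow> y1 i x = 0"
           "\<And>x i j. norm x > r \<Longrightarrow> y2 i j x = 0"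
  defines "n \<equiv> real CARD('n)"
  defines "p \<equiv> \<lambda>x::real^'n. 2*a - b * (x \<bullet> x)"
  defines "A \<equiv> \<lambda>x. 2 * p x * radial y1 x + (n * p x - 2*b*(x \<bullet> x)) * y x"
  defines "S \<equiv> \<lambda>x. (x \<bullet> x) * lap y2 x + 2 * radial y1 x + (n - 1 + (p x)\<^sup>2) * y x"
  defines "Q \<equiv> \<lambda>x. 4*b*(x \<bullet> x)*(radial y1 x + n/2 * y x)\<^sup>2 + 4*b*(x \<bullet> x)*((p x)\<^sup>2 - 1)*(y x)\<^sup>2"
  shows "integrable lborel (\<lambda>x. S x * A x - Q x)" "(\<integral>x. S x * A x - Q x \<partial>lborel) = 0"
proof -
  have cont: "continuous_on UNIV y" "\<And>i. continuous_on UNIV (y1 i)" "\<And>i j. continuous_on UNIV (y2 i j)"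
    and pdy: "\<And>i. has_partial i y (y1 i)" and pdy1: "\<And>i j. has_partial j (y1 i) (y2 i j)"
    and sym: "\<And>i j x. y2 i j x = y2 j i x"
    using C by (auto simp: C2data_def)
  have pdp: "has_partial i p (\<lambda>x. - 2 * b * x $ i)" for i
    unfolding p_def by (rule has_partial_cong, rule has_partial_diff[OF has_partial_const has_partial_mult[OF has_partial_const has_partial_inner_self]]) simp
  have pdpp: "has_partial i (\<lambda>x. p x * p x) (\<lambda>x. - 4 * b * x $ i * p x)" for i
    by (rule has_partial_cong, rule has_partial_mult[OF pdp pdp]) simp
  have pdyy: "has_partial i (\<lambda>x. y x * y x) (\<lambda>x. 2 * y1 i x * y x)" for i
    by (rule has_partial_cong, rule has_partial_mult[OF pdy pdy]) simp
  define k1 where "k1 = (\<lambda>x. 2 * p x * (x \<bullet> x))"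
  define q where "q = (\<lambda>x. (n * p x - 2*b*(x \<bullet> x)) * (x \<bullet> x))"
  define k2 where "k2 = (\<lambda>x. 1/2 * (2 * p x * (n - 1 + p x * p x) + (4 - 2*n)*b*(x \<bullet> x)))"
  have pk1: "has_partial i k1 (\<lambda>x. -4*b*x $ i * (x \<bullet> x) + 4 * p x * x $ i)" for i
    unfolding k1_def
    by (rule has_partial_cong, rule has_partial_mult[OF has_partial_mult[OF has_partial_const pdp] has_partial_inner_self]) (simp add: algebra_simps)
  have pq: "has_partial i q (\<lambda>x. (-2*b*n - 4*b) * x $ i * (x \<bullet> x) + (n * p x - 2*b*(x \<bullet> x)) * (2 * x $ i))" for i
    unfolding q_def
    by (rule has_partial_cong, rule has_partial_mult[OF has_partial_diff[OF has_partial_mult[OF has_partial_const pdp] has_partial_mult[OF has_partial_const has_partial_inner_self]] has_partial_inner_self])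
       (simp add: algebra_simps)
  have pk2: "has_partial i k2 (\<lambda>x. -2*b*x $ i * (n - 1 + p x * p x) - 4*b*x $ i * p x * p x + (4 - 2*n)*b* x $ i)" for i
    unfolding k2_def
    by (rule has_partial_cong, rule has_partial_mult[OF has_partial_const has_partial_add[OF has_partial_mult[OF has_partial_mult[OF has_partial_const pdp] has_partial_add[OF has_partial_const pdpp]]
         has_partial_mult[OF has_partial_const has_partial_inner_self]]])
       (simp add: algebra_simps)
  text \<open>The k1 term is the Rellich field, which handles (x . grad y) lap y; the q and k2 terms remove y lap y and
    y (x . grad y). The squared-gradient terms of the first two cancel because q is the antisymmetric zeroth-order coefficient times s.\<close>
  define X where "X = (\<lambda>i x. k1 x * (radial y1 x * y1 i x - 1/2 * (x $ i * grad2 y1 x)) + q x * (y x * y1 i x) + k2 x * (x $ i * (y x * y x)))"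
  define X' where "X' = (\<lambda>i x.
     (-4*b*x $ i * (x \<bullet> x) + 4 * p x * x $ i) * (radial y1 x * y1 i x - 1/2 * (x $ i * grad2 y1 x))
     + k1 x * ((y1 i x + (\<Sum>j\<in>UNIV. x $ j * y2 j i x)) * y1 i x + radial y1 x * y2 i i x
               - 1/2 * (grad2 y1 x + x $ i * (2 * (\<Sum>j\<in>UNIV. y1 j x * y2 j i x))))
     + ((-2*b*n - 4*b) * x $ i * (x \<bullet> x) + (n * p x - 2*b*(x \<bullet> x)) * (2 * x $ i)) * (y x * y1 i x)
     + q x * (y1 i x * y1 i x + y x * y2 i i x)
     + (-2*b*x $ i * (n - 1 + p x * p x) - 4*b*x $ i * p x * p x + (4 - 2*n)*b* x $ i) * (x $ i * (y x * y x))
     + k2 x * (y x * y x + x $ i * (2 * y1 i x * y x)))"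
  have pX: "has_partial i (X i) (X' i)" for i
    unfolding X_def
    by (rule has_partial_cong, rule has_partial_add[OF has_partial_add[OF has_partial_mult[OF pk1 has_partial_diff[OF has_partial_mult[OF has_partial_radial[OF C] pdy1] has_partial_mult[OF has_partial_const has_partial_mult[OF has_partial_coord has_partial_grad2[OF C]]]]]
           has_partial_mult[OF pq has_partial_mult[OF pdy pdy1]]] has_partial_mult[OF pk2 has_partial_mult[OF has_partial_coord pdyy]]])
       (simp add: X'_def)
  have contrad: "continuous_on UNIV (radial y1)" "continuous_on UNIV (grad2 y1)"
    unfolding radial_def[abs_def] grad2_def[abs_def] by (intro continuous_intros cont)+
  have cp: "continuous_on UNIV p"
    unfolding p_def by (intro continuous_intros)
  have ck: "continuous_on UNIV k1" "continuous_on UNIV q" "continuous_on UNIV k2"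
    unfolding k1_def q_def k2_def by (intro continuous_intros cp)+
  have cX: "continuous_on UNIV (X i)" "continuous_on UNIV (X' i)" for i
    unfolding X_def X'_def by (intro continuous_intros cont contrad cp ck)+
  have zX: "X i x = 0" "X' i x = 0" if "norm x > r" for i x
    using z[OF that] by (auto simp: X_def X'_def radial_def grad2_def)
  have intX: "integrable lborel (X' i)" for i
    by (rule integrable_continuous_bounded_support[OF cX(2) zX(2)])
  have zeroX: "(\<integral>x. X' i x \<partial>lborel) = 0" for i
    by (rule integral_has_partial_zero[OF pX cX zX])
  have ident: "(\<Sum>i\<in>UNIV. X' i x) = S x * A x - Q x" for x
  proof -
    have ss: "(\<Sum>i\<in>UNIV. x $ i * x $ i) = x \<bullet> x" by (simp add: inner_vec_def)
    \<comment> \<open>The Hessian terms from (x . grad y) grad y and from x |grad y|^2 / 2 are both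
      equal to \<open>H\<close>, the second by symmetry of \<open>y2\<close>, and they
      cancel.\<close>
    define H where "H = (\<Sum>i\<in>UNIV. y1 i x * (\<Sum>j\<in>UNIV. x $ j * y2 j i x))"
    have H2: "(\<Sum>i\<in>UNIV. x $ i * (\<Sum>j\<in>UNIV. y1 j x * y2 j i x)) = H"
      unfolding H_def sum_distrib_left
      by (subst sum.swap) (auto intro!: sum.cong simp: sym[of _ _ x] algebra_simps)
    have R: "(\<Sum>i\<in>UNIV. x $ i * y1 i x) = radial y1 x" by (simp add: radial_def)
    have G: "(\<Sum>i\<in>UNIV. y1 i x * y1 i x) = grad2 y1 x" by (simp add: grad2_def power2_eq_square)
    have L: "(\<Sum>i\<in>UNIV. y2 i i x) = lap y2 x" by (simp add: lap_def)
    define s where "s = x \<bullet> x"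
    let ?p = "p x" and ?E = "radial y1 x" and ?G = "grad2 y1 x" and ?y = "y x" and ?L = "lap y2 x"
    have "X' i x = (-4*b * s + 4 * ?p) * ?E * (x $ i * y1 i x) - (-4*b * s + 4 * ?p) * ?G / 2 * (x $ i * x $ i)
      + k1 x * (y1 i x * y1 i x) + k1 x * (y1 i x * (\<Sum>j\<in>UNIV. x $ j * y2 j i x)) + k1 x * ?E * y2 i i x
      - k1 x * ?G / 2 - k1 x * (x $ i * (\<Sum>j\<in>UNIV. y1 j x * y2 j i x))
      + ((-2*b*n - 4*b) * s + 2 * (n * ?p - 2*b * s)) * ?y * (x $ i * y1 i x)
      + q x * (y1 i x * y1 i x) + q x * ?y * y2 i i x
      + (-2*b* (n - 1 + ?p * ?p) - 4*b* ?p * ?p + (4 - 2*n)*b) * ?y * ?y * (x $ i * x $ i)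
      + k2 x * ?y * ?y + 2 * k2 x * ?y * (x $ i * y1 i x)" for i
      unfolding X'_def s_def by (simp add: field_simps)
    then have "(\<Sum>i\<in>UNIV. X' i x) = (-4*b * s + 4 * ?p) * ?E * ?E - (-4*b * s + 4 * ?p) * ?G / 2 * s
      + k1 x * ?G + k1 x * H + k1 x * ?E * ?L
      - n * (k1 x * ?G / 2) - k1 x * H
      + ((-2*b*n - 4*b) * s + 2 * (n * ?p - 2*b * s)) * ?y * ?E
      + q x * ?G + q x * ?y * ?L
      + (-2*b* (n - 1 + ?p * ?p) - 4*b* ?p * ?p + (4 - 2*n)*b) * ?y * ?y * s
      + n * (k2 x * ?y * ?y) + 2 * k2 x * ?y * ?E"
      by (simp only: sum.distrib sum_subtractf sum_distrib_left[symmetric] R G L ss H2 H_def[symmetric] s_def[symmetric] sum_constant n_def)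
         simp
    \<comment> \<open>What remains is a polynomial identity in which p and s, as well as the value,
      the radial derivative, the squared gradient and the Laplacian of y, may be treated as
      independent variables.\<close>
    also have "\<dots> = S x * A x - Q x"
      unfolding S_def A_def Q_def k1_def q_def k2_def s_def[symmetric] power2_eq_square
      by (simp add: field_simps)
    finally show ?thesis .
  qed
  show "integrable lborel (\<lambda>x. S x * A x - Q x)"
    unfolding ident[symmetric] by (rule Bochner_Integration.integrable_sum) (rule intX)
  show "(\<integral>x. S x * A x - Q x \<partial>lborel) = 0"
    unfolding ident[symmetric] using intX zeroX by (simp add: Bochner_Integration.integral_sum)
qed

text \<open>Since (S + A)^2 = (S - A)^2 + 4 S A, the integral of (S + A)^2 is at least four times
  that of S A. The factor 16 is this 4 times the 4 b in \<open>Q\<close>; the square of the shifted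
  radial derivative in \<open>Q\<close> is discarded, which b >= 0 permits.\<close>

lemma carleman_conjugated:
  fixes y :: "real^'n::finite \<Rightarrow> real" and a b :: real
  assumes C: "C2data y y1 y2" and b: "b \<ge> 0"
    and z: "\<And>x. norm x > r \<Longrightarrow> y x = 0" "\<And>x i. norm x > r \<Longrightarrow> y1 i x = 0"
           "\<And>x i j. norm x > r \<Longrightarrow> y2 i j x = 0"
  defines "n \<equiv> real CARD('n)"
  defines "p \<equiv> \<lambda>x::real^'n. 2*a - b * (x \<bullet> x)"
  shows "16 * b * (\<integral>x. (x \<bullet> x) * ((p x)\<^sup>2 - 1) * (y x)\<^sup>2 \<partial>lborel) \<le>
    (\<integral>x. ((x \<bullet> x) * lap y2 x + 2 * (1 + p x) * radial y1 x
        + (n - 1 + (p x)\<^sup>2 + n * p x - 2*b*(x \<bullet> x)) * y x)\<^sup>2 \<partial>lborel)"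
proof -
  define A where "A = (\<lambda>x. 2 * p x * radial y1 x + (n * p x - 2*b*(x \<bullet> x)) * y x)"
  define S where "S = (\<lambda>x. (x \<bullet> x) * lap y2 x + 2 * radial y1 x + (n - 1 + (p x)\<^sup>2) * y x)"
  define Q where "Q = (\<lambda>x. 4*b*(x \<bullet> x)*(radial y1 x + n/2 * y x)\<^sup>2 + 4*b*(x \<bullet> x)*((p x)\<^sup>2 - 1)*(y x)\<^sup>2)"
  define P where "P = (\<lambda>x. (x \<bullet> x) * ((p x)\<^sup>2 - 1) * (y x)\<^sup>2)"
  define T where "T = (\<lambda>x. ((x \<bullet> x) * lap y2 x + 2 * (1 + p x) * radial y1 x
        + (n - 1 + (p x)\<^sup>2 + n * p x - 2*b*(x \<bullet> x)) * y x)\<^sup>2)"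
  have div: "integrable lborel (\<lambda>x. S x * A x - Q x)" "(\<integral>x. S x * A x - Q x \<partial>lborel) = 0"
    unfolding S_def A_def Q_def p_def n_def using carleman_divergence[OF C z] by blast+
  have cont: "continuous_on UNIV y" "\<And>i. continuous_on UNIV (y1 i)" "\<And>i j. continuous_on UNIV (y2 i j)"
    using C by (auto simp: C2data_def)
  have cp: "continuous_on UNIV p"
    unfolding p_def by (intro continuous_intros)
  have iP: "integrable lborel P"
    by (rule integrable_continuous_bounded_support[where r=r])
       (use z in \<open>auto simp: P_def intro!: continuous_intros cont cp\<close>)
  have iT: "integrable lborel T"
    by (rule integrable_continuous_bounded_support[where r=r])
       (use z in \<open>auto simp: T_def lap_def radial_def intro!: continuous_intros cont cp\<close>)
  have "4 * (S x * A x - Q x) + 16 * b * P x \<le> T x" for x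
  proof -
    have "T x = (S x + A x)\<^sup>2"
      unfolding T_def S_def A_def by (simp add: algebra_simps)
    also have "\<dots> = (S x - A x)\<^sup>2 + 4 * (S x * A x)"
      by (simp add: power2_eq_square algebra_simps)
    also have "\<dots> \<ge> 4 * (S x * A x)" by simp
    finally have "4 * (S x * A x) \<le> T x" .
    moreover have "4 * Q x \<ge> 16 * b * P x"
      using b by (simp add: Q_def P_def)
    ultimately show ?thesis by simp
  qed
  then have "(\<integral>x. 4 * (S x * A x - Q x) + 16 * b * P x \<partial>lborel) \<le> (\<integral>x. T x \<partial>lborel)"
    by (intro integral_mono Bochner_Integration.integrable_add integrable_mult_right div iP iT)
  also have "(\<integral>x. 4 * (S x * A x - Q x) + 16 * b * P x \<partial>lborel) = 16 * b * (\<integral>x. P x \<partial>lborel)"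

  proof -
    have "integrable lborel (\<lambda>x. 4 * (S x * A x - Q x))" "integrable lborel (\<lambda>x. 16 * b * P x)"
      by (intro integrable_mult_right div iP)+
    moreover have "(\<integral>x. 4 * (S x * A x - Q x) \<partial>lborel) = 0"
      using div(2) by (simp only: integral_mult_right_zero)
    ultimately show ?thesis
      by (simp only: Bochner_Integration.integral_add integral_mult_right_zero)
  qed
  finally show ?thesis unfolding P_def T_def .
qed

section \<open>Cutoff functions and radial multipliers\<close>

text \<open>Cubes of the positive part have just the two continuous derivatives that the Carleman
  inequality asks of a cutoff, and they keep all derivative bounds explicit.\<close>

definition cub :: "real \<Rightarrow> real" where "cub t = (max 0 t)^3"
definition cub1 :: "real \<Rightarrow> real" where "cub1 t = 3 * (max 0 t)^2"
definition cub2 :: "real \<Rightarrow> real" where "cub2 t = 6 * max 0 t"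

lemma DERIV_max0_power:
  assumes "k \<ge> 1"
  shows "((\<lambda>t::real. (max 0 t) ^ Suc k) has_real_derivative real (Suc k) * (max 0 t) ^ k) (at t)"
proof -
  consider "t < 0" | "t > 0" | "t = 0" by linarith
  then show ?thesis
  proof cases
    case 1
    have "((\<lambda>t::real. 0) has_real_derivative 0) (at t)" by simp
    then have "((\<lambda>t::real. (max 0 t) ^ Suc k) has_real_derivative 0) (at t)"
      by (rule has_field_derivative_transform_within_open[where S="{..<0}"]) (use 1 in auto)
    moreover have "k \<noteq> 0" using assms by simp
    ultimately show ?thesis using 1 by (simp only: max_absorb1 less_imp_le power_0_left mult_zero_right if_False)
  next
    case 2
    have "((\<lambda>t::real. t ^ Suc k) has_real_derivative real (Suc k) * t ^ k) (at t)"
      by (rule derivative_eq_intros refl | simp)+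
    then have "((\<lambda>t::real. (max 0 t) ^ Suc k) has_real_derivative real (Suc k) * t ^ k) (at t)"
      by (rule has_field_derivative_transform_within_open[where S="{0<..}"]) (use 2 in auto)
    then show ?thesis using 2 by simp
  next
    case 3
    \<comment> \<open>At the corner the difference quotient is max(0,h)^k times a factor equal to 0
      or 1, so it tends to 0 as k is positive.\<close>
    have "((\<lambda>h::real. (max 0 h) ^ k * (max 0 h / h)) \<longlongrightarrow> 0) (at 0)"
    proof (rule Lim_null_comparison[where g="\<lambda>h. (max 0 h) ^ k"])
      show "\<forall>\<^sub>F h in at 0. norm ((max 0 h) ^ k * (max 0 h / h)) \<le> (max 0 h) ^ k"
        by (rule always_eventually) (auto simp: max_def)
      have "((\<lambda>h::real. (max 0 h) ^ k) \<longlongrightarrow> (max 0 0) ^ k) (at 0)"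
        by (intro tendsto_intros)
      moreover have "(max 0 (0::real)) ^ k = 0" using assms by (simp add: power_0_left)
      ultimately show "((\<lambda>h::real. (max 0 h) ^ k) \<longlongrightarrow> 0) (at 0)" by (simp only:)
    qed
    then show ?thesis using 3 assms by (simp add: DERIV_def mult.commute power_0_left)
  qed
qed

lemma DERIV_cub: "(cub has_real_derivative cub1 t) (at t)" "(cub1 has_real_derivative cub2 t) (at t)"
proof -
  show "(cub has_real_derivative cub1 t) (at t)"
    using DERIV_max0_power[of 2 t] by (simp add: cub_def[abs_def] cub1_def numeral_3_eq_3 numeral_2_eq_2)
  show "(cub1 has_real_derivative cub2 t) (at t)"
    using DERIV_cmult[OF DERIV_max0_power[of 1 t], of 3]
    by (simp add: cub1_def[abs_def] cub2_def numeral_2_eq_2 mult.assoc)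
qed

text \<open>The inner cube flattens the function at 0 and the outer one at 1, so that a piecewise
  polynomial joins the constants 0 and 1 with two continuous derivatives.\<close>

definition smoothstep :: "real \<Rightarrow> real" where "smoothstep t = 1 - cub (1 - cub t)"
definition smoothstep1 :: "real \<Rightarrow> real" where "smoothstep1 t = cub1 (1 - cub t) * cub1 t"
definition smoothstep2 :: "real \<Rightarrow> real" where
  "smoothstep2 t = cub1 (1 - cub t) * cub2 t - cub2 (1 - cub t) * (cub1 t)\<^sup>2"

lemma DERIV_smoothstep:
  "(smoothstep has_real_derivative smoothstep1 t) (at t)"
  "(smoothstep1 has_real_derivative smoothstep2 t) (at t)"
  unfolding smoothstep_def[abs_def] smoothstep1_def[abs_def] smoothstep2_def
  by (auto intro!: derivative_eq_intros DERIV_chain'[of _ _ _ _ cub] DERIV_chain'[of _ _ _ _ cub1] DERIV_cub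
      simp: power2_eq_square)

lemma continuous_smoothstep2 [continuous_intros]:
  "continuous_on S f \<Longrightarrow> continuous_on S (\<lambda>x. smoothstep2 (f x))"
  unfolding smoothstep2_def cub_def cub1_def cub2_def by (intro continuous_intros)

lemma smoothstep_left: "t \<le> 0 \<Longrightarrow> smoothstep t = 0 \<and> smoothstep1 t = 0 \<and> smoothstep2 t = 0"
  by (simp add: smoothstep_def smoothstep1_def smoothstep2_def cub_def cub1_def cub2_def max_def)

lemma smoothstep_right: "t \<ge> 1 \<Longrightarrow> smoothstep t = 1 \<and> smoothstep1 t = 0 \<and> smoothstep2 t = 0"
  using one_le_power[of t 3]
  by (simp add: smoothstep_def smoothstep1_def smoothstep2_def cub_def cub1_def cub2_def max_absorb1 max_absorb2)

text \<open>On (0,1), with c = 1 - t^3, the derivatives are 9 c^2 t^2 and 18 c^2 t - 54 c t^4, where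
  c and t lie in [0,1]; 72 is 18 + 54.\<close>

lemma smoothstep_bounds: "0 \<le> smoothstep t" "smoothstep t \<le> 1" "\<bar>smoothstep1 t\<bar> \<le> 9" "\<bar>smoothstep2 t\<bar> \<le> 72"
proof -
  consider "t \<le> 0" | "t \<ge> 1" | "0 < t" "t < 1" by linarith
  then have "0 \<le> smoothstep t \<and> smoothstep t \<le> 1 \<and> \<bar>smoothstep1 t\<bar> \<le> 9 \<and> \<bar>smoothstep2 t\<bar> \<le> 72"
  proof cases
    case 3
    define c where "c = 1 - t^3"
    have t: "0 \<le> t^3" "t^3 \<le> 1" "0 \<le> t^2" "t^2 \<le> 1" using 3 by (auto simp: power_le_one)
    have c: "0 \<le> c" "c \<le> 1" unfolding c_def using t by auto
    have c2: "0 \<le> c^2" "c^2 \<le> 1" "0 \<le> c^3" "c^3 \<le> 1" using c by (auto simp: power_le_one)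
    have "0 \<le> c^2 * t^2" "c^2 * t^2 \<le> 1" "0 \<le> c^2 * t" "c^2 * t \<le> 1"
      using c2 t 3 by (simp_all add: mult_le_one)
    moreover have "0 \<le> c * (t^2)^2" "c * (t^2)^2 \<le> 1"
      using c t 3 by (simp_all add: mult_le_one power_le_one)
    moreover have "cub t = t^3" "cub1 t = 3 * t^2" "cub2 t = 6 * t" "cub c = c^3" "cub1 c = 3 * c^2" "cub2 c = 6 * c"
      using 3 c by (auto simp: cub_def cub1_def cub2_def max_def)
    moreover from calculation have "smoothstep t = 1 - c^3" "smoothstep1 t = 9 * (c^2 * t^2)"
      "smoothstep2 t = 18 * (c^2 * t) - 54 * (c * (t^2)^2)"
      by (simp_all add: smoothstep_def smoothstep1_def smoothstep2_def c_def[symmetric] power_mult_distrib)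
    ultimately show ?thesis
      using c2 by (simp only: abs_le_iff) linarith
  qed (use smoothstep_left smoothstep_right in auto)
  then show "0 \<le> smoothstep t" "smoothstep t \<le> 1" "\<bar>smoothstep1 t\<bar> \<le> 9" "\<bar>smoothstep2 t\<bar> \<le> 72" by auto
qed

section \<open>Multipliers depending on the squared distance\<close>

lemma DERIV_continuous_UNIV:
  assumes "\<And>t. (g has_real_derivative g' t) (at t)" shows "continuous_on UNIV g"
  by (meson DERIV_isCont assms continuous_at_imp_continuous_on)

text \<open>As a function of x . x the multiplier is twice differentiable at the origin too, with
  gradient 2 g1 x and Laplacian 2 n g1 + 4 s g2; the rest is the product rule. It is applied with g
  equal to weight times cutoff.\<close>

lemma C2data_radial_mult:
  fixes u :: "real^'n::finite \<Rightarrow> real"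
  assumes C: "C2data u u1 u2"
    and g: "\<And>t. (g has_real_derivative g1 t) (at t)" "\<And>t. (g1 has_real_derivative g2 t) (at t)"
    and g2: "continuous_on UNIV g2"
  defines "y1 \<equiv> \<lambda>i x. 2 * (x $ i * (g1 (x \<bullet> x) * u x)) + g (x \<bullet> x) * u1 i x"
    and "y2 \<equiv> \<lambda>i j x. 2 * ((if i = j then 1 else 0) * (g1 (x \<bullet> x) * u x)
            + x $ i * (g2 (x \<bullet> x) * (2 * x $ j) * u x + g1 (x \<bullet> x) * u1 j x))
            + (g1 (x \<bullet> x) * (2 * x $ j) * u1 i x + g (x \<bullet> x) * u2 i j x)"
  shows "C2data (\<lambda>x. g (x \<bullet> x) * u x) y1 y2"
    "radial y1 x = 2 * (x \<bullet> x) * g1 (x \<bullet> x) * u x + g (x \<bullet> x) * radial u1 x"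
    "lap y2 x = 2 * real CARD('n) * g1 (x \<bullet> x) * u x + 4 * (x \<bullet> x) * g2 (x \<bullet> x) * u x
        + 4 * g1 (x \<bullet> x) * radial u1 x + g (x \<bullet> x) * lap u2 x"
proof -
  have cont: "continuous_on UNIV u" "\<And>i. continuous_on UNIV (u1 i)" "\<And>i j. continuous_on UNIV (u2 i j)"
    and pdu: "\<And>i. has_partial i u (u1 i)" and pdu1: "\<And>i j. has_partial j (u1 i) (u2 i j)"
    and sym: "\<And>i j x. u2 i j x = u2 j i x"
    using C by (auto simp: C2data_def)
  have cg: "continuous_on UNIV g" "continuous_on UNIV g1"
    using g DERIV_continuous_UNIV by blast+
  have cgs: "continuous_on UNIV (\<lambda>x::real^'n. f (x \<bullet> x))" if "continuous_on UNIV f" for f :: "real \<Rightarrow> real"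
    by (rule continuous_on_compose2[OF that]) (auto intro!: continuous_intros)
  have p0: "has_partial i (\<lambda>x::real^'n. g (x \<bullet> x)) (\<lambda>x. g1 (x \<bullet> x) * (2 * x $ i))" for i
    by (rule has_partial_chain[OF has_partial_inner_self g(1)])
  have p1: "has_partial i (\<lambda>x::real^'n. g1 (x \<bullet> x)) (\<lambda>x. g2 (x \<bullet> x) * (2 * x $ i))" for i
    by (rule has_partial_chain[OF has_partial_inner_self g(2)])
  have "has_partial i (\<lambda>x. g (x \<bullet> x) * u x) (y1 i)" for i
    by (rule has_partial_cong, rule has_partial_mult[OF p0 pdu]) (simp add: y1_def)
  moreover have "has_partial j (y1 i) (y2 i j)" for i j
    unfolding y1_def
    by (rule has_partial_cong, rule has_partial_add[OF has_partial_mult[OF has_partial_const has_partial_mult[OF has_partial_coord has_partial_mult[OF p1 pdu]]] has_partial_mult[OF p0 pdu1]])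
       (simp add: y2_def)
  moreover have "continuous_on UNIV (\<lambda>x. g (x \<bullet> x) * u x)"
    "continuous_on UNIV (y1 i)" "continuous_on UNIV (y2 i j)" for i j
    unfolding y1_def y2_def by (intro continuous_intros cgs cg g2 cont)+
  moreover have "y2 i j x = y2 j i x" for i j x
    unfolding y2_def using sym by (simp add: algebra_simps)
  ultimately show "C2data (\<lambda>x. g (x \<bullet> x) * u x) y1 y2"
    by (simp add: C2data_def)
  have ss: "(\<Sum>i\<in>UNIV. x $ i * x $ i) = x \<bullet> x" by (simp add: inner_vec_def)
  have "radial y1 x = (\<Sum>i\<in>UNIV. (2 * g1 (x \<bullet> x) * u x) * (x $ i * x $ i) + g (x \<bullet> x) * (x $ i * u1 i x))"
    unfolding radial_def y1_def by (rule sum.cong) (auto simp: algebra_simps)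
  also have "\<dots> = (2 * g1 (x \<bullet> x) * u x) * (x \<bullet> x) + g (x \<bullet> x) * radial u1 x"
    by (simp only: sum.distrib sum_distrib_left[symmetric] ss radial_def)
  finally show "radial y1 x = 2 * (x \<bullet> x) * g1 (x \<bullet> x) * u x + g (x \<bullet> x) * radial u1 x" by simp
  have "lap y2 x = (\<Sum>i\<in>UNIV. 2 * (g1 (x \<bullet> x) * u x) + (4 * g2 (x \<bullet> x) * u x) * (x $ i * x $ i)
         + (4 * g1 (x \<bullet> x)) * (x $ i * u1 i x) + g (x \<bullet> x) * u2 i i x)"
    unfolding lap_def y2_def by (rule sum.cong) (auto simp: algebra_simps)
  also have "\<dots> = real CARD('n) * (2 * (g1 (x \<bullet> x) * u x)) + (4 * g2 (x \<bullet> x) * u x) * (x \<bullet> x)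
       + (4 * g1 (x \<bullet> x)) * radial u1 x + g (x \<bullet> x) * lap u2 x"
    by (simp only: sum.distrib sum_distrib_left[symmetric] ss radial_def lap_def sum_constant) simp
  finally show "lap y2 x = 2 * real CARD('n) * g1 (x \<bullet> x) * u x + 4 * (x \<bullet> x) * g2 (x \<bullet> x) * u x
        + 4 * g1 (x \<bullet> x) * radial u1 x + g (x \<bullet> x) * lap u2 x" by simp
qed

text \<open>Integrating g |grad u|^2 by parts leaves the cross term u grad g . grad u. This is half
  of grad g . grad (u^2), so a second integration by parts puts both derivatives on g. The field g u
  grad u - g1 u^2 x does both at once, and no derivative of u except its Laplacian survives on the
  right.\<close>

lemma caccioppoli_identity:
  fixes u :: "real^'n::finite \<Rightarrow> real"
  assumes C: "C2data u u1 u2"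
    and g: "\<And>t. (g has_real_derivative g1 t) (at t)" "\<And>t. (g1 has_real_derivative g2 t) (at t)"
    and g2: "continuous_on UNIV g2"
    and z: "\<And>t. t \<ge> c \<Longrightarrow> g t = 0 \<and> g1 t = 0 \<and> g2 t = 0"
  shows "(\<integral>x. g (x \<bullet> x) * grad2 u1 x \<partial>lborel) =
    (\<integral>x. (2 * (x \<bullet> x) * g2 (x \<bullet> x) + real CARD('n) * g1 (x \<bullet> x)) * (u x)\<^sup>2 - g (x \<bullet> x) * (u x * lap u2 x) \<partial>lborel)"
proof -
  have cont: "continuous_on UNIV u" "\<And>i. continuous_on UNIV (u1 i)" "\<And>i j. continuous_on UNIV (u2 i j)"
    and pdu: "\<And>i. has_partial i u (u1 i)" and pdu1: "\<And>i j. has_partial j (u1 i) (u2 i j)"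
    using C by (auto simp: C2data_def)
  have cg: "continuous_on UNIV g" "continuous_on UNIV g1"
    using g DERIV_continuous_UNIV by blast+
  have cgs: "continuous_on UNIV (\<lambda>x::real^'n. f (x \<bullet> x))" if "continuous_on UNIV f" for f :: "real \<Rightarrow> real"
    by (rule continuous_on_compose2[OF that]) (auto intro!: continuous_intros)
  have p0: "has_partial i (\<lambda>x::real^'n. g (x \<bullet> x)) (\<lambda>x. g1 (x \<bullet> x) * (2 * x $ i))" for i
    by (rule has_partial_chain[OF has_partial_inner_self g(1)])
  have p1: "has_partial i (\<lambda>x::real^'n. g1 (x \<bullet> x)) (\<lambda>x. g2 (x \<bullet> x) * (2 * x $ i))" for i
    by (rule has_partial_chain[OF has_partial_inner_self g(2)])
  define r where "r = max 1 c"
  have zz: "g (x \<bullet> x) = 0 \<and> g1 (x \<bullet> x) = 0 \<and> g2 (x \<bullet> x) = 0" if "norm x > r" for x :: "real^'n"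
  proof -
    have "norm x * 1 \<le> norm x * norm x" using that r_def by (intro mult_left_mono) auto
    then have "x \<bullet> x \<ge> c" using that by (simp add: r_def power2_norm_eq_inner[symmetric] power2_eq_square)
    then show ?thesis using z by blast
  qed
  define X where "X = (\<lambda>i x. g (x \<bullet> x) * (u x * u1 i x) - g1 (x \<bullet> x) * (x $ i * (u x * u x)))"
  define X' where "X' = (\<lambda>i x. (g1 (x \<bullet> x) * (2 * x $ i)) * (u x * u1 i x)
      + g (x \<bullet> x) * (u1 i x * u1 i x + u x * u2 i i x)
      - ((g2 (x \<bullet> x) * (2 * x $ i)) * (x $ i * (u x * u x)) +
         g1 (x \<bullet> x) * (u x * u x + x $ i * (u1 i x * u x + u x * u1 i x))))"
  have pX: "has_partial i (X i) (X' i)" for i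
    unfolding X_def
    by (rule has_partial_cong, rule has_partial_diff[OF has_partial_mult[OF p0 has_partial_mult[OF pdu pdu1]] has_partial_mult[OF p1 has_partial_mult[OF has_partial_coord has_partial_mult[OF pdu pdu]]]])
       (simp add: X'_def)
  have cX: "continuous_on UNIV (X i)" "continuous_on UNIV (X' i)" for i
    unfolding X_def X'_def by (intro continuous_intros cont cgs cg g2)+
  have zX: "X i x = 0" "X' i x = 0" if "norm x > r" for i x
    using zz[OF that] by (auto simp: X_def X'_def)
  have intX: "integrable lborel (X' i)" for i
    by (rule integrable_continuous_bounded_support[OF cX(2) zX(2)])
  have zeroX: "(\<integral>x. X' i x \<partial>lborel) = 0" for i
    by (rule integral_has_partial_zero[OF pX cX zX])
  define P where "P = (\<lambda>x. g (x \<bullet> x) * grad2 u1 x)"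
  define Q where "Q = (\<lambda>x::real^'n. (2 * (x \<bullet> x) * g2 (x \<bullet> x) + real CARD('n) * g1 (x \<bullet> x)) * (u x)\<^sup>2 - g (x \<bullet> x) * (u x * lap u2 x))"
  have iP: "integrable lborel P"
    by (rule integrable_continuous_bounded_support[where r=r])
       (use zz in \<open>auto simp: P_def grad2_def intro!: continuous_intros cont cgs cg\<close>)
  have iQ: "integrable lborel Q"
    by (rule integrable_continuous_bounded_support[where r=r])
       (use zz in \<open>auto simp: Q_def lap_def intro!: continuous_intros cont cgs cg g2\<close>)
  have ident: "(\<Sum>i\<in>UNIV. X' i x) = P x - Q x" for x
  proof -
    have ss: "(\<Sum>i\<in>UNIV. x $ i * x $ i) = x \<bullet> x" by (simp add: inner_vec_def)
    have "(\<Sum>i\<in>UNIV. X' i x) = (\<Sum>i\<in>UNIV. g (x \<bullet> x) * (u1 i x)\<^sup>2 + (g (x \<bullet> x) * u x) * u2 i i x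
      - (2 * g2 (x \<bullet> x) * (u x)\<^sup>2) * (x $ i * x $ i) - g1 (x \<bullet> x) * (u x)\<^sup>2)"
      unfolding X'_def by (rule sum.cong) (auto simp: algebra_simps power2_eq_square)
    also have "\<dots> = g (x \<bullet> x) * grad2 u1 x + (g (x \<bullet> x) * u x) * lap u2 x
      - (2 * g2 (x \<bullet> x) * (u x)\<^sup>2) * (x \<bullet> x) - real CARD('n) * (g1 (x \<bullet> x) * (u x)\<^sup>2)"
      by (simp only: sum.distrib sum_subtractf sum_distrib_left[symmetric] ss grad2_def lap_def sum_constant) simp
    finally show ?thesis by (simp add: P_def Q_def algebra_simps)
  qed
  have "(\<integral>x. P x \<partial>lborel) - (\<integral>x. Q x \<partial>lborel) = (\<integral>x. P x - Q x \<partial>lborel)"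
    using iP iQ by simp
  also have "\<dots> = 0"
    unfolding ident[symmetric] using intX zeroX by (simp add: Bochner_Integration.integral_sum)
  finally show ?thesis by (simp add: P_def Q_def)
qed

section \<open>The Carleman weight\<close>

text \<open>This is s^(-a-1/2) exp(b s/2) for s > 0. For s at most 0 the value is junk, and it is only used
  multiplied by a cutoff vanishing there.\<close>

definition wt :: "real \<Rightarrow> real \<Rightarrow> real \<Rightarrow> real" where
  "wt a b s = exp (b * s / 2 - (a + 1/2) * ln s)"

lemma wt_pos: "wt a b s > 0"
  by (simp add: wt_def)

lemma DERIV_wt:
  assumes "s > 0"
  shows "(wt a b has_real_derivative wt a b s * (b / 2 - (a + 1/2) / s)) (at s)"
  unfolding wt_def[abs_def] using assms
  by (auto intro!: derivative_eq_intros simp: field_simps)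

text \<open>The logarithm of the weight has derivative b/2 - (a + 1/2)/s, nonpositive as long as b s
  <= 2a + 1. Comparing ln with its tangent at the larger point \<open>t\<close> means that the
  condition has to be known only there.\<close>

lemma wt_antimono:
  assumes "0 < s" "s \<le> t" "b * t \<le> 2 * a + 1" "a \<ge> 0"
  shows "wt a b t \<le> wt a b s"
proof -
  have "ln s - ln t \<le> (s - t) / t"
    using assms by (intro ln_diff_le) auto
  then have "(a + 1/2) * (ln s - ln t) \<le> (a + 1/2) * ((s - t) / t)"
    using assms by (intro mult_left_mono) auto
  also have "\<dots> = ((a + 1/2) / t) * (s - t)" by simp
  also have "\<dots> \<le> (b / 2) * (s - t)"
    using assms by (intro mult_right_mono_neg) (auto simp: field_simps)
  finally show ?thesis by (simp add: wt_def field_simps)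
qed

text \<open>\<open>m\<close> is the logarithmic derivative of the weight. The weight is singular at
  0, so the real line is covered by t < t0, where the product vanishes, and t > 0, where the usual
  rules apply. For the two regions to overlap, \<open>ch\<close> and both its derivatives must
  vanish up to a positive \<open>t0\<close>.\<close>

lemma weighted_cutoff:
  fixes ch ch1 ch2 :: "real \<Rightarrow> real" and a b :: real
  assumes ch: "\<And>t. (ch has_real_derivative ch1 t) (at t)" "\<And>t. (ch1 has_real_derivative ch2 t) (at t)"
    and ch2: "continuous_on UNIV ch2"
    and z0: "\<And>t. t \<le> t0 \<Longrightarrow> ch t = 0 \<and> ch1 t = 0 \<and> ch2 t = 0" and t0: "t0 > 0"
  defines "m \<equiv> \<lambda>s. b / 2 - (a + 1/2) / s"
  defines "w \<equiv> \<lambda>s. wt a b s * ch s"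
    and "w1 \<equiv> \<lambda>s. wt a b s * (ch1 s + m s * ch s)"
    and "w2 \<equiv> \<lambda>s. wt a b s * (ch2 s + 2 * m s * ch1 s + ((m s)\<^sup>2 + (a + 1/2) / s\<^sup>2) * ch s)"
  shows "\<And>t. (w has_real_derivative w1 t) (at t)" "\<And>t. (w1 has_real_derivative w2 t) (at t)"
    "continuous_on UNIV w2"
proof -
  have zl: "w t = 0" "w1 t = 0" "w2 t = 0" if "t < t0" for t
    using z0[of t] that by (simp_all add: w_def w1_def w2_def)
  have dm: "(m has_real_derivative (a + 1/2) / s\<^sup>2) (at s)" if "s > 0" for s
    unfolding m_def using that
    by (auto intro!: derivative_eq_intros simp: field_simps power2_eq_square)
  have zero: "(f has_real_derivative 0) (at t)" if "\<And>t. t < t0 \<Longrightarrow> f t = 0" "t < t0" for f :: "real \<Rightarrow> real" and t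
    by (rule has_field_derivative_transform_within_open[where S="{..<t0}" and f = "\<lambda>_. 0"]) (use that in auto)
  show "(w has_real_derivative w1 t) (at t)" for t
  proof (cases "t < t0")
    case True
    then show ?thesis using zero[of w t] zl by simp
  next
    case False
    then have "t > 0" using t0 by simp
    have "((\<lambda>s. wt a b s * ch s) has_real_derivative wt a b t * m t * ch t + ch1 t * wt a b t) (at t)"
      unfolding m_def by (rule DERIV_mult[OF DERIV_wt ch(1)]) fact
    then show ?thesis by (simp add: w_def w1_def algebra_simps)
  qed
  show "(w1 has_real_derivative w2 t) (at t)" for t
  proof (cases "t < t0")
    case True
    then show ?thesis using zero[of w1 t] zl by simp
  next
    case False
    then have "t > 0" using t0 by simp
    have "((\<lambda>s. wt a b s * (ch1 s + m s * ch s)) has_real_derivative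
        wt a b t * m t * (ch1 t + m t * ch t) + (ch2 t + ((a + 1/2) / t\<^sup>2 * ch t + ch1 t * m t)) * wt a b t) (at t)"
      using DERIV_wt[OF \<open>t > 0\<close>, folded m_def]
      by (intro DERIV_mult DERIV_add ch dm \<open>t > 0\<close>) (simp add: m_def)
    then show ?thesis by (simp add: w1_def w2_def algebra_simps power2_eq_square)
  qed
  have "continuous_on ({..<t0} \<union> {0<..}) w2"
  proof (rule continuous_on_open_Un)
    have "continuous_on {..<t0} (\<lambda>_. 0::real)" by simp
    then show "continuous_on {..<t0} w2"
      by (rule continuous_on_eq) (use zl in auto)
    have "continuous_on {0<..} f" if "continuous_on UNIV f" for f :: "real \<Rightarrow> real"
      using that continuous_on_subset by blast
    then show "continuous_on {0<..} w2"
      unfolding w2_def m_def wt_def using ch2 DERIV_continuous_UNIV[of ch, OF ch(1)] DERIV_continuous_UNIV[of ch1, OF ch(2)]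
      by (auto intro!: continuous_intros)
  qed auto
  moreover have "{..<t0} \<union> {0<..} = UNIV" using t0 by auto
  ultimately show "continuous_on UNIV w2" by simp
qed

text \<open>Here the conjugation is undone: applied to y = wt ch u, the operator S + A gives s wt
  times the Laplacian of ch u. The bracket on the right is that Laplacian, with 4 ch1 (x . grad u)
  and (4 s ch2 + 2 n ch1) u coming from the gradient and the Laplacian of ch(x . x).\<close>

lemma carleman_cutoff:
  fixes u :: "real^'n::finite \<Rightarrow> real" and ch ch1 ch2 :: "real \<Rightarrow> real" and a b :: real
  assumes C: "C2data u u1 u2"
    and ch: "\<And>t. (ch has_real_derivative ch1 t) (at t)" "\<And>t. (ch1 has_real_derivative ch2 t) (at t)"
    and ch2: "continuous_on UNIV ch2"
    and z0: "\<And>t. t \<le> t0 \<Longrightarrow> ch t = 0 \<and> ch1 t = 0 \<and> ch2 t = 0" and t0: "t0 > 0"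
    and z1: "\<And>t. t \<ge> t1 \<Longrightarrow> ch t = 0 \<and> ch1 t = 0 \<and> ch2 t = 0"
    and b: "b \<ge> 0"
  shows "16 * b * (\<integral>x. (x \<bullet> x) * ((2*a - b * (x \<bullet> x))\<^sup>2 - 1) * (wt a b (x \<bullet> x) * ch (x \<bullet> x) * u x)\<^sup>2 \<partial>lborel) \<le>
    (\<integral>x. ((x \<bullet> x) * wt a b (x \<bullet> x) * (ch (x \<bullet> x) * lap u2 x + 4 * ch1 (x \<bullet> x) * radial u1 x
        + (4 * (x \<bullet> x) * ch2 (x \<bullet> x) + 2 * real CARD('n) * ch1 (x \<bullet> x)) * u x))\<^sup>2 \<partial>lborel)"
proof -
  define m where "m = (\<lambda>s. b / 2 - (a + 1/2) / s)"
  define w where "w = (\<lambda>s. wt a b s * ch s)"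
  define w1 where "w1 = (\<lambda>s. wt a b s * (ch1 s + m s * ch s))"
  define w2 where "w2 = (\<lambda>s. wt a b s * (ch2 s + 2 * m s * ch1 s + ((m s)\<^sup>2 + (a + 1/2) / s\<^sup>2) * ch s))"
  have W: "(w has_real_derivative w1 t) (at t)" "(w1 has_real_derivative w2 t) (at t)" "continuous_on UNIV w2" for t
    unfolding w_def w1_def w2_def m_def
    using weighted_cutoff[OF ch ch2 z0 t0, where a=a and b=b] by blast+
  define y1 where "y1 = (\<lambda>i x. 2 * (x $ i * (w1 (x \<bullet> x) * u x)) + w (x \<bullet> x) * u1 i x)"
  define y2 where "y2 = (\<lambda>i j x. 2 * ((if i = j then 1 else 0) * (w1 (x \<bullet> x) * u x)
            + x $ i * (w2 (x \<bullet> x) * (2 * x $ j) * u x + w1 (x \<bullet> x) * u1 j x))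
            + (w1 (x \<bullet> x) * (2 * x $ j) * u1 i x + w (x \<bullet> x) * u2 i j x))"
  note Y = C2data_radial_mult[OF C W, folded y1_def y2_def]
  define r where "r = max 1 t1"
  have zz: "w (x \<bullet> x) = 0 \<and> w1 (x \<bullet> x) = 0 \<and> w2 (x \<bullet> x) = 0" if "norm x > r" for x :: "real^'n"
  proof -
    have "norm x * 1 \<le> norm x * norm x" using that r_def by (intro mult_left_mono) auto
    then have "x \<bullet> x \<ge> t1" using that by (simp add: r_def power2_norm_eq_inner[symmetric] power2_eq_square)
    then show ?thesis using z1 by (simp add: w_def w1_def w2_def)
  qed
  have yz: "w (x \<bullet> x) * u x = 0" "y1 i x = 0" "y2 i j x = 0" if "norm x > r" for x i j
    using zz[OF that] by (auto simp: y1_def y2_def)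
  have ident: "(x \<bullet> x) * lap y2 x + 2 * (1 + (2*a - b * (x \<bullet> x))) * radial y1 x
        + (real CARD('n) - 1 + (2*a - b * (x \<bullet> x))\<^sup>2 + real CARD('n) * (2*a - b * (x \<bullet> x)) - 2*b*(x \<bullet> x)) * (w (x \<bullet> x) * u x)
     = (x \<bullet> x) * wt a b (x \<bullet> x) * (ch (x \<bullet> x) * lap u2 x + 4 * ch1 (x \<bullet> x) * radial u1 x
        + (4 * (x \<bullet> x) * ch2 (x \<bullet> x) + 2 * real CARD('n) * ch1 (x \<bullet> x)) * u x)" (is "?L = ?R") for x
  proof (cases "x \<bullet> x \<le> t0")
    case True
    then show ?thesis unfolding Y(2,3) using z0[OF True] by (simp add: w_def w1_def w2_def)
  next
    case False
    define s where "s = x \<bullet> x"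
    define n where "n = real CARD('n)"
    have s: "s > 0" using False t0 unfolding s_def by linarith
    \<comment> \<open>With k = s m all quotients by s disappear and the claim becomes a polynomial
      identity. The extra 1/2 in the exponent of the weight makes 2a - b s equal to -2k - 1, so that
      the first-order term 2 (1 + p) w radial u cancels the one that 4 s w1 radial u takes from the
      weight.\<close>
    define k where "k = s * m s"
    have k: "m s = k / s" using s by (simp add: k_def)
    have bs: "b * s = 2 * k + (2 * a + 1)" using s by (simp add: k_def m_def field_simps)
    let ?c = "ch s" and ?c1 = "ch1 s" and ?c2 = "ch2 s" and ?W = "wt a b s" and ?E = "radial u1 x" and ?L = "lap u2 x"
    have p: "2 * a - b * s = - 2 * k - 1" using bs by simp
    have a1: "s * w1 s = ?W * (s * ?c1 + k * ?c)" by (simp add: w1_def k_def algebra_simps)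
    have a2: "s * (s * w2 s) = ?W * (s * s * ?c2 + 2 * s * k * ?c1 + (k\<^sup>2 + (a + 1/2)) * ?c)"
      unfolding w2_def k using s by (simp add: field_simps power2_eq_square)
    have "LL = RR" if "LL = s * (2 * n * w1 s * u x + 4 * s * w2 s * u x + 4 * w1 s * ?E + w s * ?L)
      + 2 * (1 + (2*a - b * s)) * (2 * s * w1 s * u x + w s * ?E)
      + (n - 1 + (2*a - b * s)\<^sup>2 + n * (2*a - b * s) - 2*(b * s)) * (w s * u x)"
      "RR = s * ?W * (?c * ?L + 4 * ?c1 * ?E + (4 * s * ?c2 + 2 * n * ?c1) * u x)" for LL RR
    proof -
      have "LL = 2 * n * (s * w1 s) * u x + 4 * (s * (s * w2 s)) * u x + 4 * (s * w1 s) * ?E + s * w s * ?L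
        - 4 * k * (2 * (s * w1 s) * u x + w s * ?E)
        + (n - 1 + (- 2 * k - 1)\<^sup>2 + n * (- 2 * k - 1) - 2*(2 * k + (2 * a + 1))) * (w s * u x)"
        unfolding that(1) p unfolding bs by (simp add: algebra_simps)
      also have "\<dots> = RR"
        unfolding that(2) a1 a2 w_def by (simp add: field_simps power2_eq_square)
      finally show ?thesis .
    qed
    then show ?thesis
      unfolding Y(2,3) s_def[symmetric] n_def[symmetric] by (simp add: mult.assoc)
  qed
  have "16 * b * (\<integral>x. (x \<bullet> x) * ((2*a - b * (x \<bullet> x))\<^sup>2 - 1) * (w (x \<bullet> x) * u x)\<^sup>2 \<partial>lborel) \<le> (\<integral>x. (?R x)\<^sup>2 \<partial>lborel)"
    using carleman_conjugated[OF Y(1) b yz, where a = a] unfolding ident by simp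
  then show ?thesis by (simp add: w_def)
qed

section \<open>Caccioppoli inequality and cutoff errors\<close>

lemma integrable_ball_continuous:
  fixes f :: "'a::euclidean_space \<Rightarrow> real"
  assumes "continuous_on UNIV f"
  shows "integrable lborel (\<lambda>x. indicator (ball 0 r) x * f x)"
proof -
  have "integrable lborel (\<lambda>x. indicator (cball 0 r) x *\<^sub>R f x)"
    by (rule borel_integrable_compact) (auto intro: continuous_on_subset assms)
  then have "integrable lborel (\<lambda>x. indicator (ball 0 r) x *\<^sub>R (indicator (cball 0 r) x *\<^sub>R f x))"
    by (rule integrable_mult_indicator[rotated]) simp
  moreover have "(\<lambda>x. indicator (ball 0 r) x *\<^sub>R (indicator (cball 0 r) x *\<^sub>R f x)) = (\<lambda>x. indicator (ball 0 r) x * f x)"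
    by (auto simp: indicator_def fun_eq_iff)
  ultimately show ?thesis by simp
qed

lemma radial_le_grad2: "(radial u1 x)\<^sup>2 \<le> (x \<bullet> x) * grad2 u1 x"
  using Cauchy_Schwarz_ineq_sum[of "\<lambda>i. x $ i" "\<lambda>i. u1 i x" UNIV]
  by (simp add: radial_def grad2_def inner_vec_def power2_eq_square)

lemma grad2_nonneg: "grad2 u1 x \<ge> 0"
  by (simp add: grad2_def sum_nonneg)

lemma inner_self_less_iff: "r > 0 \<Longrightarrow> x \<bullet> x < r\<^sup>2 \<longleftrightarrow> norm x < r"
  by (metis norm_ge_zero not_less order_less_imp_le power2_norm_eq_inner power_less_imp_less_base power_strict_mono zero_less_numeral)

lemma DERIV_smoothstep_affine:
  "((\<lambda>t. smoothstep (p + q * t)) has_real_derivative q * smoothstep1 (p + q * t)) (at t)"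
  "((\<lambda>t. smoothstep1 (p + q * t)) has_real_derivative q * smoothstep2 (p + q * t)) (at t)"
proof -
  have "((\<lambda>t. p + q * t) has_real_derivative q) (at t)"
    by (auto intro!: derivative_eq_intros)
  from DERIV_chain'[OF this DERIV_smoothstep(1)] DERIV_chain'[OF this DERIV_smoothstep(2)]
  show "((\<lambda>t. smoothstep (p + q * t)) has_real_derivative q * smoothstep1 (p + q * t)) (at t)"
    "((\<lambda>t. smoothstep1 (p + q * t)) has_real_derivative q * smoothstep2 (p + q * t)) (at t)"
    by (simp_all add: mult.commute)
qed

text \<open>The cutoff is 1 for |x|^2 <= r^2/2 and 0 outside the ball of radius r; r >= 1 bounds its
  derivatives uniformly. In the constant, 576 = 2 * 4 * 72 and 18 n = 2 * 9 n come from the second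
  and the first derivative, and the remaining 1 from |u lap u| <= u^2 + (lap u)^2.\<close>

lemma caccioppoli:
  fixes u :: "real^'n::finite \<Rightarrow> real"
  assumes C: "C2data u u1 u2" and r: "r \<ge> 1"
  shows "(\<integral>x. smoothstep (2 - 2 * (x \<bullet> x) / r\<^sup>2) * grad2 u1 x \<partial>lborel) \<le>
     (577 + 18 * real CARD('n)) * (\<integral>x. indicator (ball 0 r) x * ((u x)\<^sup>2 + (lap u2 x)\<^sup>2) \<partial>lborel)"
proof -
  define n where "n = real CARD('n)"
  define q where "q = - 2 / r\<^sup>2"
  have r2: "r\<^sup>2 \<ge> 1" using r by simp
  have q: "\<bar>q\<bar> \<le> 2" "\<bar>r\<^sup>2 * q\<^sup>2\<bar> \<le> 4"
    using r2 by (auto simp: q_def power2_eq_square field_simps)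
  have z: "smoothstep (2 + q * t) = 0 \<and> q * smoothstep1 (2 + q * t) = 0 \<and> q * (q * smoothstep2 (2 + q * t)) = 0"
    if "t \<ge> r\<^sup>2" for t
  proof -
    have "r\<^sup>2 > 0" using r by simp
    then have "2 + q * t \<le> 0" using that by (simp add: q_def field_simps)
    then show ?thesis using smoothstep_left by simp
  qed
  have cont: "continuous_on UNIV u" "\<And>i j. continuous_on UNIV (u2 i j)"
    using C by (auto simp: C2data_def)
  have c2: "continuous_on UNIV (\<lambda>t. q * (q * smoothstep2 (2 + q * t)))" by (intro continuous_intros)
  have id: "(\<integral>x. smoothstep (2 + q * (x \<bullet> x)) * grad2 u1 x \<partial>lborel) =
      (\<integral>x. (2 * (x \<bullet> x) * (q * (q * smoothstep2 (2 + q * (x \<bullet> x)))) + real CARD('n) * (q * smoothstep1 (2 + q * (x \<bullet> x)))) * (u x)\<^sup>2 -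
         smoothstep (2 + q * (x \<bullet> x)) * (u x * lap u2 x) \<partial>lborel)"
    by (rule caccioppoli_identity[OF C DERIV_smoothstep_affine(1)[where p=2 and q=q]
      DERIV_cmult[OF DERIV_smoothstep_affine(2)[where p=2 and q=q], where c=q] c2 z])
  have "(\<integral>x. smoothstep (2 + q * (x \<bullet> x)) * grad2 u1 x \<partial>lborel)
     \<le> (\<integral>x. (577 + 18 * n) * (indicator (ball 0 r) x * ((u x)\<^sup>2 + (lap u2 x)\<^sup>2)) \<partial>lborel)"
    unfolding id
  proof (rule integral_mono')
    show "integrable lborel (\<lambda>x. (577 + 18 * n) * (indicator (ball 0 r) x * ((u x)\<^sup>2 + (lap u2 x)\<^sup>2)))"
      by (intro integrable_mult_right integrable_ball_continuous) (auto simp: lap_def intro!: continuous_intros cont)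
    fix x :: "real^'n"
    show "0 \<le> (577 + 18 * n) * (indicator (ball 0 r) x * ((u x)\<^sup>2 + (lap u2 x)\<^sup>2))" by (simp add: n_def)
    define s where "s = x \<bullet> x"
    let ?g = "smoothstep (2 + q * s)" and ?g1 = "smoothstep1 (2 + q * s)" and ?g2 = "smoothstep2 (2 + q * s)"
    have "(2 * s * (q * (q * ?g2)) + n * (q * ?g1)) * (u x)\<^sup>2 - ?g * (u x * lap u2 x)
        \<le> (577 + 18 * n) * (indicator (ball 0 r) x * ((u x)\<^sup>2 + (lap u2 x)\<^sup>2))"
    proof (cases "norm x < r")
      case False
      then have "s \<ge> r\<^sup>2" using r inner_self_less_iff[of r x] s_def by auto
      then show ?thesis using False z[of s] by auto
    next
      case True
      then have s: "s < r\<^sup>2" "s \<ge> 0" using r inner_self_less_iff[of r x] s_def by auto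
      have "\<bar>2 * s * (q * (q * ?g2))\<bar> = 2 * (s * q\<^sup>2) * \<bar>?g2\<bar>"
        using s by (simp add: abs_mult power2_eq_square)
      also have "\<dots> \<le> 2 * (r\<^sup>2 * q\<^sup>2) * 72"
        using s smoothstep_bounds by (intro mult_mono) auto
      also have "\<dots> \<le> 576" using q(2) by linarith
      finally have 1: "\<bar>2 * s * (q * (q * ?g2))\<bar> \<le> 576" .
      have "\<bar>n * (q * ?g1)\<bar> = n * (\<bar>q\<bar> * \<bar>?g1\<bar>)" by (simp add: abs_mult n_def)
      also have "\<dots> \<le> n * (2 * 9)"
        using q smoothstep_bounds by (intro mult_left_mono mult_mono) (auto simp: n_def)
      finally have 2: "\<bar>n * (q * ?g1)\<bar> \<le> 18 * n" by simp
      have "\<bar>?g * (u x * lap u2 x)\<bar> \<le> 1 * \<bar>u x * lap u2 x\<bar>"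
        unfolding abs_mult using smoothstep_bounds by (intro mult_right_mono) auto
      also have "\<dots> \<le> ((u x)\<^sup>2 + (lap u2 x)\<^sup>2)"
        using sum_squares_bound[of "\<bar>u x\<bar>" "\<bar>lap u2 x\<bar>"]
          mult_nonneg_nonneg[OF abs_ge_zero[of "u x"] abs_ge_zero[of "lap u2 x"]]
        unfolding abs_mult power2_abs by linarith
      finally have 3: "- (?g * (u x * lap u2 x)) \<le> ((u x)\<^sup>2 + (lap u2 x)\<^sup>2)" by simp
      have "(2 * s * (q * (q * ?g2)) + n * (q * ?g1)) * (u x)\<^sup>2 \<le> (576 + 18 * n) * (u x)\<^sup>2"
        using 1 2 by (intro mult_right_mono) auto
      moreover have "0 \<le> (576 + 18 * n) * (lap u2 x)\<^sup>2" by (simp add: n_def)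
      ultimately show ?thesis using 3 True by (simp add: algebra_simps)
    qed
    then show "(2 * (x \<bullet> x) * (q * (q * smoothstep2 (2 + q * (x \<bullet> x)))) + real CARD('n) * (q * smoothstep1 (2 + q * (x \<bullet> x)))) * (u x)\<^sup>2 -
         smoothstep (2 + q * (x \<bullet> x)) * (u x * lap u2 x) \<le> (577 + 18 * n) * (indicator (ball 0 r) x * ((u x)\<^sup>2 + (lap u2 x)\<^sup>2))"
      by (simp add: s_def n_def)
  qed
  then show ?thesis by (simp add: q_def n_def)
qed

text \<open>In s = |x|^2 the cutoff rises on [1/4, 1/2] and falls on [4 R^2, 8 R^2]. On the first
  interval the Caccioppoli cutoff of radius 1 is still 1, on the second the one of radius 4 R, so
  both can absorb the gradients that appear there. The plateau contains the shell at distance about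
  R that carries the unit mass.\<close>

definition cutoff :: "real \<Rightarrow> real \<Rightarrow> real" where
  "cutoff R s = smoothstep (4 * s - 1) * smoothstep (2 - s / (4 * R\<^sup>2))"
definition cutoff1 :: "real \<Rightarrow> real \<Rightarrow> real" where
  "cutoff1 R s = 4 * smoothstep1 (4 * s - 1) * smoothstep (2 - s / (4 * R\<^sup>2))
     - smoothstep (4 * s - 1) * smoothstep1 (2 - s / (4 * R\<^sup>2)) / (4 * R\<^sup>2)"
definition cutoff2 :: "real \<Rightarrow> real \<Rightarrow> real" where
  "cutoff2 R s = 16 * smoothstep2 (4 * s - 1) * smoothstep (2 - s / (4 * R\<^sup>2))
     - 8 * smoothstep1 (4 * s - 1) * smoothstep1 (2 - s / (4 * R\<^sup>2)) / (4 * R\<^sup>2)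
     + smoothstep (4 * s - 1) * smoothstep2 (2 - s / (4 * R\<^sup>2)) / (4 * R\<^sup>2)\<^sup>2"

lemma DERIV_cutoff:
  assumes "R > 0"
  shows "(cutoff R has_real_derivative cutoff1 R t) (at t)" "(cutoff1 R has_real_derivative cutoff2 R t) (at t)"
    "continuous_on UNIV (cutoff2 R)"
proof -
  define q where "q = - 1 / (4 * R\<^sup>2)"
  have 0: "cutoff R = (\<lambda>s. smoothstep (-1 + 4 * s) * smoothstep (2 + q * s))"
    by (simp add: cutoff_def fun_eq_iff q_def)
  have 1: "cutoff1 R = (\<lambda>s. 4 * smoothstep1 (-1 + 4 * s) * smoothstep (2 + q * s) + q * (smoothstep (-1 + 4 * s) * smoothstep1 (2 + q * s)))"
    by (simp add: cutoff1_def fun_eq_iff q_def)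
  have 2: "cutoff2 R = (\<lambda>s. 16 * smoothstep2 (-1 + 4 * s) * smoothstep (2 + q * s) + q * (8 * smoothstep1 (-1 + 4 * s) * smoothstep1 (2 + q * s))
     + q\<^sup>2 * (smoothstep (-1 + 4 * s) * smoothstep2 (2 + q * s)))"
    by (simp add: cutoff2_def fun_eq_iff q_def power2_eq_square)
  show "(cutoff R has_real_derivative cutoff1 R t) (at t)"
    unfolding 0 1 by (rule derivative_eq_intros DERIV_smoothstep_affine refl | simp)+
  show "(cutoff1 R has_real_derivative cutoff2 R t) (at t)"
    unfolding 1 2 by (rule derivative_eq_intros DERIV_smoothstep_affine refl | simp add: power2_eq_square algebra_simps)+
  have "continuous_on UNIV smoothstep" "continuous_on UNIV smoothstep1"
    using DERIV_continuous_UNIV DERIV_smoothstep by blast+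
  then have "continuous_on UNIV (\<lambda>s. smoothstep (p + q * s))" "continuous_on UNIV (\<lambda>s. smoothstep1 (p + q * s))" for p q
    by (auto intro!: continuous_on_compose2[of UNIV smoothstep] continuous_on_compose2[of UNIV smoothstep1] continuous_intros)
  then show "continuous_on UNIV (cutoff2 R)"
    unfolding 2 by (intro continuous_intros)
qed

lemma cutoff_zero:
  assumes "R > 0" "t \<le> 1/4 \<or> t \<ge> 8 * R\<^sup>2"
  shows "cutoff R t = 0 \<and> cutoff1 R t = 0 \<and> cutoff2 R t = 0"
proof -
  have "4 * t - 1 \<le> 0 \<or> 2 - t / (4 * R\<^sup>2) \<le> 0"
    using assms by (auto simp: field_simps)
  then show ?thesis using smoothstep_left by (auto simp: cutoff_def cutoff1_def cutoff2_def)
qed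

lemma cutoff_eq_1:
  assumes "R > 0" "1/2 \<le> t" "t \<le> 4 * R\<^sup>2"
  shows "cutoff R t = 1" "cutoff1 R t = 0" "cutoff2 R t = 0"
proof -
  have "4 * t - 1 \<ge> 1" "2 - t / (4 * R\<^sup>2) \<ge> 1"
    using assms by (auto simp: field_simps)
  then show "cutoff R t = 1" "cutoff1 R t = 0" "cutoff2 R t = 0"
    using smoothstep_right by (auto simp: cutoff_def cutoff1_def cutoff2_def)
qed

section \<open>Size of the cutoff errors\<close>

lemma square_two_terms:
  fixes E u G :: real
  assumes "\<bar>c\<bar>\<^sup>2 * E\<^sup>2 \<le> B\<^sup>2 * G" "\<bar>d\<bar> \<le> B"
  shows "(c * E + d * u)\<^sup>2 \<le> 2 * B\<^sup>2 * (G + u\<^sup>2)"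
proof -
  have "(c * E + d * u)\<^sup>2 \<le> 2 * (c * E)\<^sup>2 + 2 * (d * u)\<^sup>2"
    using sum_squares_bound[of "c * E" "d * u"] by (simp add: power2_sum)
  moreover have "d\<^sup>2 \<le> B\<^sup>2" using assms(2) by (metis abs_ge_zero power2_abs power_mono)
  then have "d\<^sup>2 * u\<^sup>2 \<le> B\<^sup>2 * u\<^sup>2" by (intro mult_right_mono) auto
  ultimately show ?thesis using assms(1) by (simp add: power_mult_distrib algebra_simps)
qed

text \<open>\<open>E\<close>, \<open>G\<close> and \<open>u\<close> stand for the radial derivative,
  the squared gradient and the value at a point with x . x = s. The terms live on the two annuli of
  the cutoff, where the decreasing weight is at most its value at the inner edge. The constants 2304
  = 4 * (1/2) * 1152 and 72 n = 2 n * 36 are sized for the inner annulus and are generous for the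
  outer one; 128 = 2 * 64, the 64 R^4 being (8 R^2)^2.\<close>

lemma cutoff_remainder:
  fixes E u G s n R a b :: real
  assumes R: "R \<ge> 1" and s: "s \<ge> 0" and E: "E\<^sup>2 \<le> s * G" and G: "G \<ge> 0" and n: "n \<ge> 0"
    and ab: "a \<ge> 0" "b * (8 * R\<^sup>2) \<le> 2 * a + 1" "b \<ge> 0"
  shows "(s * wt a b s * (4 * cutoff1 R s * E + (4 * s * cutoff2 R s + 2 * n * cutoff1 R s) * u))\<^sup>2 \<le>
    128 * (2304 + 72 * n)\<^sup>2 * ((wt a b (1/4))\<^sup>2 * smoothstep (2 - 2 * s)
       + R ^ 4 * (wt a b (4 * R\<^sup>2))\<^sup>2 * smoothstep (2 - s / (8 * R\<^sup>2))) * (G + u\<^sup>2)"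
proof -
  define B where "B = 2304 + 72 * n"
  define T where "T = 4 * cutoff1 R s * E + (4 * s * cutoff2 R s + 2 * n * cutoff1 R s) * u"
  have R2: "R\<^sup>2 \<ge> 1" "R\<^sup>2 > 0" using R by simp_all
  have bt: "b * t \<le> 2 * a + 1" if "t \<le> 8 * R\<^sup>2" for t
    using ab that by (meson mult_left_mono order_trans)
  have Gu: "G + u\<^sup>2 \<ge> 0" using G by simp
  have "(s * wt a b s)\<^sup>2 * T\<^sup>2 \<le> 128 * B\<^sup>2 * ((wt a b (1/4))\<^sup>2 * smoothstep (2 - 2 * s)
       + R ^ 4 * (wt a b (4 * R\<^sup>2))\<^sup>2 * smoothstep (2 - s / (8 * R\<^sup>2))) * (G + u\<^sup>2)" (is "_ \<le> ?rhs")
  proof -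
    have rhs0: "?rhs \<ge> 0"
      using G smoothstep_bounds by (intro mult_nonneg_nonneg add_nonneg_nonneg) auto
    consider "s \<le> 1/4 \<or> s \<ge> 8 * R\<^sup>2 \<or> (1/2 \<le> s \<and> s \<le> 4 * R\<^sup>2)" | "1/4 < s" "s < 1/2" | "4 * R\<^sup>2 < s" "s < 8 * R\<^sup>2"
      by linarith
    then show ?thesis
    proof cases
      case 1
      then have "T = 0"
        using cutoff_zero[of R s] cutoff_eq_1[of R s] R by (auto simp: T_def)
      then show ?thesis using rhs0 by simp
    next
      case 2
      have "2 - s / (4 * R\<^sup>2) \<ge> 1" using 2 R2 by (simp add: field_simps)
      then have c: "cutoff1 R s = 4 * smoothstep1 (4 * s - 1)" "cutoff2 R s = 16 * smoothstep2 (4 * s - 1)"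
        using smoothstep_right by (auto simp: cutoff1_def cutoff2_def)
      have c1: "\<bar>cutoff1 R s\<bar> \<le> 36" "\<bar>cutoff2 R s\<bar> \<le> 1152"
        using smoothstep_bounds[of "4 * s - 1"] by (auto simp: c abs_mult)
      have "E\<^sup>2 \<le> 1 * G" using E by (rule order_trans) (use G 2 in \<open>intro mult_right_mono, auto\<close>)
      have T: "T\<^sup>2 \<le> 2 * B\<^sup>2 * (G + u\<^sup>2)"
        unfolding T_def
      proof (rule square_two_terms)
        have "\<bar>4 * cutoff1 R s\<bar>\<^sup>2 * E\<^sup>2 \<le> B\<^sup>2 * (1 * G)"
          using c1 n G \<open>E\<^sup>2 \<le> 1 * G\<close> by (intro mult_mono power_mono) (auto simp: B_def)
        then show "\<bar>4 * cutoff1 R s\<bar>\<^sup>2 * E\<^sup>2 \<le> B\<^sup>2 * G" by simp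
        have "\<bar>4 * s * cutoff2 R s + 2 * n * cutoff1 R s\<bar> \<le> 4 * s * \<bar>cutoff2 R s\<bar> + 2 * n * \<bar>cutoff1 R s\<bar>"
          using s n by (intro order_trans[OF abs_triangle_ineq]) (simp add: abs_mult)
        also have "\<dots> \<le> 4 * (1/2) * 1152 + 2 * n * 36"
          using s n c1 2 by (intro add_mono mult_mono) auto
        finally show "\<bar>4 * s * cutoff2 R s + 2 * n * cutoff1 R s\<bar> \<le> B" by (simp add: B_def)
      qed
      have "wt a b s \<le> wt a b (1/4)"
        using 2 ab(1) bt R2 by (intro wt_antimono) auto
      then have "s * wt a b s \<le> 1 * wt a b (1/4)"
        using 2 wt_pos[of a b s] by (intro mult_mono) auto
      then have W: "(s * wt a b s)\<^sup>2 \<le> (wt a b (1/4))\<^sup>2"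
        using s wt_pos[of a b s] by (intro power_mono) auto
      have "(s * wt a b s)\<^sup>2 * T\<^sup>2 \<le> (wt a b (1/4))\<^sup>2 * (2 * B\<^sup>2 * (G + u\<^sup>2))"
        using T W by (intro mult_mono) auto
      also have "\<dots> \<le> ?rhs"
      proof -
        have "smoothstep (2 - 2 * s) = 1" using smoothstep_right[of "2 - 2 * s"] 2 by simp
        moreover have "0 \<le> 126 * B\<^sup>2 * (wt a b (1/4))\<^sup>2 * (G + u\<^sup>2)" using Gu by simp
        moreover have "0 \<le> 128 * B\<^sup>2 * (R ^ 4 * (wt a b (4 * R\<^sup>2))\<^sup>2 * smoothstep (2 - s / (8 * R\<^sup>2))) * (G + u\<^sup>2)"
          using Gu smoothstep_bounds by (intro mult_nonneg_nonneg) auto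
        ultimately show ?thesis by (simp add: algebra_simps)
      qed
      finally show ?thesis .
    next
      case 3
      have "4 * s - 1 \<ge> 1" using 3 R2 by simp
      then have c: "cutoff1 R s = - smoothstep1 (2 - s / (4 * R\<^sup>2)) / (4 * R\<^sup>2)"
        "cutoff2 R s = smoothstep2 (2 - s / (4 * R\<^sup>2)) / (4 * R\<^sup>2)\<^sup>2"
        using smoothstep_right by (auto simp: cutoff1_def cutoff2_def)
      have c1: "\<bar>cutoff1 R s\<bar> \<le> 9 / (4 * R\<^sup>2)" "\<bar>cutoff2 R s\<bar> \<le> 72 / (4 * R\<^sup>2)\<^sup>2"
        using smoothstep_bounds[of "2 - s / (4 * R\<^sup>2)"] R2
        by (auto simp only: c abs_divide abs_minus_cancel abs_of_nonneg zero_le_power2 intro!: divide_right_mono frac_le)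
      have T: "T\<^sup>2 \<le> 2 * B\<^sup>2 * (G + u\<^sup>2)"
        unfolding T_def
      proof (rule square_two_terms)
        \<comment> \<open>The derivative of the outer cutoff is of order 1/R^2, and its square
          outweighs the factor s <= 8 R^2 in E^2 <= s G.\<close>
        have "\<bar>4 * cutoff1 R s\<bar>\<^sup>2 * E\<^sup>2 \<le> (9 / R\<^sup>2)\<^sup>2 * ((8 * R\<^sup>2) * G)"
        proof (intro mult_mono power_mono)
          show "E\<^sup>2 \<le> 8 * R\<^sup>2 * G" using E by (rule order_trans) (use G 3 in \<open>intro mult_right_mono, auto\<close>)
        qed (use c1 in auto)
        also have "\<dots> = (648 / R\<^sup>2) * G" using R by (simp add: power2_eq_square field_simps)
        also have "\<dots> \<le> B\<^sup>2 * G"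
        proof (intro mult_right_mono)
          have "648 / R\<^sup>2 \<le> 648" using R2 by (simp add: field_simps)
          also have "648 \<le> (2304::real)\<^sup>2" by simp
          also have "\<dots> \<le> B\<^sup>2" using n by (intro power_mono) (auto simp: B_def)
          finally show "648 / R\<^sup>2 \<le> B\<^sup>2" .
        qed fact
        finally show "\<bar>4 * cutoff1 R s\<bar>\<^sup>2 * E\<^sup>2 \<le> B\<^sup>2 * G" .
        have "\<bar>4 * s * cutoff2 R s + 2 * n * cutoff1 R s\<bar> \<le> 4 * s * \<bar>cutoff2 R s\<bar> + 2 * n * \<bar>cutoff1 R s\<bar>"
          using s n by (intro order_trans[OF abs_triangle_ineq]) (simp add: abs_mult)
        also have "\<dots> \<le> 4 * (8 * R\<^sup>2) * (72 / (4 * R\<^sup>2)\<^sup>2) + 2 * n * (9 / (4 * R\<^sup>2))"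
          using s n c1 3 by (intro add_mono mult_mono) auto
        also have "\<dots> = (144 + 9/2 * n) / R\<^sup>2" using R by (simp add: power2_eq_square field_simps)
        also have "\<dots> \<le> (144 + 9/2 * n) / 1" using n R2 by (intro divide_left_mono) auto
        finally show "\<bar>4 * s * cutoff2 R s + 2 * n * cutoff1 R s\<bar> \<le> B" using n by (simp add: B_def)
      qed
      have "wt a b s \<le> wt a b (4 * R\<^sup>2)"
        using 3 ab(1) bt R2 by (intro wt_antimono) auto
      then have "s * wt a b s \<le> (8 * R\<^sup>2) * wt a b (4 * R\<^sup>2)"
        using 3 s wt_pos[of a b s] by (intro mult_mono) auto
      then have "(s * wt a b s)\<^sup>2 \<le> ((8 * R\<^sup>2) * wt a b (4 * R\<^sup>2))\<^sup>2"
        using s wt_pos[of a b s] by (intro power_mono) auto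
      also have "\<dots> = 64 * (R ^ 4 * (wt a b (4 * R\<^sup>2))\<^sup>2)" by (simp add: power_mult_distrib power_mult[symmetric])
      finally have W: "(s * wt a b s)\<^sup>2 \<le> 64 * (R ^ 4 * (wt a b (4 * R\<^sup>2))\<^sup>2)" .
      have "(s * wt a b s)\<^sup>2 * T\<^sup>2 \<le> 64 * (R ^ 4 * (wt a b (4 * R\<^sup>2))\<^sup>2) * (2 * B\<^sup>2 * (G + u\<^sup>2))"
        using T W by (intro mult_mono) auto
      also have "\<dots> \<le> ?rhs"
      proof -
        have "2 - s / (8 * R\<^sup>2) \<ge> 1" using 3 R2 by (simp add: field_simps)
        then have "smoothstep (2 - s / (8 * R\<^sup>2)) = 1" using smoothstep_right by blast
        moreover have "0 \<le> 128 * B\<^sup>2 * ((wt a b (1/4))\<^sup>2 * smoothstep (2 - 2 * s)) * (G + u\<^sup>2)"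
          using Gu smoothstep_bounds by (intro mult_nonneg_nonneg) auto
        ultimately show ?thesis by (simp add: algebra_simps)
      qed
      finally show ?thesis .
    qed
  qed
  then show ?thesis by (simp add: T_def B_def power_mult_distrib)
qed

section \<open>The a priori inequality for smooth functions\<close>

lemma continuous_wt_cutoff:
  assumes "R > 0"
  shows "continuous_on UNIV (\<lambda>t. wt a b t * cutoff R t)"
  by (rule DERIV_continuous_UNIV, rule weighted_cutoff(1)[OF DERIV_cutoff[OF assms], where ?t0.0="1/4"])
     (use cutoff_zero[OF assms] in auto)

text \<open>The Laplacian stays a term of its own and no equation is assumed, so the bound applies
  to mollifications. The gradients in the cutoff errors are removed by the Caccioppoli inequality on
  the balls of radius 1 and 4 R; 578 is 577 plus 1 for the u^2 beside the gradient, and 256 is twice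
  128.\<close>

lemma carleman_apriori:
  fixes u :: "real^'n::finite \<Rightarrow> real" and a R :: real
  assumes C: "C2data u u1 u2" and R: "R \<ge> 1" and a: "a \<ge> 1"
  defines "n \<equiv> real CARD('n)"
  defines "b \<equiv> a / (8 * R\<^sup>2)"
  defines "I \<equiv> \<lambda>r. \<integral>x. indicator (ball 0 r) x * ((u x)\<^sup>2 + (lap u2 x)\<^sup>2) \<partial>lborel"
  shows "16 * b * (a\<^sup>2 - 1) * (\<integral>x. (x \<bullet> x) * (wt a b (x \<bullet> x) * cutoff R (x \<bullet> x))\<^sup>2 * (u x)\<^sup>2 \<partial>lborel) \<le>
     2 * (\<integral>x. (x \<bullet> x)\<^sup>2 * (wt a b (x \<bullet> x) * cutoff R (x \<bullet> x))\<^sup>2 * (lap u2 x)\<^sup>2 \<partial>lborel)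
     + 256 * (2304 + 72 * n)\<^sup>2 * (578 + 18 * n) * ((wt a b (1/4))\<^sup>2 * I 1 + R ^ 4 * (wt a b (4 * R\<^sup>2))\<^sup>2 * I (4 * R))"
proof -
  have R0: "R > 0" "R\<^sup>2 > 0" "R\<^sup>2 \<ge> 1" using R by auto
  have b: "b \<ge> 0" "b * (8 * R\<^sup>2) = a" using R a by (auto simp: b_def)
  define w where "w = (\<lambda>t. wt a b t * cutoff R t)"
  have cw: "continuous_on UNIV (\<lambda>x::real^'n. w (x \<bullet> x))"
    by (rule continuous_on_compose2[OF continuous_wt_cutoff[OF R0(1), of a b, folded w_def]]) (auto intro!: continuous_intros)
  have cont: "continuous_on UNIV u" "\<And>i. continuous_on UNIV (u1 i)" "\<And>i j. continuous_on UNIV (u2 i j)"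
    using C by (auto simp: C2data_def)
  have cl: "continuous_on UNIV (lap u2)" and cG: "continuous_on UNIV (grad2 u1)"
    unfolding lap_def[abs_def] grad2_def[abs_def] by (intro continuous_intros cont)+
  have css: "continuous_on UNIV (\<lambda>x::real^'n. smoothstep (2 - 2 * (x \<bullet> x) / r\<^sup>2))" for r
    unfolding smoothstep_def cub_def divide_inverse by (intro continuous_intros)
  have ball_iff: "x \<bullet> x < r\<^sup>2 \<longleftrightarrow> norm x < r" if "r > 0" for r and x :: "real^'n"
    using inner_self_less_iff[OF that] .
  have wz: "w (x \<bullet> x) = 0" if "norm x > 4 * R" for x :: "real^'n"
  proof -
    have "x \<bullet> x \<ge> (4 * R)\<^sup>2" using ball_iff[of "4 * R" x] that R0 by auto
    then have "x \<bullet> x \<ge> 8 * R\<^sup>2" using R0 by (simp add: power_mult_distrib)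
    then show ?thesis using cutoff_zero[OF R0(1)] by (simp add: w_def)
  qed
  define rem where "rem = (\<lambda>x. 4 * cutoff1 R (x \<bullet> x) * radial u1 x
        + (4 * (x \<bullet> x) * cutoff2 R (x \<bullet> x) + 2 * n * cutoff1 R (x \<bullet> x)) * u x)"
  define Z where "Z = (\<lambda>r x::real^'n. smoothstep (2 - 2 * (x \<bullet> x) / r\<^sup>2))"
  define J where "J = (\<lambda>r. \<integral>x. Z r x * (grad2 u1 x + (u x)\<^sup>2) \<partial>lborel)"
  have Zz: "Z r x = 0" if "norm x \<ge> r" "r > 0" for r x
  proof -
    have "x \<bullet> x \<ge> r\<^sup>2" using ball_iff[of r x] that by auto
    then have "2 - 2 * (x \<bullet> x) / r\<^sup>2 \<le> 0" using that by (simp add: field_simps)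
    then show ?thesis using smoothstep_left by (simp add: Z_def)
  qed
  have intZ: "integrable lborel (\<lambda>x. Z r x * f x)" if "continuous_on UNIV f" "r > 0" for r f
    by (rule integrable_continuous_bounded_support[where r=r])
       (use css[of r] that Zz in \<open>auto simp: Z_def intro!: continuous_intros\<close>)
  have intI: "integrable lborel (\<lambda>x. indicator (ball 0 r) x * ((u x)\<^sup>2 + (lap u2 x)\<^sup>2))" for r
    by (rule integrable_ball_continuous) (intro continuous_intros cont cl)
  have JI: "J r \<le> (578 + 18 * n) * I r" if "r \<ge> 1" for r
  proof -
    have "J r = (\<integral>x. Z r x * grad2 u1 x \<partial>lborel) + (\<integral>x. Z r x * (u x)\<^sup>2 \<partial>lborel)"
      unfolding J_def distrib_left using that
      by (intro Bochner_Integration.integral_add intZ continuous_intros cG cont) auto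
    moreover have "(\<integral>x. Z r x * grad2 u1 x \<partial>lborel) \<le> (577 + 18 * n) * I r"
      unfolding Z_def I_def n_def by (rule caccioppoli[OF C that])
    moreover have "(\<integral>x. Z r x * (u x)\<^sup>2 \<partial>lborel) \<le> I r"
      unfolding I_def
    proof (rule integral_mono'[OF intI])
      fix x
      show "Z r x * (u x)\<^sup>2 \<le> indicator (ball 0 r) x * ((u x)\<^sup>2 + (lap u2 x)\<^sup>2)"
      proof (cases "norm x < r")
        case True
        have "Z r x * (u x)\<^sup>2 \<le> 1 * (u x)\<^sup>2"
          unfolding Z_def using smoothstep_bounds by (intro mult_right_mono) auto
        also have "\<dots> \<le> (u x)\<^sup>2 + (lap u2 x)\<^sup>2" by simp
        finally show ?thesis using True by simp
      qed (use Zz[of r x] that in auto)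
    qed auto
    ultimately show ?thesis by (simp add: algebra_simps)
  qed
  define F where "F = (\<lambda>x. (x \<bullet> x)\<^sup>2 * (w (x \<bullet> x))\<^sup>2 * (lap u2 x)\<^sup>2)"
  define c1 where "c1 = 256 * (2304 + 72 * n)\<^sup>2"
  have iF: "integrable lborel F"
    by (rule integrable_continuous_bounded_support[where r="4*R"])
       (use wz in \<open>auto simp: F_def intro!: continuous_intros cw cl\<close>)
  have i1: "integrable lborel (\<lambda>x. Z 1 x * (grad2 u1 x + (u x)\<^sup>2))"
    and i2: "integrable lborel (\<lambda>x. Z (4 * R) x * (grad2 u1 x + (u x)\<^sup>2))"
    using R0 by (auto intro!: intZ continuous_intros cG cont)
  have "16 * b * (a\<^sup>2 - 1) * (\<integral>x. (x \<bullet> x) * (w (x \<bullet> x))\<^sup>2 * (u x)\<^sup>2 \<partial>lborel)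
     = 16 * b * (\<integral>x. (a\<^sup>2 - 1) * ((x \<bullet> x) * (w (x \<bullet> x))\<^sup>2 * (u x)\<^sup>2) \<partial>lborel)"
    by simp
  also have "\<dots> \<le> 16 * b * (\<integral>x. (x \<bullet> x) * ((2*a - b * (x \<bullet> x))\<^sup>2 - 1) * (w (x \<bullet> x) * u x)\<^sup>2 \<partial>lborel)"
  proof (intro mult_left_mono integral_mono)
    show "integrable lborel (\<lambda>x. (a\<^sup>2 - 1) * (x \<bullet> x * (w (x \<bullet> x))\<^sup>2 * (u x)\<^sup>2))"
      by (rule integrable_continuous_bounded_support[where r="4*R"])
         (use wz in \<open>auto intro!: continuous_intros cw cont\<close>)
    show "integrable lborel (\<lambda>x. x \<bullet> x * ((2 * a - b * (x \<bullet> x))\<^sup>2 - 1) * (w (x \<bullet> x) * u x)\<^sup>2)"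
      by (rule integrable_continuous_bounded_support[where r="4*R"])
         (use wz in \<open>auto intro!: continuous_intros cw cont\<close>)
    fix x :: "real^'n"
    show "(a\<^sup>2 - 1) * (x \<bullet> x * (w (x \<bullet> x))\<^sup>2 * (u x)\<^sup>2) \<le> x \<bullet> x * ((2 * a - b * (x \<bullet> x))\<^sup>2 - 1) * (w (x \<bullet> x) * u x)\<^sup>2"
    proof (cases "x \<bullet> x < 8 * R\<^sup>2")
      case True
      \<comment> \<open>This is what fixes b: on the support of the cutoff b s <= a, so 2a - b s >=
        a.\<close>
      have "b * (x \<bullet> x) \<le> b * (8 * R\<^sup>2)" using True b by (intro mult_left_mono) auto
      then have "a\<^sup>2 \<le> (2 * a - b * (x \<bullet> x))\<^sup>2" using a b(2) by (intro power_mono) auto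
      then have "(a\<^sup>2 - 1) * (x \<bullet> x * (w (x \<bullet> x))\<^sup>2 * (u x)\<^sup>2) \<le> ((2 * a - b * (x \<bullet> x))\<^sup>2 - 1) * (x \<bullet> x * (w (x \<bullet> x))\<^sup>2 * (u x)\<^sup>2)"
        by (intro mult_right_mono) auto
      then show ?thesis by (simp add: power_mult_distrib mult_ac)
    next
      case False
      then show ?thesis using cutoff_zero[OF R0(1)] by (simp add: w_def)
    qed
  qed (use b in auto)
  also have "\<dots> \<le> (\<integral>x. ((x \<bullet> x) * wt a b (x \<bullet> x) * (cutoff R (x \<bullet> x) * lap u2 x + rem x))\<^sup>2 \<partial>lborel)"
    using carleman_cutoff[OF C DERIV_cutoff[OF R0(1)], where ?t0.0="1/4" and ?t1.0="8 * R\<^sup>2" and b=b and a=a] cutoff_zero[OF R0(1)] b(1)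
    unfolding w_def rem_def n_def by (simp add: add.assoc)
  also have "\<dots> \<le> (\<integral>x. 2 * F x + c1 * ((wt a b (1/4))\<^sup>2 * (Z 1 x * (grad2 u1 x + (u x)\<^sup>2))
        + R ^ 4 * (wt a b (4 * R\<^sup>2))\<^sup>2 * (Z (4 * R) x * (grad2 u1 x + (u x)\<^sup>2))) \<partial>lborel)"
  proof (rule integral_mono')
    show "integrable lborel (\<lambda>x. 2 * F x + c1 * ((wt a b (1/4))\<^sup>2 * (Z 1 x * (grad2 u1 x + (u x)\<^sup>2))
        + R ^ 4 * (wt a b (4 * R\<^sup>2))\<^sup>2 * (Z (4 * R) x * (grad2 u1 x + (u x)\<^sup>2))))"
      by (intro Bochner_Integration.integrable_add integrable_mult_right iF i1 i2)
    fix x :: "real^'n"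
    define P Q where "P = (x \<bullet> x) * wt a b (x \<bullet> x) * (cutoff R (x \<bullet> x) * lap u2 x)"
      and "Q = (x \<bullet> x) * wt a b (x \<bullet> x) * rem x"
    have "((x \<bullet> x) * wt a b (x \<bullet> x) * (cutoff R (x \<bullet> x) * lap u2 x + rem x))\<^sup>2 = (P + Q)\<^sup>2"
      by (simp add: P_def Q_def algebra_simps)
    also have "\<dots> \<le> 2 * P\<^sup>2 + 2 * Q\<^sup>2"
      using sum_squares_bound[of P Q] by (simp add: power2_sum)
    also have "P\<^sup>2 = F x" by (simp add: P_def F_def w_def power_mult_distrib)
    also have "Q\<^sup>2 \<le> 128 * (2304 + 72 * n)\<^sup>2 * ((wt a b (1/4))\<^sup>2 * smoothstep (2 - 2 * (x \<bullet> x))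
       + R ^ 4 * (wt a b (4 * R\<^sup>2))\<^sup>2 * smoothstep (2 - (x \<bullet> x) / (8 * R\<^sup>2))) * (grad2 u1 x + (u x)\<^sup>2)"
      unfolding Q_def rem_def
      by (rule cutoff_remainder) (use R a b radial_le_grad2 grad2_nonneg in \<open>auto simp: n_def\<close>)
    also have "2 * F x + 2 * (128 * (2304 + 72 * n)\<^sup>2 * ((wt a b (1/4))\<^sup>2 * smoothstep (2 - 2 * (x \<bullet> x))
       + R ^ 4 * (wt a b (4 * R\<^sup>2))\<^sup>2 * smoothstep (2 - (x \<bullet> x) / (8 * R\<^sup>2))) * (grad2 u1 x + (u x)\<^sup>2))
      = 2 * F x + c1 * ((wt a b (1/4))\<^sup>2 * (Z 1 x * (grad2 u1 x + (u x)\<^sup>2))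
        + R ^ 4 * (wt a b (4 * R\<^sup>2))\<^sup>2 * (Z (4 * R) x * (grad2 u1 x + (u x)\<^sup>2)))"
    proof -
      have "Z 1 x = smoothstep (2 - 2 * (x \<bullet> x))" by (simp add: Z_def)
      moreover have "2 * (x \<bullet> x) / (4 * R)\<^sup>2 = (x \<bullet> x) / (8 * R\<^sup>2)" by (simp add: power_mult_distrib)
      then have "Z (4 * R) x = smoothstep (2 - (x \<bullet> x) / (8 * R\<^sup>2))" by (simp add: Z_def)
      ultimately show ?thesis unfolding c1_def by (simp add: algebra_simps)
    qed
    finally show "((x \<bullet> x) * wt a b (x \<bullet> x) * (cutoff R (x \<bullet> x) * lap u2 x + rem x))\<^sup>2 \<le>
       2 * F x + c1 * ((wt a b (1/4))\<^sup>2 * (Z 1 x * (grad2 u1 x + (u x)\<^sup>2))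
        + R ^ 4 * (wt a b (4 * R\<^sup>2))\<^sup>2 * (Z (4 * R) x * (grad2 u1 x + (u x)\<^sup>2)))" by simp
    then show "0 \<le> 2 * F x + c1 * ((wt a b (1/4))\<^sup>2 * (Z 1 x * (grad2 u1 x + (u x)\<^sup>2))
        + R ^ 4 * (wt a b (4 * R\<^sup>2))\<^sup>2 * (Z (4 * R) x * (grad2 u1 x + (u x)\<^sup>2)))"
      by (rule order_trans[OF zero_le_power2])
  qed
  also have "\<dots> = 2 * (\<integral>x. F x \<partial>lborel) + c1 * ((wt a b (1/4))\<^sup>2 * J 1 + R ^ 4 * (wt a b (4 * R\<^sup>2))\<^sup>2 * J (4 * R))"
  proof -
    have i3: "integrable lborel (\<lambda>x. k * (Z 1 x * (grad2 u1 x + (u x)\<^sup>2)))"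
      "integrable lborel (\<lambda>x. k * (Z (4 * R) x * (grad2 u1 x + (u x)\<^sup>2)))" for k
      by (intro integrable_mult_right i1 i2)+
    show ?thesis
      unfolding J_def
      by (simp only: Bochner_Integration.integral_add Bochner_Integration.integrable_add integrable_mult_right iF i3 integral_mult_right_zero)
  qed
  also have "\<dots> \<le> 2 * (\<integral>x. F x \<partial>lborel) + c1 * ((wt a b (1/4))\<^sup>2 * ((578 + 18 * n) * I 1) + R ^ 4 * (wt a b (4 * R\<^sup>2))\<^sup>2 * ((578 + 18 * n) * I (4 * R)))"
    using JI[of 1] JI[of "4 * R"] R by (intro add_mono mult_left_mono) (auto simp: c1_def)
  also have "\<dots> = 2 * (\<integral>x. F x \<partial>lborel) + 256 * (2304 + 72 * n)\<^sup>2 * (578 + 18 * n) * ((wt a b (1/4))\<^sup>2 * I 1 + R ^ 4 * (wt a b (4 * R\<^sup>2))\<^sup>2 * I (4 * R))"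
    unfolding c1_def by (simp add: algebra_simps)
  finally show ?thesis unfolding w_def F_def .
qed

section \<open>A smooth mollifier\<close>

text \<open>The functions P(1/t) exp(-1/t), extended by 0, are closed under differentiation, which
  replaces P by (P - P') X^2. One polynomial parameter thus covers all derivatives of
  exp(-1/t).\<close>

definition expinv :: "real poly \<Rightarrow> real \<Rightarrow> real" where
  "expinv P t = (if t > 0 then poly P (1 / t) * exp (- (1 / t)) else 0)"

lemma poly_times_exp_minus_tendsto_0:
  "((\<lambda>x::real. poly P x * exp (- x)) \<longlongrightarrow> 0) at_top"
proof -
  have "((\<lambda>x::real. \<Sum>i\<le>degree P. coeff P i * (x ^ i / exp x)) \<longlongrightarrow> (\<Sum>i\<le>degree P. coeff P i * 0)) at_top"
    by (intro tendsto_sum tendsto_mult tendsto_const tendsto_power_div_exp_0)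
  then show ?thesis
    by (simp add: poly_altdef exp_minus sum_divide_distrib divide_inverse sum_distrib_right mult.assoc)
qed

lemma DERIV_expinv:
  "(expinv P has_real_derivative expinv ((P - pderiv P) * [:0, 0, 1:]) t) (at t)"
proof -
  consider "t < 0" | "t > 0" | "t = 0" by linarith
  then show ?thesis
  proof cases
    case 1
    have "(expinv P has_real_derivative 0) (at t)"
      by (rule has_field_derivative_transform_within_open[where S="{..<0}" and f="\<lambda>_. 0"])
         (use 1 in \<open>auto simp: expinv_def\<close>)
    then show ?thesis using 1 by (simp add: expinv_def)
  next
    case 2
    have "((\<lambda>t. poly P (1 / t) * exp (- (1 / t))) has_real_derivative
        (poly P (1 / t) * (exp (- (1 / t)) * (1 / t\<^sup>2)) + poly (pderiv P) (1 / t) * (- (1 / t\<^sup>2)) * exp (- (1 / t)))) (at t)"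
    proof (rule DERIV_mult')
      show "((\<lambda>t. exp (- (1 / t))) has_real_derivative exp (- (1 / t)) * (1 / t\<^sup>2)) (at t)"
        using 2 by (auto intro!: derivative_eq_intros simp: power2_eq_square)
      have "((\<lambda>t::real. 1 / t) has_real_derivative - (1 / t\<^sup>2)) (at t)"
        using 2 by (auto intro!: derivative_eq_intros simp: power2_eq_square)
      from DERIV_chain'[OF this poly_DERIV]
      show "((\<lambda>t. poly P (1 / t)) has_real_derivative poly (pderiv P) (1 / t) * (- (1 / t\<^sup>2))) (at t)"
        by (simp add: mult.commute)
    qed
    then have "(expinv P has_real_derivative
        (poly P (1 / t) * (exp (- (1 / t)) * (1 / t\<^sup>2)) + poly (pderiv P) (1 / t) * (- (1 / t\<^sup>2)) * exp (- (1 / t)))) (at t)"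
      by (rule has_field_derivative_transform_within_open[where S="{0<..}"])
         (use 2 in \<open>auto simp: expinv_def\<close>)
    then show ?thesis using 2 by (simp add: expinv_def power2_eq_square algebra_simps)
  next
    case 3
    have "((\<lambda>h. expinv P h / h) \<longlongrightarrow> 0) (at 0)"
    proof (rule filterlim_split_at)
      show "((\<lambda>h. expinv P h / h) \<longlongrightarrow> 0) (at_left 0)"
        by (rule tendsto_eventually) (auto simp: eventually_at_filter expinv_def)
      \<comment> \<open>To the right of 0 the difference quotient has the same shape, with the
        polynomial X P evaluated at 1/h.\<close>
      have "((\<lambda>h::real. poly (pCons 0 P) (inverse h) * exp (- inverse h)) \<longlongrightarrow> 0) (at_right 0)"
        using filterlim_compose[OF poly_times_exp_minus_tendsto_0[of "pCons 0 P"] filterlim_inverse_at_top_right] .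
      then show "((\<lambda>h. expinv P h / h) \<longlongrightarrow> 0) (at_right 0)"
        by (rule Lim_transform_eventually)
           (auto simp: eventually_at_filter expinv_def divide_inverse mult_ac)
    qed
    then show ?thesis using 3 by (simp add: DERIV_def expinv_def)
  qed
qed

text \<open>A class that contains the bump exp(-1/(d+t)) exp(-1/(d-t)) and is closed under
  differentiation. It shows that all derivatives exist and vanish for |t| >= d without a formula for
  the k-th one.\<close>

inductive bump_span :: "real \<Rightarrow> (real \<Rightarrow> real) \<Rightarrow> bool" for d where
  base: "bump_span d (\<lambda>t. expinv P (d + t) * expinv Q (d - t))"
| add: "bump_span d f \<Longrightarrow> bump_span d g \<Longrightarrow> bump_span d (\<lambda>t. f t + g t)"

lemma bump_span_deriv:
  assumes "bump_span d f"
  shows "\<exists>f'. bump_span d f' \<and> (\<forall>t. (f has_real_derivative f' t) (at t))"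
  using assms
proof induction
  case (base P Q)
  define dP where "dP = (P - pderiv P) * [:0, 0, 1:]"
  define dQ where "dQ = - ((Q - pderiv Q) * [:0, 0, 1:])"
  have dQ: "expinv dQ t = - expinv ((Q - pderiv Q) * [:0, 0, 1:]) t" for t
    by (simp add: dQ_def expinv_def algebra_simps)
  have 1: "((\<lambda>t. expinv P (d + t)) has_real_derivative expinv dP (d + t)) (at t)" for t
  proof -
    have "((\<lambda>t. d + t) has_real_derivative 1) (at t)" by (auto intro!: derivative_eq_intros)
    from DERIV_chain'[OF this DERIV_expinv] show ?thesis by (simp add: dP_def)
  qed
  have 2: "((\<lambda>t. expinv Q (d - t)) has_real_derivative expinv dQ (d - t)) (at t)" for t
  proof -
    have "((\<lambda>t. d - t) has_real_derivative - 1) (at t)" by (auto intro!: derivative_eq_intros)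
    from DERIV_chain'[OF this DERIV_expinv] show ?thesis by (simp add: dQ)
  qed
  show ?case
    by (rule exI[of _ "\<lambda>t. expinv P (d + t) * expinv dQ (d - t) + expinv dP (d + t) * expinv Q (d - t)"])
       (auto intro!: bump_span.intros DERIV_mult' 1 2)
next
  case (add f g)
  then obtain f' g' where "bump_span d f'" "bump_span d g'"
    "\<And>t. (f has_real_derivative f' t) (at t)" "\<And>t. (g has_real_derivative g' t) (at t)" by blast
  then show ?case
    by (intro exI[of _ "\<lambda>t. f' t + g' t"]) (auto intro!: bump_span.intros DERIV_add)
qed

lemma bump_span_zero: "bump_span d f \<Longrightarrow> \<bar>t\<bar> \<ge> d \<Longrightarrow> f t = 0"
  by (induction rule: bump_span.induct) (auto simp: expinv_def)

definition bump :: "real \<Rightarrow> nat \<Rightarrow> real \<Rightarrow> real" where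
  "bump d k = (deriv ^^ k) (\<lambda>t. expinv 1 (d + t) * expinv 1 (d - t))"

lemma bump_span_bump: "bump_span d (bump d k)"
proof (induction k)
  case 0
  show ?case unfolding bump_def using bump_span.base[of d 1 1] by simp
next
  case (Suc k)
  then obtain f' where f': "bump_span d f'" "\<And>t. (bump d k has_real_derivative f' t) (at t)"
    using bump_span_deriv by blast
  then have "bump d (Suc k) = f'"
    by (auto simp: bump_def fun_eq_iff intro: DERIV_imp_deriv)
  then show ?case using f' by simp
qed

lemma DERIV_bump: "(bump d k has_real_derivative bump d (Suc k) t) (at t)"
proof -
  obtain f' where f': "\<And>t. (bump d k has_real_derivative f' t) (at t)"
    using bump_span_deriv bump_span_bump by blast
  then have "bump d (Suc k) = f'"
    by (auto simp: bump_def fun_eq_iff intro: DERIV_imp_deriv)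
  then show ?thesis using f' by simp
qed

lemma bump_zero: "\<bar>t\<bar> \<ge> d \<Longrightarrow> bump d k t = 0"
  using bump_span_zero[OF bump_span_bump] .

lemma bump_nonneg: "bump d 0 t \<ge> 0"
  by (simp add: bump_def expinv_def)

lemma bump_pos: "d > 0 \<Longrightarrow> bump d 0 0 > 0"
  by (simp add: bump_def expinv_def)

text \<open>A product of one-dimensional bumps, where the multi-index \<open>m\<close> counts the
  derivatives taken in each coordinate, so that a partial derivative merely raises an entry of
  \<open>m\<close>. The mass is not normalised; the division by the integral is made when
  mollifying.\<close>

definition mol :: "real \<Rightarrow> ('n::finite \<Rightarrow> nat) \<Rightarrow> real^'n \<Rightarrow> real" where
  "mol d m z = (\<Prod>i\<in>UNIV. bump d (m i) (z $ i))"

lemma has_partial_mol: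
  fixes c :: "real^'n::finite"
  shows "has_partial i (\<lambda>z. mol d m (z - c)) (\<lambda>z. mol d (m(i := Suc (m i))) (z - c))"
  unfolding has_partial_def
proof
  fix x :: "real^'n"
  let ?P = "\<Prod>j\<in>UNIV - {i}. bump d (m j) (x $ j - c $ j)"
  have 1: "mol d m (x + t *\<^sub>R axis i 1 - c) = bump d (m i) ((x $ i - c $ i) + t) * ?P" for t
    unfolding mol_def
    by (subst prod.remove[of UNIV i]) (auto intro!: prod.cong simp: axis_def algebra_simps)
  have 2: "mol d (m(i := Suc (m i))) (x - c) = bump d (Suc (m i)) (x $ i - c $ i) * ?P"
    unfolding mol_def
    by (subst prod.remove[of UNIV i]) (auto intro!: prod.cong)
  have "((\<lambda>t. bump d (m i) ((x $ i - c $ i) + t)) has_real_derivative bump d (Suc (m i)) (x $ i - c $ i)) (at 0)"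
    using DERIV_bump[of d "m i" "x $ i - c $ i"] DERIV_shift[of "bump d (m i)" _ 0 "x $ i - c $ i"] by (simp add: add.commute)
  from DERIV_cmult_right[OF this, of ?P]
  show "((\<lambda>t. mol d m (x + t *\<^sub>R axis i 1 - c)) has_real_derivative mol d (m(i := Suc (m i))) (x - c)) (at 0)"
    unfolding 1 2 .
qed

lemma differentiable_mol:
  fixes c :: "real^'n::finite"
  shows "(\<lambda>z. mol d m (z - c)) differentiable (at x)"
proof -
  have 1: "(\<lambda>z::real^'n. bump d k (z $ i - c $ i)) differentiable (at x)" for k i
  proof -
    have "(\<lambda>z::real^'n. z $ i - c $ i) differentiable (at x)"
      by (intro differentiable_diff differentiable_const bounded_linear_imp_differentiable bounded_linear_vec_nth)
    moreover have "bump d k differentiable (at y)" for y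
      using DERIV_bump real_differentiable_def by blast
    ultimately have "(bump d k \<circ> (\<lambda>z::real^'n. z $ i - c $ i)) differentiable (at x)"
      by (intro differentiable_chain_at) auto
    then show ?thesis by (simp add: o_def)
  qed
  have "(\<lambda>z::real^'n. \<Prod>i\<in>A. bump d (m i) (z $ i - c $ i)) differentiable (at x)" if "finite A" for A
    using that by induction (auto intro!: differentiable_mult 1)
  then show ?thesis by (simp add: mol_def)
qed

lemma continuous_mol: "continuous_on UNIV (\<lambda>z. mol d m (z - c))"
  by (intro continuous_at_imp_continuous_on ballI differentiable_imp_continuous_within differentiable_mol)

lemma partials_mol: "\<exists>m'. partials is (\<lambda>z. mol d m (z - c)) = (\<lambda>z. mol d m' (z - c))"
  by (induction "is") (auto simp: has_partial_partial_deriv[OF has_partial_mol])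

text \<open>The support is a cube; the crude radius n d comes from bounding the Euclidean norm by
  the sum of the coordinates.\<close>

lemma mol_zero:
  fixes z :: "real^'n::finite"
  assumes "norm z \<ge> real CARD('n) * d"
  shows "mol d m z = 0"
proof -
  have "\<exists>i. \<bar>z $ i\<bar> \<ge> d"
  proof (rule ccontr)
    assume "\<not> ?thesis"
    then have "(\<Sum>i\<in>UNIV. \<bar>z $ i\<bar>) < (\<Sum>i\<in>(UNIV::'n set). d)"
      by (intro sum_strict_mono) (auto simp: not_le)
    then show False using assms norm_le_l1_cart[of z] by simp
  qed
  then obtain i where "bump d (m i) (z $ i) = 0" using bump_zero by blast
  then show ?thesis unfolding mol_def by (metis (no_types) UNIV_I finite prod_zero)
qed

text \<open>Every iterated partial derivative is again some \<open>mol\<close>, hence continuous and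
  differentiable; this makes the translated kernels admissible in the weak equation.\<close>

lemma test_fun_mol: "test_fun (\<lambda>z::real^'n::finite. mol d m (z - c))"
  unfolding test_fun_def smooth_fun_def
proof (intro conjI allI)
  fix "is"
  obtain m' where m': "partials is (\<lambda>z. mol d m (z - c)) = (\<lambda>z. mol d m' (z - c))"
    using partials_mol by blast
  show "continuous_on UNIV (partials is (\<lambda>z. mol d m (z - c)))"
    unfolding m' by (rule continuous_mol)
  show "partials is (\<lambda>z. mol d m (z - c)) differentiable at x" for x
    unfolding m' by (rule differentiable_mol)
next
  have "{x. mol d m (x - c) \<noteq> 0} \<subseteq> cball c (real CARD('n) * d)"
    using mol_zero[of d _ m] by (force simp: dist_norm norm_minus_commute)
  then show "compact (closure {x. mol d m (x - c) \<noteq> 0})"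
    using bounded_subset[OF bounded_cball] by (simp add: compact_closure)
qed

lemma laplacian_mol:
  "laplacian (\<lambda>z. mol d m (z - c)) x = (\<Sum>i\<in>UNIV. mol d (m(i := Suc (Suc (m i)))) (x - c))"
  unfolding laplacian_def by (simp add: has_partial_partial_deriv[OF has_partial_mol])

section \<open>Sign and mass of the mollifier\<close>

lemma mol_nonneg: "mol d (\<lambda>_. 0) z \<ge> 0"
  unfolding mol_def by (intro prod_nonneg) (simp add: bump_nonneg)

lemma integrable_mol: "integrable lborel (mol d m :: real^'n::finite \<Rightarrow> real)"
  using continuous_mol[of d m 0] mol_zero[where 'n='n]
  by (intro integrable_continuous_bounded_support[where r="real CARD('n) * d"]) auto

lemma integral_mol_pos:
  assumes "d > 0"
  shows "(\<integral>z. mol d (\<lambda>_. 0) (z::real^'n::finite) \<partial>lborel) > 0"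
proof -
  let ?f = "mol d (\<lambda>_. 0) :: real^'n \<Rightarrow> real"
  have f0: "?f 0 > 0" unfolding mol_def using bump_pos[OF assms] by (simp add: prod_pos)
  have "continuous_on UNIV ?f" using continuous_mol[of d "\<lambda>_. 0" 0] by simp
  then have "open {z. ?f z > ?f 0 / 2}"
    using open_Collect_less[of "\<lambda>_. ?f 0 / 2" ?f] by simp
  then obtain r where r: "r > 0" "ball 0 r \<subseteq> {z. ?f z > ?f 0 / 2}"
    using f0 open_contains_ball_eq[of "{z. ?f z > ?f 0 / 2}" 0] by auto
  have "0 < ?f 0 / 2 * measure lborel (ball (0::real^'n) r)"
    using f0 r content_ball_pos[of r "0::real^'n"] by simp
  also have "\<dots> = (\<integral>z. ?f 0 / 2 * indicator (ball 0 r) (z::real^'n) \<partial>lborel)"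
    by simp
  also have "\<dots> \<le> (\<integral>z. ?f z \<partial>lborel)"
  proof (rule integral_mono'[OF integrable_mol])
    show "?f 0 / 2 * indicator (ball 0 r) z \<le> ?f z" for z
      using r(2) mol_nonneg[of d z] by (auto simp: indicator_def intro: less_imp_le)
  qed (rule mol_nonneg)
  finally show ?thesis .
qed

section \<open>Mollifying a weak solution\<close>

text \<open>A correlation, not a convolution: as a function of y the kernel is a translate of
  \<open>k\<close>, hence directly a test function. Each derivative in x costs a sign, and the two
  signs in the Laplacian cancel.\<close>

definition corr :: "(real^'n::finite \<Rightarrow> real) \<Rightarrow> (real^'n \<Rightarrow> real) \<Rightarrow> real^'n \<Rightarrow> real" where
  "corr U k x = (\<integral>y. U y * k (y - x) \<partial>lborel)"

lemma integrable_mult_bounded_continuous: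
  fixes U k :: "'a::euclidean_space \<Rightarrow> real"
  assumes U: "integrable lborel U" and k: "continuous_on UNIV k" and b: "\<And>x. \<bar>k x\<bar> \<le> B"
  shows "integrable lborel (\<lambda>y. U y * k y)"
proof (rule Bochner_Integration.integrable_bound)
  show "integrable lborel (\<lambda>y. B * U y)" using U by simp
  show "(\<lambda>y. U y * k y) \<in> borel_measurable lborel"
    using U borel_measurable_continuous_onI[OF k] by auto
  have "B \<ge> 0" using b[of 0] by linarith
  then show "AE y in lborel. norm (U y * k y) \<le> norm (B * U y)"
    using b by (auto simp: abs_mult mult.commute[of B] intro!: mult_left_mono)
qed

lemma mol_bounded: "\<exists>B\<ge>0. \<forall>z::real^'n::finite. \<bar>mol d m z\<bar> \<le> B"
proof -
  obtain B where "B \<ge> 0" "\<And>x::real^'n. \<bar>mol d m x\<bar> \<le> B"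
    by (rule bounded_continuous_bounded_support[where f="mol d m" and r="real CARD('n) * d"])
       (use continuous_mol[of d m 0] mol_zero[where 'n='n] in auto)
  then show ?thesis by blast
qed

lemma integrable_corr:
  fixes U :: "real^'n::finite \<Rightarrow> real"
  assumes U: "integrable lborel U"
  shows "integrable lborel (\<lambda>y. U y * mol d m (y - x))"
proof -
  obtain B where B: "\<And>z::real^'n. \<bar>mol d m z\<bar> \<le> B" using mol_bounded by blast
  show ?thesis by (rule integrable_mult_bounded_continuous[OF U continuous_mol B])
qed

lemma continuous_corr:
  fixes U :: "real^'n::finite \<Rightarrow> real"
  assumes U: "integrable lborel U"
  shows "continuous_on UNIV (corr U (mol d m))"
proof -
  obtain B where B: "B \<ge> 0" "\<And>z::real^'n. \<bar>mol d m z\<bar> \<le> B" using mol_bounded by blast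
  have "isCont (corr U (mol d m)) a" for a
    unfolding corr_def[abs_def] continuous_at_sequentially comp_def
  proof (intro allI impI integral_dominated_convergence[where w="\<lambda>y. B * \<bar>U y\<bar>"])
    fix X :: "nat \<Rightarrow> real^'n" assume X: "X \<longlonglongrightarrow> a"
    show "AE y in lborel. (\<lambda>n. U y * mol d m (y - X n)) \<longlonglongrightarrow> U y * mol d m (y - a)"
    proof (rule AE_I2)
      fix y
      have "isCont (\<lambda>z. mol d m (z - 0)) (y - a)"
        using continuous_mol continuous_on_eq_continuous_at open_UNIV by blast
      moreover have "(\<lambda>n. y - X n) \<longlonglongrightarrow> y - a" by (intro tendsto_intros X)
      ultimately have "(\<lambda>n. mol d m (y - X n)) \<longlonglongrightarrow> mol d m (y - a)"
        using isCont_tendsto_compose[of "y - a" "mol d m"] by simp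
      then show "(\<lambda>n. U y * mol d m (y - X n)) \<longlonglongrightarrow> U y * mol d m (y - a)" by (intro tendsto_intros)
    qed
    show "(\<lambda>y. U y * mol d m (y - X n)) \<in> borel_measurable lborel" for n
      using integrable_corr[OF U] by auto
    show "AE y in lborel. norm (U y * mol d m (y - X n)) \<le> B * \<bar>U y\<bar>" for n
      using B by (auto simp: abs_mult mult.commute[of B] intro!: mult_left_mono)
  qed (use U integrable_corr[OF U] in auto)
  then show ?thesis by (simp add: continuous_at_imp_continuous_on)
qed

lemma has_partial_corr:
  fixes U :: "real^'n::finite \<Rightarrow> real"
  assumes U: "integrable lborel U"
  shows "has_partial i (corr U (mol d m)) (\<lambda>x. - corr U (mol d (m(i := Suc (m i)))) x)"
  unfolding has_partial_def
proof
  fix x :: "real^'n"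
  let ?m = "m(i := Suc (m i))" and ?e = "axis i 1 :: real^'n"
  obtain B where B: "B \<ge> 0" "\<And>z::real^'n. \<bar>mol d ?m z\<bar> \<le> B" using mol_bounded by blast
  have "((\<lambda>t. \<integral>y. U y * mol d m (y - (x + t *\<^sub>R ?e)) \<partial>lborel) has_real_derivative
      (\<integral>y. - (U y * mol d ?m (y - (x + 0 *\<^sub>R ?e))) \<partial>lborel)) (at 0)"
  proof (rule deriv_under_integral[where g="\<lambda>y. B * \<bar>U y\<bar>"])
    show "((\<lambda>t. U y * mol d m (y - (x + t *\<^sub>R ?e))) has_real_derivative - (U y * mol d ?m (y - (x + t *\<^sub>R ?e)))) (at t)" for t y
    proof -
      have "((\<lambda>r. mol d m ((y - x) + r *\<^sub>R ?e - 0)) has_real_derivative mol d ?m ((y - x) + (-t) *\<^sub>R ?e - 0)) (at (-t))"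
        by (rule has_partial_at[OF has_partial_mol])
      then have "((\<lambda>r. mol d m ((y - x) + (- r) *\<^sub>R ?e - 0)) has_real_derivative - mol d ?m ((y - x) + (-t) *\<^sub>R ?e - 0)) (at t)"
        by (subst (asm) DERIV_mirror)
      from DERIV_cmult[OF this, of "U y"] show ?thesis by (simp add: algebra_simps)
    qed
    show "\<bar>- (U y * mol d ?m (y - (x + t *\<^sub>R ?e)))\<bar> \<le> B * \<bar>U y\<bar>" for t y
      using B by (auto simp: abs_mult mult.commute[of B] intro!: mult_left_mono)
    show "(\<lambda>y. - (U y * mol d ?m (y - (x + 0 *\<^sub>R ?e)))) \<in> borel_measurable lborel"
      using integrable_corr[OF U, of d ?m] by auto
  qed (use U integrable_corr[OF U] in auto)
  then show "((\<lambda>t. corr U (mol d m) (x + t *\<^sub>R ?e)) has_real_derivative - corr U (mol d ?m) x) (at 0)"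
    by (simp add: corr_def)
qed

lemma has_partial_uminus: "has_partial i f f' \<Longrightarrow> has_partial i (\<lambda>x. - f x) (\<lambda>x. - f' x)"
  by (auto simp: has_partial_def intro!: DERIV_minus)

text \<open>The mixed derivatives agree because raising two entries of the multi-index can be done
  in either order.\<close>

lemma C2data_corr:
  fixes U :: "real^'n::finite \<Rightarrow> real"
  assumes U: "integrable lborel U"
  shows "C2data (corr U (mol d m)) (\<lambda>i x. - corr U (mol d (m(i := Suc (m i)))) x)
     (\<lambda>i j. corr U (mol d ((m(i := Suc (m i)))(j := Suc ((m(i := Suc (m i))) j)))))"
  unfolding C2data_def
proof (intro conjI allI)
  fix i j :: 'n
  let ?m = "m(i := Suc (m i))"
  show "has_partial i (corr U (mol d m)) (\<lambda>x. - corr U (mol d ?m) x)" by (rule has_partial_corr[OF U])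
  show "has_partial j (\<lambda>x. - corr U (mol d ?m) x) (corr U (mol d (?m(j := Suc (?m j)))))"
    using has_partial_uminus[OF has_partial_corr[OF U, of j d ?m]] by (simp only: minus_minus)
  have "?m(j := Suc (?m j)) = (m(j := Suc (m j)))(i := Suc ((m(j := Suc (m j))) i))"
    by (auto simp: fun_eq_iff)
  then show "corr U (mol d (?m(j := Suc (?m j)))) x = corr U (mol d ((m(j := Suc (m j)))(i := Suc ((m(j := Suc (m j))) i)))) x" for x
    by simp
qed (auto intro!: continuous_intros continuous_corr U)

text \<open>The Laplacian in x turns into the Laplacian in y of the kernel, which is the form in
  which the weak equation can be applied.\<close>

lemma lap_corr:
  fixes U :: "real^'n::finite \<Rightarrow> real"
  assumes U: "integrable lborel U"
  shows "lap (\<lambda>i j. corr U (mol d ((m(i := Suc (m i)))(j := Suc ((m(i := Suc (m i))) j))))) x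
    = (\<integral>y. U y * laplacian (\<lambda>z. mol d m (z - x)) y \<partial>lborel)"
  unfolding lap_def corr_def laplacian_mol sum_distrib_left using integrable_corr[OF U]
  by (subst Bochner_Integration.integral_sum) (auto simp: fun_upd_upd)

text \<open>Only the values of the solution near the point enter, which is why the truncated
  functions still satisfy the mollified equation inside the ball.\<close>

lemma lap_corr_solution:
  fixes u V :: "real^'n::finite \<Rightarrow> real"
  assumes sol: "solves_schrodinger V u"
    and U: "integrable lborel U"
    and Uu: "\<And>y. norm y \<le> Q \<Longrightarrow> U y = u (x0 + y)" and Fu: "\<And>y. norm y \<le> Q \<Longrightarrow> F y = V (x0 + y) * u (x0 + y)"
    and x: "norm x + real CARD('n) * d \<le> Q"
    and um: "u \<in> borel_measurable borel" "V \<in> borel_measurable borel"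
  shows "(\<integral>y. U y * laplacian (\<lambda>z. mol d m (z - x)) y \<partial>lborel) = corr F (mol d m) x"
proof -
  \<comment> \<open>Either the truncated functions agree with the original ones at y, or y is out of
    reach of the kernel. All multi-indices are included because the Laplacian of the kernel is a sum
    of kernels with raised ones.\<close>
  have eq: "norm y \<le> Q \<or> (\<forall>m. mol d m (y - x) = 0)" for y
  proof (cases "norm y \<le> Q")
    case False
    have "norm y \<le> norm x + norm (y - x)" using norm_triangle_ineq[of x "y - x"] by simp
    then show ?thesis using False x mol_zero[of d "y - x"] by auto
  qed simp
  let ?c = "x0 + x"
  have ml: "laplacian (\<lambda>z. mol d m (z - ?c)) \<in> borel_measurable borel"
    unfolding laplacian_mol[abs_def]
    by (intro borel_measurable_continuous_onI continuous_on_sum continuous_mol)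
  have mm: "(\<lambda>z. mol d m (z - ?c)) \<in> borel_measurable borel"
    by (intro borel_measurable_continuous_onI continuous_mol)
  have "(\<integral>y. U y * laplacian (\<lambda>z. mol d m (z - x)) y \<partial>lborel) =
     (\<integral>y. u (y + x0) * laplacian (\<lambda>z. mol d m (z - ?c)) (y + x0) \<partial>lborel)"
  proof (rule Bochner_Integration.integral_cong[OF refl])
    fix y
    show "U y * laplacian (\<lambda>z. mol d m (z - x)) y = u (y + x0) * laplacian (\<lambda>z. mol d m (z - ?c)) (y + x0)"
      using eq[of y] Uu[of y] by (auto simp: laplacian_mol add.commute[of y x0])
  qed
  also have "\<dots> = (\<integral>z. u z * laplacian (\<lambda>z. mol d m (z - ?c)) z \<partial>lborel)"
    by (rule lborel_integral_translate) (use um ml in auto)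
  also have "\<dots> = (\<integral>z. V z * u z * mol d m (z - ?c) \<partial>lborel)"
    using sol test_fun_mol[of d m ?c] unfolding solves_schrodinger_def by blast
  also have "\<dots> = (\<integral>y. V (y + x0) * u (y + x0) * mol d m (y + x0 - ?c) \<partial>lborel)"
    by (rule lborel_integral_translate[symmetric]) (use um mm in auto)
  also have "\<dots> = corr F (mol d m) x"
    unfolding corr_def
  proof (rule Bochner_Integration.integral_cong[OF refl])
    fix y
    show "V (y + x0) * u (y + x0) * mol d m (y + x0 - ?c) = F y * mol d m (y - x)"
      using eq[of y] Fu[of y] by (auto simp: add.commute[of y x0])
  qed
  finally show ?thesis .
qed

section \<open>Convergence in mean of mollifications\<close>

lemma integrable_bounded_support:
  fixes U :: "'a::euclidean_space \<Rightarrow> real"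
  assumes "U \<in> borel_measurable borel" "\<And>x. \<bar>U x\<bar> \<le> M" "\<And>x. norm x > Q \<Longrightarrow> U x = 0"
  shows "integrable lborel U"
proof (rule Bochner_Integration.integrable_bound)
  show "integrable lborel (\<lambda>x. M * indicator (cball 0 Q) (x::'a))"
    by (auto intro!: integrable_real_indicator emeasure_lborel_cball_finite)
  show "AE x in lborel. norm (U x) \<le> norm (M * indicator (cball 0 Q) x)"
  proof (rule AE_I2)
    fix x
    show "norm (U x) \<le> norm (M * indicator (cball 0 Q) x)"
      using assms(2)[of x] assms(3)[of x] by (cases "norm x > Q") auto
  qed
qed (use assms in auto)

text \<open>Measurability gives continuous functions converging almost everywhere. Clipping their
  values at M and multiplying by a tent function of |x| does not change the limit and supplies a
  dominating function.\<close>

lemma continuous_L1_approx: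
  fixes U :: "'a::euclidean_space \<Rightarrow> real"
  assumes m: "U \<in> borel_measurable borel" and b: "\<And>x. \<bar>U x\<bar> \<le> M" and z: "\<And>x. norm x > Q \<Longrightarrow> U x = 0"
    and e: "e > 0"
  obtains g where "continuous_on UNIV g" "\<And>x. norm x > Q + 1 \<Longrightarrow> g x = 0" "(\<integral>x. \<bar>g x - U x\<bar> \<partial>lborel) < e"
proof -
  have M: "M \<ge> 0" using b[of 0] by linarith
  have "U \<in> borel_measurable lebesgue" using m by (simp add: measurable_completion)
  then have "U measurable_on UNIV"
    by (intro lebesgue_measurable_imp_measurable_on) auto
  then obtain N h where N: "negligible N" and h: "\<And>n. continuous_on UNIV (h n)"
    and lim: "\<And>x. x \<notin> N \<Longrightarrow> (\<lambda>n. h n x) \<longlonglongrightarrow> U x"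
    unfolding measurable_on_def by auto
  define g where "g = (\<lambda>n::nat. \<lambda>x. max (- M) (min M (h n x)) * max 0 (min 1 (Q + 1 - norm x)))"
  have cg: "continuous_on UNIV (g n)" for n
    unfolding g_def by (intro continuous_intros h)
  have gz: "g n x = 0" if "norm x > Q + 1" for n x
    using that by (simp add: g_def)
  have gb: "\<bar>g n x\<bar> \<le> M" for n x
  proof -
    have "\<bar>g n x\<bar> \<le> M * 1"
      unfolding g_def abs_mult using M by (intro mult_mono) auto
    then show ?thesis by simp
  qed
  have "(\<lambda>n. \<integral>x. \<bar>g n x - U x\<bar> \<partial>lborel) \<longlonglongrightarrow> (\<integral>x. 0 \<partial>(lborel :: 'a measure))"
  proof (rule integral_dominated_convergence[where w="\<lambda>x. 2 * M * indicator (cball 0 (Q + 1)) x"])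
    show "AE x in lborel. (\<lambda>n. \<bar>g n x - U x\<bar>) \<longlonglongrightarrow> 0"
    proof -
      have "AE x in lebesgue. x \<notin> N"
        using N by (simp add: negligible_iff_null_sets AE_not_in)
      then have "AE x in lborel. x \<notin> N"
        by (simp add: AE_completion_iff)
      then show ?thesis
      proof (eventually_elim)
        fix x assume "x \<notin> N"
        then have "(\<lambda>n. max (- M) (min M (h n x)) * max 0 (min 1 (Q + 1 - norm x))) \<longlonglongrightarrow>
            max (- M) (min M (U x)) * max 0 (min 1 (Q + 1 - norm x))"
          by (intro tendsto_intros lim)
        also have "max (- M) (min M (U x)) = U x" using b[of x] by (auto simp: abs_le_iff max_def min_def)
        also have "U x * max 0 (min 1 (Q + 1 - norm x)) = U x" using z[of x] by (cases "norm x > Q") auto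
        finally have "(\<lambda>n. g n x) \<longlonglongrightarrow> U x" unfolding g_def .
        then have "(\<lambda>n. \<bar>g n x - U x\<bar>) \<longlonglongrightarrow> \<bar>U x - U x\<bar>" by (intro tendsto_intros)
        then show "(\<lambda>n. \<bar>g n x - U x\<bar>) \<longlonglongrightarrow> 0" by simp
      qed
    qed
    show "AE x in lborel. norm \<bar>g n x - U x\<bar> \<le> 2 * M * indicator (cball 0 (Q + 1)) x" for n
    proof (rule AE_I2)
      fix x
      show "norm \<bar>g n x - U x\<bar> \<le> 2 * M * indicator (cball 0 (Q + 1)) x"
      proof (cases "norm x \<le> Q + 1")
        case True
        then show ?thesis using gb[of n x] b[of x] by (auto simp: abs_le_iff)
      next
        case False
        then show ?thesis using gz[of x n] z[of x] by simp
      qed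
    qed
    show "integrable lborel (\<lambda>x. 2 * M * indicator (cball 0 (Q + 1)) (x::'a))"
      by (auto intro!: integrable_real_indicator emeasure_lborel_cball_finite)
    show "(\<lambda>x. \<bar>g n x - U x\<bar>) \<in> borel_measurable lborel" for n
      using borel_measurable_continuous_onI[OF cg[of n]] m by auto
  qed auto
  then have "eventually (\<lambda>n. (\<integral>x. \<bar>g n x - U x\<bar> \<partial>lborel) < e) sequentially"
    using e by (intro order_tendstoD) auto
  then obtain n where "(\<integral>x. \<bar>g n x - U x\<bar> \<partial>lborel) < e"
    by (auto simp: eventually_sequentially)
  then show ?thesis using that[of "g n"] cg gz by blast
qed

text \<open>A three-term estimate: a continuous approximation \<open>g\<close> changes uniformly
  little under a small shift, and the two errors g - U have the same integral by translation
  invariance.\<close>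

lemma translation_L1_continuous:
  fixes U :: "'a::euclidean_space \<Rightarrow> real"
  assumes m: "U \<in> borel_measurable borel" and b: "\<And>x. \<bar>U x\<bar> \<le> M" and z: "\<And>x. norm x > Q \<Longrightarrow> U x = 0"
    and e: "e > 0"
  shows "\<exists>\<delta>>0. \<forall>h. norm h \<le> \<delta> \<longrightarrow> (\<integral>x. \<bar>U (x + h) - U x\<bar> \<partial>lborel) \<le> e"
proof -
  obtain g where g: "continuous_on UNIV g" "\<And>x. norm x > Q + 1 \<Longrightarrow> g x = 0"
    and gU: "(\<integral>x. \<bar>g x - U x\<bar> \<partial>lborel) < e / 3"
  proof -
    have "e / 3 > 0" using e by simp
    from continuous_L1_approx[OF m b z this] show ?thesis using that by blast
  qed
  have iU: "integrable lborel U" by (rule integrable_bounded_support[OF m b z])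
  have ig: "integrable lborel g" by (rule integrable_continuous_bounded_support[OF g])
  define v where "v = measure lborel (cball (0::'a) (Q + 2))"
  \<comment> \<open>\<open>g\<close> lives in radius Q + 1 and the shift has length at most 1, so
    the difference lives in radius Q + 2, a ball of volume \<open>v\<close>; v + 1 avoids a division
    by zero.\<close>
  define e' where "e' = e / (3 * (v + 1))"
  have v: "v \<ge> 0" by (simp add: v_def)
  then have e': "e' > 0" "e' * v \<le> e / 3"
    using e by (auto simp: e'_def field_simps)
  have "uniformly_continuous_on (cball 0 (Q + 3)) g"
    by (rule compact_uniformly_continuous) (auto intro: continuous_on_subset[OF g(1)])
  then obtain d where d: "d > 0" "\<And>x y. x \<in> cball 0 (Q + 3) \<Longrightarrow> y \<in> cball 0 (Q + 3) \<Longrightarrow> dist y x < d \<Longrightarrow> dist (g y) (g x) < e'"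
    using e'(1) unfolding uniformly_continuous_on_def by metis
  define \<delta> where "\<delta> = min (d / 2) 1"
  have "\<delta> > 0" using d by (simp add: \<delta>_def)
  moreover have "(\<integral>x. \<bar>U (x + h) - U x\<bar> \<partial>lborel) \<le> e" if h: "norm h \<le> \<delta>" for h
  proof -
    have igh: "integrable lborel (\<lambda>x. g (x + h))" and iUh: "integrable lborel (\<lambda>x. U (x + h))"
      using lborel_integrable_translate ig iU by blast+
    have i1: "integrable lborel (\<lambda>x. \<bar>g (x + h) - U (x + h)\<bar>)"
      and i2: "integrable lborel (\<lambda>x. \<bar>g (x + h) - g x\<bar>)" and i3: "integrable lborel (\<lambda>x. \<bar>g x - U x\<bar>)"
      using igh iUh ig iU by auto
    have gh: "\<bar>g (x + h) - g x\<bar> \<le> e' * indicator (cball 0 (Q + 2)) x" for x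
    proof (cases "norm x \<le> Q + 2")
      case True
      have "norm (x + h) \<le> Q + 3" using True h norm_triangle_ineq[of x h] by (simp add: \<delta>_def)
      moreover have "dist (x + h) x < d" using h d(1) by (simp add: dist_norm \<delta>_def)
      ultimately have "dist (g (x + h)) (g x) < e'" using True by (intro d(2)) auto
      then show ?thesis using True by (simp add: dist_real_def)
    next
      case False
      have "norm x \<le> norm (x + h) + norm h" using norm_triangle_ineq4[of "x + h" h] by simp
      then have "norm (x + h) > Q + 1" using False h by (simp add: \<delta>_def)
      then show ?thesis using False g(2) by simp
    qed
    have "(\<integral>x. \<bar>g (x + h) - g x\<bar> \<partial>lborel) \<le> (\<integral>x. e' * indicator (cball 0 (Q + 2)) (x::'a) \<partial>lborel)"
      by (intro integral_mono i2 gh) (auto intro!: integrable_real_indicator emeasure_lborel_cball_finite)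
    also have "\<dots> = e' * v" by (simp add: v_def)
    finally have 2: "(\<integral>x. \<bar>g (x + h) - g x\<bar> \<partial>lborel) \<le> e / 3" using e'(2) by simp
    have 1: "(\<integral>x. \<bar>g (x + h) - U (x + h)\<bar> \<partial>lborel) = (\<integral>x. \<bar>g x - U x\<bar> \<partial>lborel)"
      using lborel_integral_translate[of "\<lambda>x. \<bar>g x - U x\<bar>" h] i3 by simp
    have "(\<integral>x. \<bar>U (x + h) - U x\<bar> \<partial>lborel) \<le> (\<integral>x. \<bar>g (x + h) - U (x + h)\<bar> + (\<bar>g (x + h) - g x\<bar> + \<bar>g x - U x\<bar>) \<partial>lborel)"
      using i1 i2 i3 iU iUh by (intro integral_mono) auto
    also have "\<dots> = (\<integral>x. \<bar>g (x + h) - U (x + h)\<bar> \<partial>lborel) + ((\<integral>x. \<bar>g (x + h) - g x\<bar> \<partial>lborel) + (\<integral>x. \<bar>g x - U x\<bar> \<partial>lborel))"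
      using i1 i2 i3 by simp
    finally show ?thesis using 1 2 gU by simp
  qed
  ultimately show ?thesis by blast
qed

text \<open>The error is the average of U(x + z) - U(x) against a probability density supported in
  |z| <= \<delta>. Exchanging the integrals leaves, for each such z, a translation error of at most
  e; with nonnegative integrals the exchange asks only for measurability. Averaging also preserves
  the bound M, which is needed later for the squares.\<close>

lemma mollification_L1:
  fixes U :: "real^'n::finite \<Rightarrow> real"
  assumes m: "U \<in> borel_measurable borel" and b: "\<And>x. \<bar>U x\<bar> \<le> M" and z: "\<And>x. norm x > Q \<Longrightarrow> U x = 0"
    and e: "e > 0"
  shows "\<exists>d0>0. \<forall>d. 0 < d \<and> d \<le> d0 \<longrightarrow>
     (\<integral>x. \<bar>corr U (mol d (\<lambda>_. 0)) x / (\<integral>z. mol d (\<lambda>_. 0) (z::real^'n) \<partial>lborel) - U x\<bar> \<partial>lborel) \<le> e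
     \<and> (\<forall>x. \<bar>corr U (mol d (\<lambda>_. 0)) x / (\<integral>z. mol d (\<lambda>_. 0) (z::real^'n) \<partial>lborel)\<bar> \<le> M)"
proof -
  obtain \<delta> where \<delta>: "\<delta> > 0" "\<And>h. norm h \<le> \<delta> \<Longrightarrow> (\<integral>x. \<bar>U (x + h) - U x\<bar> \<partial>lborel) \<le> e"
    using translation_L1_continuous[OF m b z e] by blast
  have iU: "integrable lborel U" by (rule integrable_bounded_support[OF m b z])
  define d0 where "d0 = \<delta> / real CARD('n)"
  have "d0 > 0" using \<delta> by (simp add: d0_def)
  moreover have "(\<integral>x. \<bar>corr U (mol d (\<lambda>_. 0)) x / (\<integral>z. mol d (\<lambda>_. 0) (z::real^'n) \<partial>lborel) - U x\<bar> \<partial>lborel) \<le> e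
     \<and> (\<forall>x. \<bar>corr U (mol d (\<lambda>_. 0)) x / (\<integral>z. mol d (\<lambda>_. 0) (z::real^'n) \<partial>lborel)\<bar> \<le> M)"
    if d: "0 < d" "d \<le> d0" for d
  proof -
    define k where "k = (\<lambda>z::real^'n. mol d (\<lambda>_. 0) z / (\<integral>z. mol d (\<lambda>_. 0) (z::real^'n) \<partial>lborel))"
    have pos: "(\<integral>z. mol d (\<lambda>_. 0) (z::real^'n) \<partial>lborel) > 0" using integral_mol_pos[OF d(1)] .
    have k0: "k z \<ge> 0" for z using pos mol_nonneg[of d z] by (simp add: k_def)
    have ik: "integrable lborel k" unfolding k_def using integrable_mol by auto
    have k1: "(\<integral>z. k z \<partial>lborel) = 1" unfolding k_def using pos by simp
    have kz: "k z = 0" if "norm z > \<delta>" for z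
    proof -
      have "real CARD('n) * d \<le> \<delta>" using d by (simp add: d0_def field_simps)
      then show ?thesis using that mol_zero[of d z] by (simp add: k_def)
    qed
    have mk: "k \<in> borel_measurable borel" using ik by auto
    define v where "v = (\<lambda>x. corr U (mol d (\<lambda>_. 0)) x / (\<integral>z. mol d (\<lambda>_. 0) (z::real^'n) \<partial>lborel))"
    have iUk: "integrable lborel (\<lambda>z. U (x + z) * k z)" for x
    proof (rule Bochner_Integration.integrable_bound[of _ "\<lambda>z. M * k z"])
      show "(\<lambda>z. U (x + z) * k z) \<in> borel_measurable lborel" using m mk by auto
      show "AE z in lborel. norm (U (x + z) * k z) \<le> norm (M * k z)"
        using b k0 order_trans[OF abs_ge_zero b] by (auto simp: abs_mult intro!: mult_right_mono)
    qed (use ik in auto)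
    have v0: "v x = (\<integral>z. U (x + z) * k z \<partial>lborel)" for x
    proof -
      have "v x = (\<integral>y. U y * k (y - x) \<partial>lborel)"
        by (simp add: v_def corr_def k_def)
      also have "\<dots> = (\<integral>z. U (z + x) * k (z + x - x) \<partial>lborel)"
        by (rule lborel_integral_translate[symmetric]) (use m mk in auto)
      also have "\<dots> = (\<integral>z. U (x + z) * k z \<partial>lborel)" by (simp add: add.commute)
      finally show ?thesis .
    qed
    have vM: "\<bar>v x\<bar> \<le> M" for x
    proof -
      have "\<bar>v x\<bar> \<le> (\<integral>z. \<bar>U (x + z) * k z\<bar> \<partial>lborel)"
        unfolding v0 using integral_norm_bound[of lborel "\<lambda>z. U (x + z) * k z"] by simp
      also have "\<dots> \<le> (\<integral>z. M * k z \<partial>lborel)"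
      proof (rule integral_mono)
        show "integrable lborel (\<lambda>z. \<bar>U (x + z) * k z\<bar>)" using iUk[of x] by (rule integrable_abs)
        show "\<bar>U (x + z) * k z\<bar> \<le> M * k z" for z
          using b k0 by (simp add: abs_mult mult_right_mono)
      qed (use ik in auto)
      also have "\<dots> = M" using k1 by simp
      finally show ?thesis .
    qed
    have v: "v x - U x = (\<integral>z. (U (x + z) - U x) * k z \<partial>lborel)" for x
    proof -
      have "v x - U x * 1 = (\<integral>z. U (x + z) * k z \<partial>lborel) - U x * (\<integral>z. k z \<partial>lborel)"
        using k1 v0[of x] by simp
      also have "\<dots> = (\<integral>z. U (x + z) * k z - U x * k z \<partial>lborel)"
        using iUk ik by simp
      finally show ?thesis by (simp add: algebra_simps)
    qed
    have vb: "ennreal \<bar>v x - U x\<bar> \<le> (\<integral>\<^sup>+z. ennreal (\<bar>U (x + z) - U x\<bar> * k z) \<partial>lborel)" for x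
    proof -
      have i: "integrable lborel (\<lambda>z. (U (x + z) - U x) * k z)"
        using iUk[of x] ik by (simp add: left_diff_distrib)
      have "\<bar>v x - U x\<bar> \<le> (\<integral>z. \<bar>(U (x + z) - U x) * k z\<bar> \<partial>lborel)"
        unfolding v using integral_norm_bound[of lborel "\<lambda>z. (U (x + z) - U x) * k z"] by simp
      then have "ennreal \<bar>v x - U x\<bar> \<le> ennreal (\<integral>z. \<bar>(U (x + z) - U x) * k z\<bar> \<partial>lborel)"
        by (rule ennreal_leI)
      also have "\<dots> = (\<integral>\<^sup>+z. ennreal \<bar>(U (x + z) - U x) * k z\<bar> \<partial>lborel)"
        using i by (intro nn_integral_eq_integral[symmetric]) auto
      finally show ?thesis using k0 by (simp add: abs_mult)
    qed
    have mp: "(\<lambda>(x, z). ennreal (\<bar>U (x + z) - U x\<bar> * k z)) \<in> borel_measurable (lborel \<Otimes>\<^sub>M lborel)"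
      using m mk by measurable
    have "(\<integral>\<^sup>+x. ennreal \<bar>v x - U x\<bar> \<partial>lborel) \<le> (\<integral>\<^sup>+x. (\<integral>\<^sup>+z. ennreal (\<bar>U (x + z) - U x\<bar> * k z) \<partial>lborel) \<partial>lborel)"
      by (intro nn_integral_mono vb)
    also have "\<dots> = (\<integral>\<^sup>+z. (\<integral>\<^sup>+x. ennreal (\<bar>U (x + z) - U x\<bar> * k z) \<partial>lborel) \<partial>lborel)"
      by (rule lborel_pair.Fubini'[OF mp, symmetric])
    also have "\<dots> \<le> (\<integral>\<^sup>+z. ennreal (e * k z) \<partial>lborel)"
    proof (rule nn_integral_mono)
      fix z :: "real^'n"
      have i: "integrable lborel (\<lambda>x. \<bar>U (x + z) - U x\<bar> * k z)"
        using lborel_integrable_translate[OF iU, of z] iU by auto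
      have "(\<integral>\<^sup>+x. ennreal (\<bar>U (x + z) - U x\<bar> * k z) \<partial>lborel) = ennreal (\<integral>x. \<bar>U (x + z) - U x\<bar> * k z \<partial>lborel)"
        using i k0 by (intro nn_integral_eq_integral) auto
      also have "\<dots> = ennreal ((\<integral>x. \<bar>U (x + z) - U x\<bar> \<partial>lborel) * k z)" by simp
      also have "\<dots> \<le> ennreal (e * k z)"
        using \<delta>(2)[of z] kz[of z] k0[of z] by (cases "norm z \<le> \<delta>") (auto intro!: ennreal_leI mult_right_mono)
      finally show "(\<integral>\<^sup>+x. ennreal (\<bar>U (x + z) - U x\<bar> * k z) \<partial>lborel) \<le> ennreal (e * k z)" .
    qed
    also have "\<dots> = ennreal (\<integral>z. e * k z \<partial>lborel)"
      using ik k0 e by (intro nn_integral_eq_integral) auto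
    also have "\<dots> = ennreal e" using k1 by simp
    finally have *: "(\<integral>\<^sup>+x. ennreal \<bar>v x - U x\<bar> \<partial>lborel) \<le> ennreal e" .
    have "(\<integral>x. \<bar>v x - U x\<bar> \<partial>lborel) = enn2real (\<integral>\<^sup>+x. ennreal \<bar>v x - U x\<bar> \<partial>lborel)"
      using m borel_measurable_continuous_onI[OF continuous_corr[OF iU, of d "\<lambda>_. 0"]]
      by (intro integral_eq_nn_integral) (auto simp: v_def)
    also have "\<dots> \<le> e" using enn2real_mono[OF *] e by simp
    finally show ?thesis using vM by (simp add: v_def)
  qed
  ultimately show ?thesis by blast
qed

section \<open>The Carleman inequality for weak solutions\<close>

text \<open>Convergence in mean carries over to squares because of the common bound M: |v^2 - U^2|
  <= 2 M |v - U|.\<close>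

lemma weighted_square_limit:
  fixes v :: "nat \<Rightarrow> 'a \<Rightarrow> real" and U :: "'a \<Rightarrow> real"
  assumes v: "\<And>m. integrable N (v m)" "\<And>m x. \<bar>v m x\<bar> \<le> M" and U: "integrable N U" "\<And>x. \<bar>U x\<bar> \<le> M"
    and lim: "\<And>m. (\<integral>x. \<bar>v m x - U x\<bar> \<partial>N) \<le> 1 / real (Suc m)"
    and G: "G \<in> borel_measurable N" "\<And>x. \<bar>G x\<bar> \<le> B"
  shows "(\<lambda>m. \<integral>x. G x * (v m x)\<^sup>2 \<partial>N) \<longlonglongrightarrow> (\<integral>x. G x * (U x)\<^sup>2 \<partial>N)"
    "integrable N (\<lambda>x. G x * (U x)\<^sup>2)" "integrable N (\<lambda>x. G x * (v m x)\<^sup>2)"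
proof -
  have int: "integrable N (\<lambda>x. G x * (f x)\<^sup>2)" if "integrable N f" "\<And>x. \<bar>f x\<bar> \<le> M" for f
  proof (rule Bochner_Integration.integrable_bound)
    show "integrable N (\<lambda>x. B * M * f x)" using that by simp
    show "(\<lambda>x. G x * (f x)\<^sup>2) \<in> borel_measurable N" using that G by auto
    show "AE x in N. norm (G x * (f x)\<^sup>2) \<le> norm (B * M * f x)"
    proof (rule AE_I2)
      fix x
      have "\<bar>G x\<bar> * (\<bar>f x\<bar> * \<bar>f x\<bar>) \<le> B * (M * \<bar>f x\<bar>)"
        using G(2)[of x] that(2)[of x] by (intro mult_mono) auto
      also have "\<dots> = (B * M) * \<bar>f x\<bar>" by simp
      also have "\<dots> \<le> \<bar>B * M\<bar> * \<bar>f x\<bar>" by (intro mult_right_mono) auto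
      also have "\<dots> = \<bar>B * M * f x\<bar>" by (simp add: abs_mult)
      finally show "norm (G x * (f x)\<^sup>2) \<le> norm (B * M * f x)"
        by (simp add: abs_mult power2_eq_square)
    qed
  qed
  show iU: "integrable N (\<lambda>x. G x * (U x)\<^sup>2)" by (rule int[OF U])
  have iv: "integrable N (\<lambda>x. G x * (v m x)\<^sup>2)" for m by (rule int[OF v])
  then show "integrable N (\<lambda>x. G x * (v m x)\<^sup>2)" .
  have bnd: "\<bar>(\<integral>x. G x * (v m x)\<^sup>2 \<partial>N) - (\<integral>x. G x * (U x)\<^sup>2 \<partial>N)\<bar> \<le> \<bar>B\<bar> * (2 * \<bar>M\<bar>) * (1 / real (Suc m))" for m
  proof -
    have i: "integrable N (\<lambda>x. \<bar>v m x - U x\<bar>)" using v U by auto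
    have "\<bar>(\<integral>x. G x * (v m x)\<^sup>2 \<partial>N) - (\<integral>x. G x * (U x)\<^sup>2 \<partial>N)\<bar> = \<bar>\<integral>x. G x * (v m x)\<^sup>2 - G x * (U x)\<^sup>2 \<partial>N\<bar>"
      using iU iv by simp
    also have "\<dots> \<le> (\<integral>x. \<bar>G x * (v m x)\<^sup>2 - G x * (U x)\<^sup>2\<bar> \<partial>N)"
      using integral_norm_bound[of N "\<lambda>x. G x * (v m x)\<^sup>2 - G x * (U x)\<^sup>2"] by simp
    also have "\<dots> \<le> (\<integral>x. \<bar>B\<bar> * (2 * \<bar>M\<bar>) * \<bar>v m x - U x\<bar> \<partial>N)"
    proof (rule integral_mono)
      show "integrable N (\<lambda>x. \<bar>G x * (v m x)\<^sup>2 - G x * (U x)\<^sup>2\<bar>)" using iU iv by auto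
      show "integrable N (\<lambda>x. \<bar>B\<bar> * (2 * \<bar>M\<bar>) * \<bar>v m x - U x\<bar>)" using i by simp
      fix x
      have "G x * (v m x)\<^sup>2 - G x * (U x)\<^sup>2 = G x * (v m x + U x) * (v m x - U x)"
        by (simp add: power2_eq_square algebra_simps)
      moreover have "\<bar>v m x + U x\<bar> \<le> 2 * \<bar>M\<bar>" using v(2)[of m x] U(2)[of x] by linarith
      moreover have "\<bar>G x\<bar> \<le> \<bar>B\<bar>" using G(2)[of x] by linarith
      ultimately show "\<bar>G x * (v m x)\<^sup>2 - G x * (U x)\<^sup>2\<bar> \<le> \<bar>B\<bar> * (2 * \<bar>M\<bar>) * \<bar>v m x - U x\<bar>"
        by (simp only: abs_mult) (intro mult_right_mono mult_mono, auto)
    qed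
    also have "\<dots> \<le> \<bar>B\<bar> * (2 * \<bar>M\<bar>) * (1 / real (Suc m))"
      using lim[of m] by (simp only: integral_mult_right_zero) (intro mult_left_mono, auto)
    finally show ?thesis .
  qed
  have bl: "(\<lambda>m. \<bar>B\<bar> * (2 * \<bar>M\<bar>) * (1 / real (Suc m))) \<longlonglongrightarrow> \<bar>B\<bar> * (2 * \<bar>M\<bar>) * 0"
    by (rule tendsto_mult[OF tendsto_const LIMSEQ_inverse_real_of_nat[unfolded inverse_eq_divide]])
  have "(\<lambda>m. (\<integral>x. G x * (v m x)\<^sup>2 \<partial>N) - (\<integral>x. G x * (U x)\<^sup>2 \<partial>N)) \<longlonglongrightarrow> 0"
  proof (rule Lim_null_comparison[rotated])
    show "(\<lambda>m. \<bar>B\<bar> * (2 * \<bar>M\<bar>) * (1 / real (Suc m))) \<longlonglongrightarrow> 0"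
      using bl by (simp only: mult_zero_right)
  qed (intro always_eventually allI, simp only: real_norm_def bnd)
  then show "(\<lambda>m. \<integral>x. G x * (v m x)\<^sup>2 \<partial>N) \<longlonglongrightarrow> (\<integral>x. G x * (U x)\<^sup>2 \<partial>N)"
    by (rule LIM_zero_cancel)
qed

text \<open>The mollification \<open>v m\<close> of u has as its Laplacian the mollification
  \<open>f m\<close> of V u, and the a priori inequality is passed to the limit in both. After that
  |V u| <= |u| is inserted: for s <= 8 R^2 the Laplacian term is at most 2 * 8 R^2 = 16 R^2 times
  the integral on the left, where it is moved. The constant doubles from 256 to 512 because the
  local integrals of u^2 + (V u)^2 are at most twice those of u^2.\<close>

lemma carleman_weak:
  fixes u V :: "real^'n::finite \<Rightarrow> real" and a R :: real
  assumes sol: "solves_schrodinger V u" and Vm: "V \<in> borel_measurable lborel"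
    and V1: "AE x in lborel. \<bar>V x\<bar> \<le> 1"
    and uM: "\<And>y. norm y \<le> 4 * R + 1 \<Longrightarrow> \<bar>u (x0 + y)\<bar> \<le> M"
    and R: "R \<ge> 1" and a: "a \<ge> 1"
  defines "n \<equiv> real CARD('n)"
  defines "b \<equiv> a / (8 * R\<^sup>2)"
  defines "w2 \<equiv> \<lambda>x::real^'n. (wt a b (x \<bullet> x) * cutoff R (x \<bullet> x))\<^sup>2"
  defines "I \<equiv> \<lambda>r. \<integral>x. indicator (ball 0 r) x * (u (x0 + x))\<^sup>2 \<partial>lborel"
  shows "(16 * b * (a\<^sup>2 - 1) - 16 * R\<^sup>2) * (\<integral>x. (x \<bullet> x) * w2 x * (u (x0 + x))\<^sup>2 \<partial>lborel) \<le>
     512 * (2304 + 72 * n)\<^sup>2 * (578 + 18 * n) * ((wt a b (1/4))\<^sup>2 * I 1 + R ^ 4 * (wt a b (4 * R\<^sup>2))\<^sup>2 * I (4 * R))"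
    and "integrable lborel (\<lambda>x. (x \<bullet> x) * w2 x * (u (x0 + x))\<^sup>2)"
    and "r \<le> 4 * R \<Longrightarrow> integrable lborel (\<lambda>x. indicator (ball 0 r) x * (u (x0 + x))\<^sup>2)"
proof -
  have R0: "R > 0" "R\<^sup>2 > 0" using R by auto
  have um: "u \<in> borel_measurable borel" using sol by (auto simp: solves_schrodinger_def)
  have vm: "V \<in> borel_measurable borel" using Vm by simp
  \<comment> \<open>Kernels of radius at most 1 centred in the ball of radius 4 R only see |y| <= 4
    R + 1.\<close>
  define Q where "Q = 4 * R + 1"
  define U where "U = (\<lambda>y. indicator (cball 0 Q) y * u (x0 + y))"
  text \<open>Clipping V at 1 changes it on a null set only but makes the truncated right-hand side bounded everywhere.\<close>
  define V' where "V' = (\<lambda>x. max (- 1) (min 1 (V x)))"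
  define F where "F = (\<lambda>y. indicator (cball 0 Q) y * (V' (x0 + y) * u (x0 + y)))"
  have V': "AE x in lborel. V' x = V x"
    using V1 by eventually_elim (auto simp: V'_def abs_le_iff max_def min_def)
  have V'm: "V' \<in> borel_measurable borel" unfolding V'_def using vm by auto
  have sol': "solves_schrodinger V' u"
  proof -
    have 1: "set_integrable lborel K (\<lambda>x. V' x * u x)" if "compact K" for K
    proof -
      have "set_integrable lborel K (\<lambda>x. V x * u x)" using sol that by (auto simp: solves_schrodinger_def)
      moreover have "(\<lambda>x. indicator K x *\<^sub>R (V' x * u x)) \<in> borel_measurable lborel"
        using V'm um borel_compact[OF that] by measurable
      ultimately show ?thesis
        unfolding set_integrable_def by (rule integrable_cong_AE_imp) (use V' in \<open>eventually_elim, simp\<close>)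
    qed
    have 2: "(LINT x|lborel. V' x * u x * \<phi> x) = (LINT x|lborel. V x * u x * \<phi> x)" if "test_fun \<phi>" for \<phi>
    proof (rule integral_cong_AE)
      have "continuous_on UNIV (partials [] \<phi>)" using that unfolding test_fun_def smooth_fun_def by blast
      then have "\<phi> \<in> borel_measurable borel" by (simp add: borel_measurable_continuous_onI)
      then show "(\<lambda>x. V' x * u x * \<phi> x) \<in> borel_measurable lborel" "(\<lambda>x. V x * u x * \<phi> x) \<in> borel_measurable lborel"
        using V'm vm um by auto
      show "AE x in lborel. V' x * u x * \<phi> x = V x * u x * \<phi> x"
        using V' by eventually_elim simp
    qed
    show ?thesis using sol 1 2 unfolding solves_schrodinger_def by auto
  qed
  have M: "M \<ge> 0" using uM[of 0] R by force
  have Um: "U \<in> borel_measurable borel" and Fm: "F \<in> borel_measurable borel"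
  proof -
    have "(\<lambda>y. u (x0 + y)) \<in> borel_measurable borel" "(\<lambda>y. V' (x0 + y)) \<in> borel_measurable borel"
      using um V'm by (auto intro!: measurable_compose[of "\<lambda>y. x0 + y" borel borel])
    moreover have "(indicator (cball 0 Q) :: real^'n \<Rightarrow> real) \<in> borel_measurable borel"
      by (rule borel_measurable_indicator) simp
    ultimately show "U \<in> borel_measurable borel" "F \<in> borel_measurable borel"
      unfolding U_def F_def by auto
  qed
  have Ub: "\<bar>U x\<bar> \<le> M" for x
    using uM[of x] M by (auto simp: U_def Q_def indicator_def)
  have FU: "\<bar>F x\<bar> \<le> \<bar>U x\<bar>" for x
  proof -
    have "\<bar>V' y\<bar> \<le> 1" for y by (auto simp: V'_def)
    then have "\<bar>V' (x0 + x)\<bar> * \<bar>u (x0 + x)\<bar> \<le> 1 * \<bar>u (x0 + x)\<bar>" by (intro mult_right_mono) auto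
    then show ?thesis by (auto simp: F_def U_def indicator_def abs_mult)
  qed
  have Fb: "\<bar>F x\<bar> \<le> M" for x using FU[of x] Ub[of x] by linarith
  have Uz: "U x = 0" "F x = 0" if "norm x > Q" for x using that by (auto simp: U_def F_def)
  have iU: "integrable lborel U" and iF: "integrable lborel F"
    using integrable_bounded_support[OF Um Ub Uz(1)] integrable_bounded_support[OF Fm Fb Uz(2)] by auto
  define kap where "kap = (\<lambda>d. \<integral>z. mol d (\<lambda>_. 0) (z::real^'n) \<partial>lborel)"
  \<comment> \<open>One d has to serve for both U and F, since the equation ties together
    mollifications at the same scale.\<close>
  define P where "P = (\<lambda>m d. d > 0 \<and> real CARD('n) * d \<le> 1 \<and>
      (\<integral>x. \<bar>corr U (mol d (\<lambda>_. 0)) x / kap d - U x\<bar> \<partial>lborel) \<le> 1 / real (Suc m) \<and>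
      (\<integral>x. \<bar>corr F (mol d (\<lambda>_. 0)) x / kap d - F x\<bar> \<partial>lborel) \<le> 1 / real (Suc m) \<and>
      (\<forall>x. \<bar>corr U (mol d (\<lambda>_. 0)) x / kap d\<bar> \<le> M) \<and> (\<forall>x. \<bar>corr F (mol d (\<lambda>_. 0)) x / kap d\<bar> \<le> M))"
  have "\<exists>d. P m d" for m
  proof -
    have e: "1 / real (Suc m) > 0" by simp
    obtain d1 d2 where d: "d1 > 0" "d2 > 0"
      "\<And>d. 0 < d \<and> d \<le> d1 \<Longrightarrow> (\<integral>x. \<bar>corr U (mol d (\<lambda>_. 0)) x / kap d - U x\<bar> \<partial>lborel) \<le> 1 / real (Suc m) \<and> (\<forall>x. \<bar>corr U (mol d (\<lambda>_. 0)) x / kap d\<bar> \<le> M)"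
      "\<And>d. 0 < d \<and> d \<le> d2 \<Longrightarrow> (\<integral>x. \<bar>corr F (mol d (\<lambda>_. 0)) x / kap d - F x\<bar> \<partial>lborel) \<le> 1 / real (Suc m) \<and> (\<forall>x. \<bar>corr F (mol d (\<lambda>_. 0)) x / kap d\<bar> \<le> M)"
      using mollification_L1[OF Um Ub Uz(1) e] mollification_L1[OF Fm Fb Uz(2) e] unfolding kap_def by blast
    show ?thesis
      unfolding P_def
    proof (intro exI conjI)
      let ?d = "min (min d1 d2) (1 / real CARD('n))"
      show d0: "?d > 0" using d(1,2) by simp
      have "real CARD('n) * ?d \<le> real CARD('n) * (1 / real CARD('n))" by (intro mult_left_mono) auto
      then show "real CARD('n) * ?d \<le> 1" by simp
      have "?d \<le> d1" "?d \<le> d2" by auto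
      with d0 d(3)[of ?d] d(4)[of ?d]
      show "(\<integral>x. \<bar>corr U (mol ?d (\<lambda>_. 0)) x / kap ?d - U x\<bar> \<partial>lborel) \<le> 1 / real (Suc m)"
        "(\<integral>x. \<bar>corr F (mol ?d (\<lambda>_. 0)) x / kap ?d - F x\<bar> \<partial>lborel) \<le> 1 / real (Suc m)"
        "\<forall>x. \<bar>corr U (mol ?d (\<lambda>_. 0)) x / kap ?d\<bar> \<le> M" "\<forall>x. \<bar>corr F (mol ?d (\<lambda>_. 0)) x / kap ?d\<bar> \<le> M"
        by blast+
    qed
  qed
  then have "\<exists>d. \<forall>m. P m (d m)" by (intro choice allI)
  then obtain d where "\<And>m. P m (d m)" by blast
  then have d: "\<And>m. d m > 0" "\<And>m. real CARD('n) * d m \<le> 1"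
    and lU: "\<And>m. (\<integral>x. \<bar>corr U (mol (d m) (\<lambda>_. 0)) x / kap (d m) - U x\<bar> \<partial>lborel) \<le> 1 / real (Suc m)"
    and lF: "\<And>m. (\<integral>x. \<bar>corr F (mol (d m) (\<lambda>_. 0)) x / kap (d m) - F x\<bar> \<partial>lborel) \<le> 1 / real (Suc m)"
    and bU: "\<And>m x. \<bar>corr U (mol (d m) (\<lambda>_. 0)) x / kap (d m)\<bar> \<le> M"
    and bF: "\<And>m x. \<bar>corr F (mol (d m) (\<lambda>_. 0)) x / kap (d m)\<bar> \<le> M"
    unfolding P_def by blast+
  define v where "v = (\<lambda>m x. corr U (mol (d m) (\<lambda>_. 0)) x / kap (d m))"
  define f where "f = (\<lambda>m x. corr F (mol (d m) (\<lambda>_. 0)) x / kap (d m))"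
  have corr_int: "integrable lborel (\<lambda>x. corr H (mol (d m) (\<lambda>_. 0)) x / kap (d m))"
    if "integrable lborel H" "\<And>x. norm x > Q \<Longrightarrow> H x = 0" for H :: "real^'n \<Rightarrow> real" and m
  proof (rule integrable_continuous_bounded_support[where r="Q + 1"])
    show "continuous_on UNIV (\<lambda>x. corr H (mol (d m) (\<lambda>_. 0)) x / kap (d m))"
      unfolding divide_inverse by (intro continuous_intros continuous_corr that)
    fix x :: "real^'n" assume x: "norm x > Q + 1"
    have "H y * mol (d m) (\<lambda>_. 0) (y - x) = 0" for y
    proof (cases "norm y > Q")
      case False
      have "norm x \<le> norm y + norm (y - x)" using norm_triangle_ineq4[of y "y - x"] by simp
      then show ?thesis using mol_zero[of "d m" "y - x"] d(2)[of m] x False by simp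
    qed (use that in simp)
    then show "corr H (mol (d m) (\<lambda>_. 0)) x / kap (d m) = 0" by (simp only: corr_def) simp
  qed
  have iv: "integrable lborel (v m)" and iff: "integrable lborel (f m)" for m
    unfolding v_def f_def using corr_int iU iF Uz by auto
  have bv: "\<bar>v m x\<bar> \<le> M" "\<bar>f m x\<bar> \<le> M" for m x unfolding v_def f_def by (rule bU bF)+
  have lv: "(\<integral>x. \<bar>v m x - U x\<bar> \<partial>lborel) \<le> 1 / real (Suc m)"
    "(\<integral>x. \<bar>f m x - F x\<bar> \<partial>lborel) \<le> 1 / real (Suc m)" for m
    unfolding v_def f_def by (rule lU lF)+
  note limU = weighted_square_limit[OF iv bv(1) iU Ub lv(1)]
  note limF = weighted_square_limit[OF iff bv(2) iF Fb lv(2)]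
  define g1 g2 where "g1 = (\<lambda>x. (x \<bullet> x) * w2 x)" and "g2 = (\<lambda>x. (x \<bullet> x)\<^sup>2 * w2 x)"
  have cw: "continuous_on UNIV w2"
    unfolding w2_def
    by (intro continuous_on_power continuous_on_compose2[OF continuous_wt_cutoff[OF R0(1), of a b]])
       (auto intro!: continuous_intros)
  have w0: "w2 x \<ge> 0" for x by (simp add: w2_def)
  have wz: "w2 x = 0" if "x \<bullet> x \<ge> 8 * R\<^sup>2" for x
    using cutoff_zero[OF R0(1)] that by (simp add: w2_def)
  have wz': "w2 x = 0" if "norm x > 4 * R" for x
  proof -
    have "x \<bullet> x \<ge> (4 * R)\<^sup>2" using inner_self_less_iff[of "4 * R" x] that R0 by auto
    moreover have "(4 * R)\<^sup>2 = 16 * R\<^sup>2" by (simp add: power_mult_distrib)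
    ultimately have "x \<bullet> x \<ge> 8 * R\<^sup>2" using R0(2) by linarith
    then show ?thesis by (rule wz)
  qed
  have cg: "continuous_on UNIV g1" "continuous_on UNIV g2"
    unfolding g1_def g2_def by (intro continuous_intros cw)+
  obtain B1 where B1: "\<And>x. \<bar>g1 x\<bar> \<le> B1"
    by (rule bounded_continuous_bounded_support[OF cg(1), of "4*R"]) (auto simp: g1_def wz')
  obtain B2 where B2: "\<And>x. \<bar>g2 x\<bar> \<le> B2"
    by (rule bounded_continuous_bounded_support[OF cg(2), of "4*R"]) (auto simp: g2_def wz')
  have mg: "g1 \<in> borel_measurable lborel" "g2 \<in> borel_measurable lborel"
    using cg by (simp_all add: borel_measurable_continuous_onI)
  have mi: "(indicator (ball 0 r) :: real^'n \<Rightarrow> real) \<in> borel_measurable lborel" for r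
    by (intro borel_measurable_indicator) simp
  have mi1: "\<bar>indicator (ball 0 r) x\<bar> \<le> (1::real)" for r and x :: "real^'n"
    by (simp add: indicator_def)
  note limUi = limU[OF mi mi1] and limFi = limF[OF mi mi1]
  define K where "K = 256 * (2304 + 72 * n)\<^sup>2 * (578 + 18 * n)"
  have K: "K \<ge> 0" by (simp add: K_def n_def)
  define J where "J = (\<lambda>r m. (\<integral>x. indicator (ball 0 r) x * (v m x)\<^sup>2 \<partial>lborel) + (\<integral>x. indicator (ball 0 r) x * (f m x)\<^sup>2 \<partial>lborel))"
  have step: "16 * b * (a\<^sup>2 - 1) * (\<integral>x. g1 x * (v m x)\<^sup>2 \<partial>lborel) \<le>
     2 * (\<integral>x. g2 x * (f m x)\<^sup>2 \<partial>lborel) + K * ((wt a b (1/4))\<^sup>2 * J 1 m + R ^ 4 * (wt a b (4 * R\<^sup>2))\<^sup>2 * J (4 * R) m)" for m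
  proof -
    define U' where "U' = (\<lambda>y. U y / kap (d m))"
    have iU': "integrable lborel U'" using iU by (simp add: U'_def)
    have vU': "corr U' (mol (d m) (\<lambda>_. 0)) = v m"
      by (simp add: fun_eq_iff v_def corr_def U'_def)
    define L where "L = lap (\<lambda>i j. corr U' (mol (d m) (((\<lambda>_. 0)(i := Suc ((\<lambda>_. 0) i)))(j := Suc (((\<lambda>_. 0)(i := Suc ((\<lambda>_. 0) i))) j)))))"
    \<comment> \<open>Farther out the truncation spoils the equation, but all weights and indicators
      in the inequality vanish there.\<close>
    have L: "L x = f m x" if "norm x \<le> 4 * R" for x
    proof -
      have "L x = (\<integral>y. U' y * laplacian (\<lambda>z. mol (d m) (\<lambda>_. 0) (z - x)) y \<partial>lborel)"
        unfolding L_def by (rule lap_corr[OF iU'])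
      also have "\<dots> = (\<integral>y. U y * laplacian (\<lambda>z. mol (d m) (\<lambda>_. 0) (z - x)) y \<partial>lborel) / kap (d m)"
        by (simp add: U'_def)
      also have "(\<integral>y. U y * laplacian (\<lambda>z. mol (d m) (\<lambda>_. 0) (z - x)) y \<partial>lborel) = corr F (mol (d m) (\<lambda>_. 0)) x"
        by (rule lap_corr_solution[OF sol' iU, of Q x0])
           (use that d(2)[of m] um V'm in \<open>auto simp: U_def F_def Q_def\<close>)
      finally show ?thesis by (simp add: f_def)
    qed
    have Ig: "(\<integral>x. (x \<bullet> x)\<^sup>2 * w2 x * (L x)\<^sup>2 \<partial>lborel) = (\<integral>x. g2 x * (f m x)\<^sup>2 \<partial>lborel)"
    proof (rule Bochner_Integration.integral_cong[OF refl])
      fix x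
      show "(x \<bullet> x)\<^sup>2 * w2 x * (L x)\<^sup>2 = g2 x * (f m x)\<^sup>2"
        using L[of x] wz'[of x] by (cases "norm x \<le> 4 * R") (auto simp: g2_def)
    qed
    have IJ: "(\<integral>x. indicator (ball 0 r) x * ((v m x)\<^sup>2 + (L x)\<^sup>2) \<partial>lborel) = J r m" if "r \<le> 4 * R" for r
    proof -
      have "(\<integral>x. indicator (ball 0 r) x * ((v m x)\<^sup>2 + (L x)\<^sup>2) \<partial>lborel) =
        (\<integral>x. indicator (ball 0 r) x * (v m x)\<^sup>2 + indicator (ball 0 r) x * (f m x)\<^sup>2 \<partial>lborel)"
        by (rule Bochner_Integration.integral_cong) (use L that in \<open>auto simp: indicator_def\<close>)
      also have "\<dots> = J r m"
        unfolding J_def by (intro Bochner_Integration.integral_add limUi(3) limFi(3))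
      finally show ?thesis .
    qed
    have "16 * b * (a\<^sup>2 - 1) * (\<integral>x. (x \<bullet> x) * w2 x * (v m x)\<^sup>2 \<partial>lborel) \<le>
     2 * (\<integral>x. (x \<bullet> x)\<^sup>2 * w2 x * (L x)\<^sup>2 \<partial>lborel)
     + K * ((wt a b (1/4))\<^sup>2 * (\<integral>x. indicator (ball 0 1) x * ((v m x)\<^sup>2 + (L x)\<^sup>2) \<partial>lborel)
       + R ^ 4 * (wt a b (4 * R\<^sup>2))\<^sup>2 * (\<integral>x. indicator (ball 0 (4 * R)) x * ((v m x)\<^sup>2 + (L x)\<^sup>2) \<partial>lborel))"
      using carleman_apriori[OF C2data_corr[OF iU', of "d m" "\<lambda>_. 0"] R a, folded L_def]
      unfolding vU' b_def K_def n_def w2_def .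
    then show ?thesis unfolding Ig using R by (simp add: IJ g1_def)
  qed
  define JJ where "JJ = (\<lambda>r. (\<integral>x. indicator (ball 0 r) x * (U x)\<^sup>2 \<partial>lborel) + (\<integral>x. indicator (ball 0 r) x * (F x)\<^sup>2 \<partial>lborel))"
  have limJ: "(\<lambda>m. J r m) \<longlonglongrightarrow> JJ r" for r
    unfolding J_def JJ_def by (intro tendsto_add limUi(1) limFi(1))
  have main: "16 * b * (a\<^sup>2 - 1) * (\<integral>x. g1 x * (U x)\<^sup>2 \<partial>lborel) \<le>
     2 * (\<integral>x. g2 x * (F x)\<^sup>2 \<partial>lborel) + K * ((wt a b (1/4))\<^sup>2 * JJ 1 + R ^ 4 * (wt a b (4 * R\<^sup>2))\<^sup>2 * JJ (4 * R))"
  proof (rule LIMSEQ_le)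
    show "(\<lambda>m. 16 * b * (a\<^sup>2 - 1) * (\<integral>x. g1 x * (v m x)\<^sup>2 \<partial>lborel)) \<longlonglongrightarrow> 16 * b * (a\<^sup>2 - 1) * (\<integral>x. g1 x * (U x)\<^sup>2 \<partial>lborel)"
      by (intro tendsto_mult tendsto_const limU(1)[OF mg(1) B1])
    show "(\<lambda>m. 2 * (\<integral>x. g2 x * (f m x)\<^sup>2 \<partial>lborel) + K * ((wt a b (1/4))\<^sup>2 * J 1 m + R ^ 4 * (wt a b (4 * R\<^sup>2))\<^sup>2 * J (4 * R) m))
       \<longlonglongrightarrow> 2 * (\<integral>x. g2 x * (F x)\<^sup>2 \<partial>lborel) + K * ((wt a b (1/4))\<^sup>2 * JJ 1 + R ^ 4 * (wt a b (4 * R\<^sup>2))\<^sup>2 * JJ (4 * R))"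
      by (intro tendsto_add tendsto_mult tendsto_const limF(1)[OF mg(2) B2] limJ)
  qed (use step in blast)
  have FU2: "(F x)\<^sup>2 \<le> (U x)\<^sup>2" for x
    using FU[of x] by (simp add: abs_le_square_iff)
  have iU1: "integrable lborel (\<lambda>x. g1 x * (U x)\<^sup>2)" by (rule limU(2)[OF mg(1) B1])
  have UI: "(\<integral>x. indicator (ball 0 r) x * (U x)\<^sup>2 \<partial>lborel) = I r"
    "integrable lborel (\<lambda>x. indicator (ball 0 r) x * (u (x0 + x))\<^sup>2)" if "r \<le> 4 * R" for r
  proof -
    have *: "(\<lambda>x. indicator (ball 0 r) x * (U x)\<^sup>2) = (\<lambda>x. indicator (ball 0 r) x * (u (x0 + x))\<^sup>2)"
      using that by (auto simp: fun_eq_iff U_def Q_def indicator_def)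
    show "(\<integral>x. indicator (ball 0 r) x * (U x)\<^sup>2 \<partial>lborel) = I r" by (simp add: * I_def)
    show "integrable lborel (\<lambda>x. indicator (ball 0 r) x * (u (x0 + x))\<^sup>2)"
      using limUi(2)[of r] by (simp add: *)
  qed
  have Ug: "g1 x * (U x)\<^sup>2 = (x \<bullet> x) * w2 x * (u (x0 + x))\<^sup>2" for x
    using wz'[of x] by (cases "norm x > 4 * R") (auto simp: g1_def U_def Q_def)
  have JI: "JJ r \<le> 2 * I r" if "r \<le> 4 * R" for r
  proof -
    have "(\<integral>x. indicator (ball 0 r) x * (F x)\<^sup>2 \<partial>lborel) \<le> (\<integral>x. indicator (ball 0 r) x * (U x)\<^sup>2 \<partial>lborel)"
      by (intro integral_mono limUi(2) limFi(2) mult_left_mono FU2) auto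
    then show ?thesis using UI(1)[OF that] by (simp add: JJ_def)
  qed
  have g2F: "(\<integral>x. g2 x * (F x)\<^sup>2 \<partial>lborel) \<le> (\<integral>x. 8 * R\<^sup>2 * (g1 x * (U x)\<^sup>2) \<partial>lborel)"
  proof (rule integral_mono)
    show "integrable lborel (\<lambda>x. g2 x * (F x)\<^sup>2)" by (rule limF(2)[OF mg(2) B2])
    show "integrable lborel (\<lambda>x. 8 * R\<^sup>2 * (g1 x * (U x)\<^sup>2))" by (intro integrable_mult_right iU1)
    fix x
    have "g2 x \<le> 8 * R\<^sup>2 * g1 x"
    proof (cases "x \<bullet> x \<ge> 8 * R\<^sup>2")
      case False
      then have "(x \<bullet> x) * ((x \<bullet> x) * w2 x) \<le> 8 * R\<^sup>2 * ((x \<bullet> x) * w2 x)"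
        using w0[of x] by (intro mult_right_mono) auto
      then show ?thesis by (simp add: g2_def g1_def power2_eq_square mult.assoc)
    qed (simp add: wz g1_def g2_def)
    then have "g2 x * (F x)\<^sup>2 \<le> (8 * R\<^sup>2 * g1 x) * (U x)\<^sup>2"
      using FU2[of x] w0[of x] by (intro mult_mono) (auto simp: g1_def)
    then show "g2 x * (F x)\<^sup>2 \<le> 8 * R\<^sup>2 * (g1 x * (U x)\<^sup>2)" by (simp add: mult.assoc)
  qed
  have "16 * b * (a\<^sup>2 - 1) * (\<integral>x. g1 x * (U x)\<^sup>2 \<partial>lborel) \<le> 16 * R\<^sup>2 * (\<integral>x. g1 x * (U x)\<^sup>2 \<partial>lborel)
     + K * ((wt a b (1/4))\<^sup>2 * (2 * I 1) + R ^ 4 * (wt a b (4 * R\<^sup>2))\<^sup>2 * (2 * I (4 * R)))"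
  proof -
    have "K * ((wt a b (1/4))\<^sup>2 * JJ 1 + R ^ 4 * (wt a b (4 * R\<^sup>2))\<^sup>2 * JJ (4 * R)) \<le>
       K * ((wt a b (1/4))\<^sup>2 * (2 * I 1) + R ^ 4 * (wt a b (4 * R\<^sup>2))\<^sup>2 * (2 * I (4 * R)))"
      using JI[of 1] JI[of "4 * R"] R K by (intro mult_left_mono add_mono) auto
    then show ?thesis using main g2F by simp
  qed
  then have "(16 * b * (a\<^sup>2 - 1) - 16 * R\<^sup>2) * (\<integral>x. g1 x * (U x)\<^sup>2 \<partial>lborel) \<le>
      2 * K * ((wt a b (1/4))\<^sup>2 * I 1 + R ^ 4 * (wt a b (4 * R\<^sup>2))\<^sup>2 * I (4 * R))"
    by (simp add: algebra_simps)
  then show "(16 * b * (a\<^sup>2 - 1) - 16 * R\<^sup>2) * (\<integral>x. (x \<bullet> x) * w2 x * (u (x0 + x))\<^sup>2 \<partial>lborel) \<le>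
     512 * (2304 + 72 * n)\<^sup>2 * (578 + 18 * n) * ((wt a b (1/4))\<^sup>2 * I 1 + R ^ 4 * (wt a b (4 * R\<^sup>2))\<^sup>2 * I (4 * R))"
    unfolding Ug K_def by simp
  show "integrable lborel (\<lambda>x. (x \<bullet> x) * w2 x * (u (x0 + x))\<^sup>2)" using iU1 unfolding Ug .
  show "r \<le> 4 * R \<Longrightarrow> integrable lborel (\<lambda>x. indicator (ball 0 r) x * (u (x0 + x))\<^sup>2)" by (rule UI(2))
qed

section \<open>The lower bound\<close>

text \<open>The centre \<open>c\<close> and the new origin \<open>c'\<close> are separate because
  both the ball at x0 and the ball at 0 have to be written in coordinates centred at x0.\<close>

lemma L2_norm_on_ball:
  fixes u :: "real^'n::finite \<Rightarrow> real"
  assumes "u \<in> borel_measurable borel"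
  shows "L2_norm_on u (ball c r) = sqrt (\<integral>x. indicator (ball (c - c') r) x * (u (c' + x))\<^sup>2 \<partial>lborel)"
proof -
  have 1: "(\<lambda>x. indicator (ball c r) x * (u x)\<^sup>2) \<in> borel_measurable borel"
    using assms by (intro borel_measurable_times borel_measurable_indicator borel_measurable_power) auto
  have 2: "indicator (ball (c - c') r) x = (indicator (ball c r) (x + c') :: real)" for x
    by (simp add: indicator_def dist_norm algebra_simps)
  have "L2_norm_on u (ball c r) = sqrt (\<integral>x. indicator (ball c r) x * (u x)\<^sup>2 \<partial>lborel)"
    by (simp add: L2_norm_on_def set_lebesgue_integral_def)
  also have "\<dots> = sqrt (\<integral>x. indicator (ball c r) (x + c') * (u (x + c'))\<^sup>2 \<partial>lborel)"
    using lborel_integral_translate[OF 1, of c'] by simp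
  finally show ?thesis by (simp only: 2 add.commute[of c'])
qed

section \<open>Comparing the weight at different distances\<close>

lemma wt_square: "(wt a b s)\<^sup>2 = exp (b * s - (2 * a + 1) * ln s)"
proof -
  have "(wt a b s)\<^sup>2 = exp (2 * (b * s / 2 - (a + 1/2) * ln s))"
    unfolding wt_def by (simp add: exp_of_nat_mult[symmetric] power2_eq_square mult_exp_exp)
  then show ?thesis by (simp add: algebra_simps)
qed

text \<open>Doubling s from 2 R^2 to 4 R^2 lowers the exponent by (2a + 1) ln 2 >= 4a/3, while the
  factor exp(b s) gives back only a/4; the difference exceeds a.\<close>

lemma outer_weight_ratio:
  assumes "R > 0" "a \<ge> 0"
  shows "(wt a (a / (8 * R\<^sup>2)) (4 * R\<^sup>2))\<^sup>2 \<le> exp (- a) * (wt a (a / (8 * R\<^sup>2)) (2 * R\<^sup>2))\<^sup>2"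
proof -
  define L where "L = ln (2 * R\<^sup>2)"
  have L: "ln (4 * R\<^sup>2) = ln 2 + L"
    unfolding L_def using assms ln_mult[of 2 "2 * R\<^sup>2"] by simp
  have "(2 * a + 1) * (2 / 3) \<le> (2 * a + 1) * ln 2"
    using assms ln2_ge_two_thirds by (intro mult_left_mono) auto
  then have "a / 2 - (2 * a + 1) * (ln 2 + L) \<le> - a + (a / 4 - (2 * a + 1) * L)"
    using assms by (simp add: algebra_simps)
  moreover have "a / (8 * R\<^sup>2) * (4 * R\<^sup>2) = a / 2" "a / (8 * R\<^sup>2) * (2 * R\<^sup>2) = a / 4"
    using assms by simp_all
  ultimately show ?thesis
    unfolding wt_square L L_def[symmetric] exp_add[symmetric] by (simp only: exp_le_cancel_iff)
qed

text \<open>The 9 is 3 * 3, from 2a + 1 <= 3a and from 8 R^2 <= R^3, which is R >= 8. The factor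
  exp(b s) increases with s and so acts in the right direction.\<close>

lemma inner_weight_ratio:
  assumes "R \<ge> 8" "a \<ge> 1"
  shows "exp (- (9 * a * ln R)) * (wt a (a / (8 * R\<^sup>2)) (1 / 4))\<^sup>2 \<le> (wt a (a / (8 * R\<^sup>2)) (2 * R\<^sup>2))\<^sup>2"
proof -
  have R: "R > 0" "R\<^sup>2 > 0" using assms by auto
  have "1 \<le> R\<^sup>2" using assms by (simp add: one_le_power)
  then have "0 \<le> ln (8 * R\<^sup>2)" by simp
  moreover have eq: "ln (2 * R\<^sup>2) - ln (1 / 4) = ln (8 * R\<^sup>2)"
    using ln_div[of "2 * R\<^sup>2" "1/4"] R by simp
  ultimately have calc0: "0 \<le> ln (2 * R\<^sup>2) - ln (1 / 4)" by simp
  note eq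
  also have "ln (8 * R\<^sup>2) \<le> ln (R ^ 3)"
    using assms R by (simp add: power3_eq_cube power2_eq_square)
  also have "\<dots> = 3 * ln R" using R by (simp add: ln_realpow)
  finally have le: "ln (2 * R\<^sup>2) - ln (1 / 4) \<le> 3 * ln R" .
  have "(2 * a + 1) * (ln (2 * R\<^sup>2) - ln (1 / 4)) \<le> (3 * a) * (3 * ln R)"
  proof (rule mult_mono)
    show "0 \<le> ln (2 * R\<^sup>2) - ln (1 / 4)" by (rule calc0)
  qed (use assms le in auto)
  then have 1: "- (9 * a * ln R) - (2 * a + 1) * ln (1 / 4) \<le> - (2 * a + 1) * ln (2 * R\<^sup>2)"
    unfolding right_diff_distrib by linarith
  have "1 / 4 \<le> 2 * R\<^sup>2" using \<open>1 \<le> R\<^sup>2\<close> by linarith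
  then have 2: "a / (8 * R\<^sup>2) * (1/4) \<le> a / (8 * R\<^sup>2) * (2 * R\<^sup>2)"
    using assms by (intro mult_left_mono) auto
  show ?thesis
    unfolding wt_square exp_add[symmetric] exp_le_cancel_iff using 1 2 by linarith
qed

lemma polynomial_exp_eventually:
  fixes c :: real
  shows "\<exists>R0\<ge>8. \<forall>R\<ge>R0. c * R ^ k * exp (- R) \<le> 1 / 2"
proof -
  have "((\<lambda>R::real. c * (R ^ k / exp R)) \<longlongrightarrow> c * 0) at_top"
    by (rule tendsto_mult[OF tendsto_const tendsto_power_div_exp_0])
  then have "eventually (\<lambda>R. c * (R ^ k / exp R) < 1 / 2) at_top"
    by (rule order_tendstoD(2)) simp
  then obtain N where N: "\<forall>R\<ge>N. c * (R ^ k / exp R) < 1 / 2"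
    unfolding eventually_at_top_linorder by blast
  show ?thesis
  proof (intro exI conjI allI impI)
    show "max 8 N \<ge> 8" by simp
    fix R assume "R \<ge> max 8 N"
    then have "c * (R ^ k / exp R) < 1 / 2" using N by simp
    moreover have "c * R ^ k * exp (- R) = c * (R ^ k / exp R)"
      by (simp only: exp_minus divide_inverse mult.assoc)
    ultimately show "c * R ^ k * exp (- R) \<le> 1 / 2" by linarith
  qed
qed

theorem theorem2p1:
  fixes C\<^sub>0 :: real
  assumes n2: "CARD('n::finite) \<ge> 2"
      and C0pos: "C\<^sub>0 > 0"
  shows "\<exists>C>0. \<exists>R\<^sub>0\<ge>1. \<forall>(V :: real^'n \<Rightarrow> real) u.
           V \<in> borel_measurable lborel \<longrightarrow>
           (AE x in lborel. \<bar>V x\<bar> \<le> 1) \<longrightarrow>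
           solves_schrodinger V u \<longrightarrow>
           (\<forall>x. \<bar>u x\<bar> \<le> exp (C\<^sub>0 * norm x powr (4/3))) \<longrightarrow>
           L2_norm_on u (ball 0 1) \<ge> 1 \<longrightarrow>
           (\<forall>R x\<^sub>0. R \<ge> R\<^sub>0 \<longrightarrow> norm x\<^sub>0 = R \<longrightarrow>
              L2_norm_on u (ball x\<^sub>0 1) \<ge> exp (- C * R powr (4/3) * ln R))"
proof -
  define n where "n = real CARD('n)"
  define K where "K = 512 * (2304 + 72 * n)\<^sup>2 * (578 + 18 * n)"
  \<comment> \<open>On the region in use |x0 + y| <= R + (4 R + 1) <= 6 R, so |u| <= exp(D R^(4/3))
    there.\<close>
  define D where "D = C\<^sub>0 * 6 powr (4/3)"
  \<comment> \<open>The 4 gives a^3 >= 64 R^4, enough to absorb the potential. The 2 D cancels the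
    growth of u^2 in the outer error and leaves exp(-4 R^(4/3)).\<close>
  define A where "A = 4 + 2 * D"
  \<comment> \<open>9 A is the loss in the ratio of the weights, ln (2 K) takes care of the constant
    factor, and the division by 2 reflects the square root in the norm.\<close>
  define C where "C = (9 * A + ln (2 * K)) / 2"
  define vol where "vol = measure lborel (ball (0::real^'n) 1)"
  have K: "K \<ge> 1"
  proof -
    have "1 * 1 \<le> (2304 + 72 * n)\<^sup>2 * (578 + 18 * n)"
      by (intro mult_mono one_le_power) (auto simp: n_def)
    then show ?thesis by (simp add: K_def)
  qed
  have D: "D > 0" using C0pos by (simp add: D_def)
  have A: "A \<ge> 4" using D by (simp add: A_def)
  have lnK: "ln (2 * K) \<ge> 0" using K by simp
  have C: "C > 0" using A lnK by (simp add: C_def)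
  obtain R0 where R0: "R0 \<ge> 8" "\<And>R. R \<ge> R0 \<Longrightarrow> (K * vol * 4 ^ CARD('n)) * R ^ (CARD('n) + 4) * exp (- R) \<le> 1 / 2"
    using polynomial_exp_eventually[of "K * vol * 4 ^ CARD('n)" "CARD('n) + 4"] by blast
  have main: "L2_norm_on u (ball x0 1) \<ge> exp (- C * R powr (4/3) * ln R)"
    if V: "V \<in> borel_measurable lborel" "AE x in lborel. \<bar>V x\<bar> \<le> 1" and sol: "solves_schrodinger V u"
      and growth: "\<And>x. \<bar>u x\<bar> \<le> exp (C\<^sub>0 * norm x powr (4/3))" and unit: "L2_norm_on u (ball 0 1) \<ge> 1"
      and RR: "R \<ge> R0" and x0: "norm x0 = R"
    for V u :: "real^'n \<Rightarrow> real" and R x0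
  proof -
    have R: "R \<ge> 8" using RR R0 by simp
    have um: "u \<in> borel_measurable borel" using sol by (auto simp: solves_schrodinger_def)
    define T where "T = R powr (4/3)"
    have TR: "T \<ge> R" using R powr_mono[of 1 "4/3" R] by (simp add: T_def)
    \<comment> \<open>This identity makes a^3 comparable with R^4, so that the gain a^3/R^2 exceeds
      the cost R^2 of the potential.\<close>
    have T3: "T ^ 3 = R ^ 4"
    proof -
      have "T ^ 3 = R powr (4/3 * real 3)" unfolding T_def using R by (subst powr_powr[symmetric]) (simp add: powr_realpow)
      also have "\<dots> = R powr (real 4)" by simp
      also have "\<dots> = R ^ 4" using R by (subst powr_realpow) auto
      finally show ?thesis .
    qed
    define a where "a = A * T"
    have a: "a \<ge> 32" unfolding a_def using A TR R mult_mono[of 4 A 8 T] by simp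
    define b where "b = a / (8 * R\<^sup>2)"
    define M where "M = exp (D * T)"
    have uM: "\<bar>u (x0 + y)\<bar> \<le> M" if "norm y \<le> 4 * R + 1" for y
    proof -
      have "norm (x0 + y) \<le> 6 * R" using that x0 R norm_triangle_ineq[of x0 y] by linarith
      then have "norm (x0 + y) powr (4/3) \<le> (6 * R) powr (4/3)" by (intro powr_mono2) auto
      also have "\<dots> = 6 powr (4/3) * T" using R by (simp add: powr_mult T_def)
      finally have "C\<^sub>0 * norm (x0 + y) powr (4/3) \<le> D * T"
        using C0pos by (simp add: D_def mult.assoc)
      then show ?thesis using growth[of "x0 + y"] unfolding M_def by (meson exp_le_cancel_iff order_trans)
    qed
    define W where "W = (\<lambda>s. (wt a b s)\<^sup>2)"
    have Wpos: "W s > 0" for s using wt_pos[of a b s] by (simp add: W_def)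
    define w2 where "w2 = (\<lambda>x::real^'n. (wt a b (x \<bullet> x) * cutoff R (x \<bullet> x))\<^sup>2)"
    define I where "I = (\<lambda>r. \<integral>x. indicator (ball 0 r) x * (u (x0 + x))\<^sup>2 \<partial>lborel)"
    have R1: "R \<ge> 1" and a1: "a \<ge> 1" using R a by auto
    have cw1: "(16 * b * (a\<^sup>2 - 1) - 16 * R\<^sup>2) * (\<integral>x. (x \<bullet> x) * w2 x * (u (x0 + x))\<^sup>2 \<partial>lborel)
        \<le> K * (W (1/4) * I 1 + R ^ 4 * W (4 * R\<^sup>2) * I (4 * R))"
      unfolding w2_def W_def I_def K_def n_def b_def by (rule carleman_weak(1)[OF sol V uM R1 a1])
    have cw2: "integrable lborel (\<lambda>x. (x \<bullet> x) * w2 x * (u (x0 + x))\<^sup>2)"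
      unfolding w2_def b_def by (rule carleman_weak(2)[OF sol V uM R1 a1])
    \<comment> \<open>Seen from x0, the unit ball at the origin lies between the distances R - 1 and
      R + 1, hence in 1 <= s <= 2 R^2. There the cutoff is 1 and the decreasing weight is at least
      its value at 2 R^2.\<close>
    have lower: "W (2 * R\<^sup>2) \<le> (\<integral>x. (x \<bullet> x) * w2 x * (u (x0 + x))\<^sup>2 \<partial>lborel)"
    proof -
      have int1: "(\<integral>x. indicator (ball (0 - x0) 1) x * (u (x0 + x))\<^sup>2 \<partial>lborel) \<ge> 1"
        using unit unfolding L2_norm_on_ball[OF um, of 0 1 x0] by simp
      have "W (2 * R\<^sup>2) * 1 \<le> W (2 * R\<^sup>2) * (\<integral>x. indicator (ball (0 - x0) 1) x * (u (x0 + x))\<^sup>2 \<partial>lborel)"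
        using int1 Wpos[of "2 * R\<^sup>2"] by (intro mult_left_mono) auto
      also have "\<dots> = (\<integral>x. W (2 * R\<^sup>2) * (indicator (ball (0 - x0) 1) x * (u (x0 + x))\<^sup>2) \<partial>lborel)"
        by simp
      also have "\<dots> \<le> (\<integral>x. (x \<bullet> x) * w2 x * (u (x0 + x))\<^sup>2 \<partial>lborel)"
      proof (rule integral_mono'[OF cw2])
        fix x
        show "0 \<le> (x \<bullet> x) * w2 x * (u (x0 + x))\<^sup>2" by (simp add: w2_def)
        show "W (2 * R\<^sup>2) * (indicator (ball (0 - x0) 1) x * (u (x0 + x))\<^sup>2) \<le> (x \<bullet> x) * w2 x * (u (x0 + x))\<^sup>2"
        proof (cases "x \<in> ball (0 - x0) 1")
          case False
          then show ?thesis by (simp add: w2_def)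
        next
          case True
          then have "norm (x0 + x) < 1" by (simp add: dist_norm norm_minus_commute add.commute)
          then have "R - 1 \<le> norm x" "norm x \<le> R + 1"
            using x0 norm_triangle_ineq4[of "x0 + x" x] norm_triangle_ineq4[of "x0 + x" x0] by auto
          then have nx: "1 \<le> norm x" "norm x \<le> R + 1" using R by auto
          have "(norm x)\<^sup>2 \<ge> 1" using nx by simp
          moreover have "(norm x)\<^sup>2 \<le> (R + 1)\<^sup>2" using nx by (intro power_mono) auto
          moreover have "(R + 1)\<^sup>2 \<le> 2 * R\<^sup>2"
          proof -
            have "8 * R \<le> R * R" using R by (intro mult_right_mono) auto
            moreover have "(R + 1)\<^sup>2 = R * R + 2 * R + 1" by (simp add: power2_eq_square algebra_simps)
            ultimately show ?thesis using R unfolding power2_eq_square[of R] by linarith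
          qed
          ultimately have s: "1 \<le> x \<bullet> x" "x \<bullet> x \<le> 2 * R\<^sup>2" by (auto simp: power2_norm_eq_inner)
          have "cutoff R (x \<bullet> x) = 1" using s R by (intro cutoff_eq_1) auto
          then have w: "w2 x = W (x \<bullet> x)" by (simp add: w2_def W_def)
          have "wt a b (2 * R\<^sup>2) \<le> wt a b (x \<bullet> x)"
            using s a R by (intro wt_antimono) (auto simp: b_def)
          then have "W (2 * R\<^sup>2) \<le> W (x \<bullet> x)"
            unfolding W_def using wt_pos[of a b "2 * R\<^sup>2"] by (intro power_mono) auto
          also have "\<dots> \<le> (x \<bullet> x) * W (x \<bullet> x)"
            using mult_right_mono[OF s(1), of "W (x \<bullet> x)"] Wpos[of "x \<bullet> x"] by simp
          finally have "W (2 * R\<^sup>2) * (u (x0 + x))\<^sup>2 \<le> (x \<bullet> x) * W (x \<bullet> x) * (u (x0 + x))\<^sup>2"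
            by (intro mult_right_mono) auto
          then show ?thesis using True w by simp
        qed
      qed
      finally show ?thesis by simp
    qed
    have coeff: "16 * b * (a\<^sup>2 - 1) - 16 * R\<^sup>2 \<ge> 1"
    proof -
      have "64 * R ^ 4 \<le> A ^ 3 * R ^ 4"
        using A power_mono[of 4 A 3] by (intro mult_right_mono) auto
      also have "\<dots> = a ^ 3" by (simp add: a_def power_mult_distrib T3)
      also have "\<dots> \<le> 2 * a * (a\<^sup>2 - 1)"
      proof -
        have "a\<^sup>2 \<ge> 2" using a power_mono[of 32 a 2] by simp
        then have "a * 2 \<le> a * a\<^sup>2" using a by (intro mult_left_mono) auto
        then show ?thesis by (simp add: power3_eq_cube power2_eq_square algebra_simps)
      qed
      finally have "64 * R ^ 4 \<le> 2 * a * (a\<^sup>2 - 1)" .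
      then have "64 * R\<^sup>2 \<le> 2 * a * (a\<^sup>2 - 1) / R\<^sup>2"
        using R by (simp add: field_simps power2_eq_square power4_eq_xxxx)
      also have "\<dots> = 16 * b * (a\<^sup>2 - 1)" using R by (simp add: b_def field_simps)
      finally have "16 * b * (a\<^sup>2 - 1) - 16 * R\<^sup>2 \<ge> 48 * R\<^sup>2" by simp
      moreover have "R\<^sup>2 \<ge> 1" using R by (simp add: one_le_power)
      ultimately show ?thesis by linarith
    qed
    have upper: "W (2 * R\<^sup>2) \<le> K * (W (1/4) * I 1 + R ^ 4 * W (4 * R\<^sup>2) * I (4 * R))"
    proof -
      let ?L = "\<integral>x. (x \<bullet> x) * w2 x * (u (x0 + x))\<^sup>2 \<partial>lborel"
      have "?L \<ge> 0" using lower Wpos[of "2 * R\<^sup>2"] by linarith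
      then have "1 * ?L \<le> (16 * b * (a\<^sup>2 - 1) - 16 * R\<^sup>2) * ?L" using coeff by (intro mult_right_mono)
      then show ?thesis using lower cw1 by linarith
    qed
    \<comment> \<open>The factor exp(-a) from the weights against exp(2 D T) from u^2 leaves exp(-4
      T). The powers of R from the volume and from the cutoff error are absorbed by the choice of
      \<open>R0\<close>, and half of the lower bound survives.\<close>
    have outer: "K * (R ^ 4 * W (4 * R\<^sup>2) * I (4 * R)) \<le> 1 / 2 * W (2 * R\<^sup>2)"
    proof -
      have I4: "I (4 * R) \<le> vol * (4 * R) ^ CARD('n) * exp (2 * D * T)"
      proof -
        have "I (4 * R) \<le> (\<integral>x. exp (2 * D * T) * indicator (ball 0 (4 * R)) (x::real^'n) \<partial>lborel)"
          unfolding I_def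
        proof (rule integral_mono')
          show "integrable lborel (\<lambda>x. exp (2 * D * T) * indicator (ball 0 (4 * R)) (x::real^'n))"
            by (auto intro!: integrable_real_indicator emeasure_lborel_ball_finite)
          fix x :: "real^'n"
          show "indicator (ball 0 (4 * R)) x * (u (x0 + x))\<^sup>2 \<le> exp (2 * D * T) * indicator (ball 0 (4 * R)) x"
          proof (cases "norm x < 4 * R")
            case True
            have "(u (x0 + x))\<^sup>2 \<le> M\<^sup>2"
              using uM[of x] True by (intro power2_le_iff_abs_le[THEN iffD2]) (auto simp: M_def)
            also have "M\<^sup>2 = exp (2 * D * T)" by (simp add: M_def power2_eq_square mult_exp_exp)
            finally show ?thesis using True by simp
          qed auto
        qed auto
        also have "\<dots> = exp (2 * D * T) * measure lborel (ball (0::real^'n) (4 * R))" by simp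
        also have "measure lborel (ball (0::real^'n) (4 * R)) = vol * (4 * R) ^ CARD('n)"
          using R content_ball_conv_unit_ball[of "4 * R" "0::real^'n"] by (simp add: vol_def)
        finally show ?thesis by (simp add: mult_ac)
      qed
      have "K * (R ^ 4 * W (4 * R\<^sup>2) * I (4 * R))
         \<le> K * (R ^ 4 * (exp (- a) * W (2 * R\<^sup>2)) * (vol * (4 * R) ^ CARD('n) * exp (2 * D * T)))"
      proof (intro mult_left_mono mult_mono I4)
        show "W (4 * R\<^sup>2) \<le> exp (- a) * W (2 * R\<^sup>2)"
          unfolding W_def b_def using R a by (intro outer_weight_ratio) auto
        show "0 \<le> I (4 * R)" unfolding I_def by (intro integral_nonneg_AE) auto
      qed (use K R Wpos[of "2 * R\<^sup>2"] in auto)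
      also have "\<dots> = (K * vol * 4 ^ CARD('n) * R ^ (CARD('n) + 4) * exp (- 4 * T)) * W (2 * R\<^sup>2)"
      proof -
        have "exp (- a) * exp (2 * D * T) = exp (- 4 * T)"
          by (simp add: mult_exp_exp a_def A_def algebra_simps)
        then show ?thesis by (simp add: power_mult_distrib power_add mult_ac)
      qed
      also have "\<dots> \<le> 1 / 2 * W (2 * R\<^sup>2)"
      proof (rule mult_right_mono)
        have "K * vol * 4 ^ CARD('n) * R ^ (CARD('n) + 4) * exp (- 4 * T) \<le> K * vol * 4 ^ CARD('n) * R ^ (CARD('n) + 4) * exp (- R)"
          using TR R K by (intro mult_left_mono) (auto simp: vol_def)
        also have "\<dots> \<le> 1 / 2" using R0(2)[OF RR] .
        finally show "K * vol * 4 ^ CARD('n) * R ^ (CARD('n) + 4) * exp (- 4 * T) \<le> 1 / 2" .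
      qed (use Wpos[of "2 * R\<^sup>2"] in simp)
      finally show ?thesis .
    qed
    have "W (2 * R\<^sup>2) \<le> (2 * K * I 1) * W (1/4)"
      using upper outer by (simp add: algebra_simps)
    moreover have "exp (- (9 * a * ln R)) * W (1/4) \<le> W (2 * R\<^sup>2)"
      unfolding W_def b_def using inner_weight_ratio[OF R a1] by simp
    ultimately have "exp (- (9 * a * ln R)) * W (1/4) \<le> (2 * K * I 1) * W (1/4)" by linarith
    then have I1: "exp (- (9 * a * ln R)) \<le> 2 * K * I 1" using Wpos[of "1/4"] by simp
    have "(exp (- C * T * ln R))\<^sup>2 \<le> I 1"
    proof -
      have "ln R \<ge> 1"
      proof -
        have "exp 1 \<le> R" using R exp_le by linarith
        then show ?thesis using R by (subst ln_ge_iff) auto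
      qed
      \<comment> \<open>Since T ln R >= 1, the constant ln (2 K) can be hidden in a multiple of T ln
        R.\<close>
      then have "1 * 1 \<le> T * ln R" using TR R by (intro mult_mono) auto
      then have "ln (2 * K) * 1 \<le> ln (2 * K) * (T * ln R)" using lnK by (intro mult_left_mono) auto
      then have "ln (2 * K) + 9 * a * ln R \<le> 2 * C * T * ln R"
        by (simp add: C_def a_def algebra_simps add_divide_distrib)
      then have "exp (- (2 * C * T * ln R)) \<le> exp (- (ln (2 * K) + 9 * a * ln R))" by simp
      also have "\<dots> = exp (- (9 * a * ln R)) / (2 * K)"
        using K by (simp add: exp_diff exp_minus exp_add field_simps)
      also have "\<dots> \<le> I 1" using I1 K by (simp add: field_simps)
      finally show ?thesis by (simp add: power2_eq_square mult_exp_exp algebra_simps)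
    qed
    then have "exp (- C * T * ln R) \<le> sqrt (I 1)" by (rule real_le_rsqrt)
    moreover have "L2_norm_on u (ball x0 1) = sqrt (I 1)"
      using L2_norm_on_ball[OF um, of x0 1 x0] by (simp add: I_def)
    ultimately show ?thesis by (simp add: T_def)
  qed
  show ?thesis
  proof (rule exI[of _ C], intro conjI exI[of _ R0] allI impI C)
    show "R0 \<ge> 1" using R0(1) by simp
  qed (rule main, auto)
qed

end
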